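(* Let $f_1 \in M^\infty(\mathbb{R})$ and let $\mathcal{W}_S$ be a stationary, circularly symmetric generalized complex Gaussian process whose power spectral density (PSD) $S:\mathbb{R}\to[0,\infty)$ is a non-zero (i.e. not almost everywhere zero) measurable function with polynomial growth. Let $f = f_1 + \mathcal{W}_S$. Let $$S_\phi(\omega) = \int_{-\infty}^{\infty} e^{-2\pi(t-\omega)^2} S(t)\,dt,\qquad \omega\in\mathbb{R},$$ be the smoothed PSD, and $$\Gamma(\tau,\omega) = \frac{\mathrm{Spec}_{f_1}(\tau,\omega)}{S_\phi(\omega)},\qquad (\tau,\omega)\in\mathbb{R}^2.$$ Set $$\rho_{1,\mathrm{Spec}}(\tau,\omega) := \Big[1 + \tfrac{1}{4\pi}(\log S_\phi)''(\omega) + \tfrac{1}{\sqrt2}\,\widetilde{\Gamma}(\tau,\omega)\Big]\exp\Big(-\tfrac{1}{\sqrt2}\,\Gamma(\tau,\omega)\Big),\qquad (\tau,\omega)\in\mathbb{R}^2,$$ where $$\widetilde{\Gamma}(\tau,\omega) = \frac{1}{4\pi}\,\frac{\Delta \mathrm{Spec}_{f_1}(\tau,\omega)}{S_\phi(\omega)} - \frac{1}{2\pi}(\log S_\phi)'(\omega)\cdot\frac{\frac{\partial}{\partial\omega}\mathrm{Spec}_{f_1}(\tau,\omega)}{S_\phi(\omega)} + \Big(1+\frac{1}{4\pi}\big[(\log S_\phi)'(\omega)\big]^2\Big)\,\Gamma(\tau,\omega)$$ and $\Delta$ is the Laplacian with respect to $(\tau,\omega)$. Then, for any Borel set $\Omega\subset\mathbb{R}^2$,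 $$\mathbb{E}\big[N_{\mathrm{Spec}_f}(\Omega)\big] = \int_\Omega \rho_{1,\mathrm{Spec}}(\tau,\omega)\,d\tau\,d\omega .$$
   Context: Notation. $\mathcal{S}(\mathbb{R})$ is the Schwartz space and $\mathcal{S}'(\mathbb{R})$ the space of tempered distributions. The Fourier transform is $\mathcal{F}\{g\}(\omega)=\int_{\mathbb{R}} g(t)e^{-2\pi i t\omega}\,dt$. Write $\mathcal{M}_y g(t)=e^{2\pi i y t}g(t)$ and $\mathcal{T}_x g(t)=g(t-x)$. The pairing $\langle f,\psi\rangle$ is conjugate-linear in $\psi$ (it extends $\int f\overline{\psi}$). STFT. The window is $\varphi(t)=2^{1/4}e^{-\pi t^2}$. For a tempered distribution $f$, the short-time Fourier transform is $V_\varphi f(x,\omega)=\langle f,\mathcal{M}_\omega\mathcal{T}_x\varphi\rangle$, which for functions equals $\int f(t)\overline{\varphi(t-x)}e^{-2\pi i\omega t}dt$; it is a smooth function on $\mathbb{R}^2$. The spectrogram is $\mathrm{Spec}_f(\tau,\omega)=|V_\varphi f(\tau,\omega)|^2$. For a Borel set $\Omega\subset\mathbb{R}^2$, $N_{\mathrm{Spec}_f}(\Omega)=\#\{(\tau,\omega)\in\Omega: \mathrm{Spec}_f(\tau,\omega)=0\}$. Modulation space. $M^\infty(\mathbb{R})=\{f\in\mathcal{S}'(\mathbb{R}): \sup_{\tau,\omega\in\mathbb{R}}|V_\varphi f(\tau,\omega)|<\infty\}$. Elements $f_1$ are deterministic. Noise. Polynomial growth of $S$ means that there is $n>0$ with $\sup_{\omega\in\mathbb{R}}(1+|\omega|)^{-n}|S(\omega)|<\infty$.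 A stationary, circularly symmetric generalized complex Gaussian process $\mathcal{W}_S$ with PSD $S$ is a linear map $\mathcal{W}_S:\mathcal{S}(\mathbb{R})\to L^2(\Xi,\mathcal{A},\mathbb{P})$ into complex random variables on a probability space, such that: (1) for all $\phi_1,\dots,\phi_n\in\mathcal{S}(\mathbb{R})$ the vector $(\mathcal{W}_S(\phi_1),\dots,\mathcal{W}_S(\phi_n))$ is circularly symmetric jointly complex Gaussian (in particular zero mean and zero pseudo-covariance); (2) if $\phi_k\to0$ in $\mathcal{S}(\mathbb{R})$ then $\mathbb{E}[|\mathcal{W}_S(\phi_k)|^2]\to0$; (3) for all $\psi_1,\psi_2\in\mathcal{S}(\mathbb{R})$, $\mathbb{E}[\langle\mathcal{W}_S,\psi_1\rangle\overline{\langle\mathcal{W}_S,\psi_2\rangle}]=\int_{\mathbb{R}}\mathcal{F}\{\psi_2\}(\omega)\overline{\mathcal{F}\{\psi_1\}(\omega)}S(\omega)\,d\omega$. Here $\langle\mathcal{W}_S,\psi\rangle=\mathcal{W}_S(\overline{\psi})$. Almost every realization of $\mathcal{W}_S$ is a tempered distribution (i.e. one works with such a version), so that $V_\varphi\mathcal{W}_S$ and $V_\varphi f$ are almost surely well-defined smooth functions on $\mathbb{R}^2$. *)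

theory Defs
  imports "HOL-Probability.Probability"
begin

section \<open>Schwartz space and tempered distributions on the real line\<close>

definition nth_vderiv :: "nat \<Rightarrow> (real \<Rightarrow> complex) \<Rightarrow> real \<Rightarrow> complex" where
  "nth_vderiv k \<phi> = ((\<lambda>g t. vector_derivative g (at t)) ^^ k) \<phi>"

definition schwartz :: "(real \<Rightarrow> complex) set" where
  "schwartz = {\<phi>. (\<forall>k t. nth_vderiv k \<phi> differentiable (at t)) \<and>
                   (\<forall>j k. bounded (range (\<lambda>t. of_real (t ^ j) * nth_vderiv k \<phi> t)))}"

definition schwartz_seminorm :: "nat \<Rightarrow> nat \<Rightarrow> (real \<Rightarrow> complex) \<Rightarrow> real" where
  "schwartz_seminorm j k \<phi> = (SUP t. cmod (of_real (t ^ j) * nth_vderiv k \<phi> t))"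

definition schwartz_null_seq :: "(nat \<Rightarrow> real \<Rightarrow> complex) \<Rightarrow> bool" where
  "schwartz_null_seq \<Phi> \<longleftrightarrow> (\<forall>m. \<Phi> m \<in> schwartz) \<and>
     (\<forall>j k. (\<lambda>m. schwartz_seminorm j k (\<Phi> m)) \<longlonglongrightarrow> 0)"

text \<open>The Schwartz space is metrizable, so sequential continuity at 0 characterises
  continuity of a linear functional. Values outside \<^const>\<open>schwartz\<close> are irrelevant.\<close>

definition tempered_distribution :: "((real \<Rightarrow> complex) \<Rightarrow> complex) \<Rightarrow> bool" where
  "tempered_distribution u \<longleftrightarrow>
     (\<forall>\<phi>\<in>schwartz. \<forall>\<psi>\<in>schwartz. \<forall>a b. u (\<lambda>t. a * \<phi> t + b * \<psi> t) = a * u \<phi> + b * u \<psi>) \<and>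
     (\<forall>\<Phi>. schwartz_null_seq \<Phi> \<longrightarrow> (\<lambda>m. u (\<Phi> m)) \<longlonglongrightarrow> 0)"

text \<open>A distribution acts linearly on test functions; the pairing is the sesquilinear one,
  conjugate-linear in the test function.\<close>

definition pairing :: "((real \<Rightarrow> complex) \<Rightarrow> complex) \<Rightarrow> (real \<Rightarrow> complex) \<Rightarrow> complex" where
  "pairing u \<psi> = u (\<lambda>t. cnj (\<psi> t))"

section \<open>Fourier transform, short-time Fourier transform, spectrogram\<close>

definition fourier :: "(real \<Rightarrow> complex) \<Rightarrow> real \<Rightarrow> complex" where
  "fourier g \<omega> = (\<integral>t. g t * exp (- 2 * of_real pi * \<i> * of_real t * of_real \<omega>) \<partial>lebesgue)"

definition modulation :: "real \<Rightarrow> (real \<Rightarrow> complex) \<Rightarrow> real \<Rightarrow> complex" where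
  "modulation y g t = exp (2 * of_real pi * \<i> * of_real y * of_real t) * g t"

definition translation :: "real \<Rightarrow> (real \<Rightarrow> complex) \<Rightarrow> real \<Rightarrow> complex" where
  "translation x g t = g (t - x)"

definition gauss_window :: "real \<Rightarrow> complex" where
  "gauss_window t = of_real (2 powr (1/4) * exp (- pi * t\<^sup>2))"

definition stft :: "((real \<Rightarrow> complex) \<Rightarrow> complex) \<Rightarrow> real \<Rightarrow> real \<Rightarrow> complex" where
  "stft u x \<omega> = pairing u (modulation \<omega> (translation x gauss_window))"

definition spectrogram :: "((real \<Rightarrow> complex) \<Rightarrow> complex) \<Rightarrow> real \<Rightarrow> real \<Rightarrow> real" where
  "spectrogram u \<tau> \<omega> = (cmod (stft u \<tau> \<omega>))\<^sup>2"

definition spec_zero_count ::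
    "((real \<Rightarrow> complex) \<Rightarrow> complex) \<Rightarrow> (real \<times> real) set \<Rightarrow> ennreal" where
  "spec_zero_count u \<Omega> =
     emeasure (count_space UNIV) {(\<tau>, \<omega>). (\<tau>, \<omega>) \<in> \<Omega> \<and> spectrogram u \<tau> \<omega> = 0}"

definition modulation_space_infty :: "((real \<Rightarrow> complex) \<Rightarrow> complex) set" where
  "modulation_space_infty =
     {u. tempered_distribution u \<and> bdd_above (range (\<lambda>(\<tau>, \<omega>). cmod (stft u \<tau> \<omega>)))}"

section \<open>Stationary circularly symmetric generalized complex Gaussian processes\<close>

text \<open>Degenerate (almost surely constant) variables count as Gaussian.\<close>

definition real_gaussian :: "'x measure \<Rightarrow> ('x \<Rightarrow> real) \<Rightarrow> bool" where
  "real_gaussian M X \<longleftrightarrow>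
     (\<exists>\<mu> \<sigma>. \<sigma> > 0 \<and> distributed M lborel X (\<lambda>x. ennreal (normal_density \<mu> \<sigma> x))) \<or>
     (X \<in> borel_measurable M \<and> (\<exists>\<mu>. AE \<xi> in M. X \<xi> = \<mu>))"

text \<open>A complex random vector \<open>Z 0, \<dots>, Z (n - 1)\<close> is jointly complex Gaussian if
  the \<open>2n\<close> real variables formed by the real and imaginary parts are jointly Gaussian.\<close>

definition jointly_complex_gaussian :: "'x measure \<Rightarrow> nat \<Rightarrow> (nat \<Rightarrow> 'x \<Rightarrow> complex) \<Rightarrow> bool" where
  "jointly_complex_gaussian M n Z \<longleftrightarrow>
     (\<forall>i<n. Z i \<in> borel_measurable M) \<and>
     (\<forall>a b :: nat \<Rightarrow> real.
        real_gaussian M (\<lambda>\<xi>. \<Sum>i<n. a i * Re (Z i \<xi>) + b i * Im (Z i \<xi>)))"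

text \<open>The law of the vector is invariant under a common rotation of the phase.\<close>

definition circularly_symmetric :: "'x measure \<Rightarrow> nat \<Rightarrow> (nat \<Rightarrow> 'x \<Rightarrow> complex) \<Rightarrow> bool" where
  "circularly_symmetric M n Z \<longleftrightarrow>
     (\<forall>\<theta>::real. distr M (Pi\<^sub>M {..<n} (\<lambda>_. borel)) (\<lambda>\<xi>. \<lambda>i\<in>{..<n}. cis \<theta> * Z i \<xi>)
              = distr M (Pi\<^sub>M {..<n} (\<lambda>_. borel)) (\<lambda>\<xi>. \<lambda>i\<in>{..<n}. Z i \<xi>))"

text \<open>The process is represented by a choice of random variables \<open>W \<phi>\<close>, of which only the
  classes modulo almost sure equality matter here; in particular linearity is an
  identity in \<open>L\<^sup>2\<close>, i.e. almost sure for each pair of test functions.\<close>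

definition stationary_gaussian_process ::
    "'x measure \<Rightarrow> (real \<Rightarrow> real) \<Rightarrow> ((real \<Rightarrow> complex) \<Rightarrow> 'x \<Rightarrow> complex) \<Rightarrow> bool" where
  "stationary_gaussian_process M S W \<longleftrightarrow>
     (\<forall>\<phi>\<in>schwartz. W \<phi> \<in> borel_measurable M \<and> integrable M (\<lambda>\<xi>. (cmod (W \<phi> \<xi>))\<^sup>2)) \<and>
     (\<forall>\<phi>\<in>schwartz. \<forall>\<psi>\<in>schwartz. \<forall>a b.
        AE \<xi> in M. W (\<lambda>t. a * \<phi> t + b * \<psi> t) \<xi> = a * W \<phi> \<xi> + b * W \<psi> \<xi>) \<and>
     (\<forall>n \<phi>. (\<forall>i<n. \<phi> i \<in> schwartz) \<longrightarrow>
        jointly_complex_gaussian M n (\<lambda>i. W (\<phi> i)) \<and> circularly_symmetric M n (\<lambda>i. W (\<phi> i))) \<and>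
     (\<forall>\<Phi>. schwartz_null_seq \<Phi> \<longrightarrow> (\<lambda>m. \<integral>\<xi>. (cmod (W (\<Phi> m) \<xi>))\<^sup>2 \<partial>M) \<longlonglongrightarrow> 0) \<and>
     (\<forall>\<psi>1\<in>schwartz. \<forall>\<psi>2\<in>schwartz.
        (\<integral>\<xi>. pairing (\<lambda>\<phi>. W \<phi> \<xi>) \<psi>1 * cnj (pairing (\<lambda>\<phi>. W \<phi> \<xi>) \<psi>2) \<partial>M) =
        (\<integral>\<omega>. fourier \<psi>2 \<omega> * cnj (fourier \<psi>1 \<omega>) * of_real (S \<omega>) \<partial>lebesgue))"

definition polynomial_growth :: "(real \<Rightarrow> real) \<Rightarrow> bool" where
  "polynomial_growth S \<longleftrightarrow>
     (\<exists>n::real. n > 0 \<and> bdd_above (range (\<lambda>\<omega>. (1 + \<bar>\<omega>\<bar>) powr (- n) * \<bar>S \<omega>\<bar>)))"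

section \<open>First intensity of the zeros\<close>

definition smoothed_psd :: "(real \<Rightarrow> real) \<Rightarrow> real \<Rightarrow> real" where
  "smoothed_psd S \<omega> = (\<integral>t. exp (- 2 * pi * (t - \<omega>)\<^sup>2) * S t \<partial>lebesgue)"

definition log_smoothed_psd :: "(real \<Rightarrow> real) \<Rightarrow> real \<Rightarrow> real" where
  "log_smoothed_psd S \<omega> = ln (smoothed_psd S \<omega>)"

definition laplacian :: "(real \<Rightarrow> real \<Rightarrow> real) \<Rightarrow> real \<Rightarrow> real \<Rightarrow> real" where
  "laplacian P \<tau> \<omega> = deriv (deriv (\<lambda>t. P t \<omega>)) \<tau> + deriv (deriv (\<lambda>w. P \<tau> w)) \<omega>"

definition snr :: "(real \<Rightarrow> real) \<Rightarrow> ((real \<Rightarrow> complex) \<Rightarrow> complex) \<Rightarrow> real \<Rightarrow> real \<Rightarrow> real" where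
  "snr S f1 \<tau> \<omega> = spectrogram f1 \<tau> \<omega> / smoothed_psd S \<omega>"

definition snr_tilde ::
    "(real \<Rightarrow> real) \<Rightarrow> ((real \<Rightarrow> complex) \<Rightarrow> complex) \<Rightarrow> real \<Rightarrow> real \<Rightarrow> real" where
  "snr_tilde S f1 \<tau> \<omega> =
     1 / (4 * pi) * (laplacian (spectrogram f1) \<tau> \<omega> / smoothed_psd S \<omega>)
     - 1 / (2 * pi) * deriv (log_smoothed_psd S) \<omega>
         * (deriv (\<lambda>w. spectrogram f1 \<tau> w) \<omega> / smoothed_psd S \<omega>)
     + (1 + 1 / (4 * pi) * (deriv (log_smoothed_psd S) \<omega>)\<^sup>2) * snr S f1 \<tau> \<omega>"

definition rho1_spec ::
    "(real \<Rightarrow> real) \<Rightarrow> ((real \<Rightarrow> complex) \<Rightarrow> complex) \<Rightarrow> real \<Rightarrow> real \<Rightarrow> real" where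
  "rho1_spec S f1 \<tau> \<omega> =
     (1 + 1 / (4 * pi) * deriv (deriv (log_smoothed_psd S)) \<omega>
        + 1 / sqrt 2 * snr_tilde S f1 \<tau> \<omega>)
     * exp (- (1 / sqrt 2) * snr S f1 \<tau> \<omega>)"

end

theory Submission
  imports Defs "HOL-Complex_Analysis.Complex_Analysis"
begin

text \<open>Up to a nonvanishing factor, the short-time Fourier transform with Gaussian window is the entire
  function \<open>z \<mapsto> u (\<lambda>t. exp (- pi * (t - z)\<^sup>2))\<close> of \<open>z = \<tau> - \<i> \<omega>\<close>. So the zeros in question are those of
  \<open>G + X\<close> with \<open>G\<close> entire and \<open>X\<close> a Gaussian analytic function. Near a point \<open>z0\<close> write
  \<open>X z = a z * \<zeta> + Y z\<close> with \<open>\<zeta> = X z0\<close>, where \<open>a\<close> is nonvanishing and \<open>Y\<close> is independent of \<open>\<zeta>\<close>. The zeros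
  of \<open>G + X\<close> are the points where \<open>h = - (G + Y) / a\<close> takes the value \<open>\<zeta>\<close>. Given \<open>Y\<close>, the area formula turns
  the expected number of such points into the integral of \<open>p (h z) * (cmod (deriv h z))\<^sup>2\<close>, where \<open>p\<close> is the
  density of \<open>\<zeta>\<close>; no limit is taken, and since the formula counts points without multiplicity, multiple
  zeros need no separate treatment. The expectation over \<open>Y\<close> is a Gaussian integral at each point, and
  its value does not depend on \<open>z0\<close>, so the local formulas add up.\<close>

section \<open>Independence by characteristic functions\<close>

text \<open>The process is known only through covariances on test functions. Uncorrelated values are
  independent because a sum of values is again a value, whose characteristic function depends on its
  variance alone. Since the zeros depend on the whole path \<open>Y\<close>, this is upgraded from
  pairs to the sigma-algebra generated by all residual values, and zero counts have to be measurable
  with respect to it. The factor \<open>a z\<close> is the covariance of \<open>X z\<close> and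
  \<open>X z0\<close> divided by the variance of \<open>X z0\<close>. It is 1 at \<open>z0\<close>
  but may vanish elsewhere; therefore the formula is local, and the plane is cut into countably many
  pieces. The expectation over \<open>Y\<close> involves \<open>Y z\<close> and its derivative,
  which are correlated. A second regression, of the derivative on the value, separates them. At
  \<open>z = z0\<close> the value \<open>Y z\<close> is 0, so the Gaussian integrals must admit
  variance 0. The two regressions together restore the covariances of \<open>X\<close> and its
  derivative at \<open>z\<close>, and this is why \<open>z0\<close> drops out.\<close>

lemma measurable_cnj [measurable]: "cnj \<in> borel_measurable borel"
  by (intro borel_measurable_continuous_onI continuous_intros)

context prob_space begin

lemma expectation_indicator_complex:
  assumes "A \<in> events" shows "(\<integral>x. indicator A x \<partial>M) = complex_of_real (prob A)"
proof -
  have "(\<integral>x. indicator A x \<partial>M) = (\<integral>x. complex_of_real (indicator A x) \<partial>M)"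
    by (intro Bochner_Integration.integral_cong) (auto simp: indicator_def)
  then show ?thesis using assms by (simp add: integral_complex_of_real)
qed

lemma integrable_bounded_complex:
  fixes Y :: "'a \<Rightarrow> complex"
  assumes "Y \<in> borel_measurable M" "\<And>x. cmod (Y x) \<le> c" shows "integrable M Y"
  by (rule integrable_const_bound[where B=c]) (use assms in auto)

text \<open>Levy's uniqueness theorem is about probability measures; the signed weight \<open>Y\<close> is therefore
  turned into the density \<open>1 + Y / k\<close>.\<close>

lemma fourier_weight_zero_real:
  fixes X Y :: "'a \<Rightarrow> real"
  assumes [measurable]: "X \<in> borel_measurable M" "Y \<in> borel_measurable M"
    and bd: "\<And>x. \<bar>Y x\<bar> \<le> c"
    and zero: "\<And>s. (\<integral>x. iexp (s * X x) * of_real (Y x) \<partial>M) = 0"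
    and A[measurable]: "A \<in> sets borel"
  shows "(\<integral>x. indicator A (X x) * Y x \<partial>M) = 0"
proof -
  \<comment> \<open>The summand 1 keeps \<open>k\<close> positive, and \<open>k\<close> bounds
    \<open>Y\<close>, so the density \<open>1 + Y / k\<close> is nonnegative. The case
    \<open>s = 0\<close> of \<open>zero\<close> says that \<open>Y\<close> has mean zero, so the
    density has total mass 1.\<close>
  define k where "k = \<bar>c\<bar> + 1"
  have k: "k > 0" "\<And>x. \<bar>Y x\<bar> \<le> k" using bd abs_ge_self[of c] by (auto simp: k_def intro: order.trans[OF bd])
  have k1: "1 \<le> k" "0 \<le> k" by (auto simp: k_def)
  define d where "d x = 1 + Y x / k" for x
  have d0: "d x \<ge> 0" for x using k(1) k(2)[of x] by (auto simp: d_def field_simps abs_le_iff)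
  have [measurable]: "d \<in> borel_measurable M" unfolding d_def[abs_def] by measurable
  define M1 where "M1 = density M (\<lambda>x. ennreal (d x))"
  have iY: "integrable M Y" by (rule integrable_const_bound[where B=k]) (use k in auto)
  have Y0: "(\<integral>x. Y x \<partial>M) = 0"
    using zero[of 0] iY by (simp add: integral_complex_of_real)
  have int_d: "integrable M d" unfolding d_def[abs_def] using iY by auto
  have id: "(\<integral>x. d x \<partial>M) = 1" unfolding d_def using iY Y0 by (simp add: prob_space)
  have "prob_space M1"
    by (rule prob_spaceI) (simp add: M1_def emeasure_density nn_integral_eq_integral[OF int_d] d0 id)
  have [measurable_cong]: "sets M1 = sets M" by (simp add: M1_def)
  interpret M1: prob_space M1 by fact
  have iZ: "integrable M (\<lambda>x. iexp (s * X x))" for s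
    by (rule integrable_bounded_complex[where c=1]) auto
  have iZY: "integrable M (\<lambda>x. iexp (s * X x) * of_real (Y x))" for s
    by (rule integrable_bounded_complex[where c=k]) (use k in \<open>auto simp: norm_mult\<close>)
  have "char (distr M1 borel X) = char (distr M borel X)"
  proof
    fix s
    have "char (distr M1 borel X) s = (\<integral>x. iexp (s * X x) \<partial>M1)"
      unfolding char_def by (rule integral_distr) (auto simp: M1_def)
    also have "\<dots> = (\<integral>x. d x *\<^sub>R iexp (s * X x) \<partial>M)"
      unfolding M1_def by (rule integral_density) (auto simp: d0)
    also have "\<dots> = (\<integral>x. iexp (s * X x) + (1 / k) * (iexp (s * X x) * of_real (Y x)) \<partial>M)"
      by (intro Bochner_Integration.integral_cong) (auto simp: d_def scaleR_conv_of_real algebra_simps)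
    also have "\<dots> = (\<integral>x. iexp (s * X x) \<partial>M)"
      using iZ iZY zero[of s] by (subst Bochner_Integration.integral_add) auto
    also have "\<dots> = char (distr M borel X) s"
      unfolding char_def by (rule integral_distr[symmetric]) auto
    finally show "char (distr M1 borel X) s = char (distr M borel X) s" .
  qed
  then have eq: "distr M1 borel X = distr M borel X"
    by (intro Levy_uniqueness real_distribution_distr M1.real_distribution_distr) (auto simp: M1_def)
  have i1: "integrable M (\<lambda>x. indicator A (X x) :: real)" "integrable M (\<lambda>x. indicator A (X x) * Y x)"
    by (auto intro!: integrable_const_bound[where B=1] integrable_const_bound[where B=k] simp: indicator_def k(2) k1)
  have "(\<integral>x. indicator A (X x) \<partial>M) = (\<integral>x. (indicator A x :: real) \<partial>distr M borel X)"
    by (subst integral_distr) auto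
  also have "\<dots> = (\<integral>x. indicator A (X x) \<partial>M1)"
    unfolding eq[symmetric] by (subst integral_distr) (auto simp: M1_def)
  also have "\<dots> = (\<integral>x. d x *\<^sub>R indicator A (X x) \<partial>M)"
    unfolding M1_def by (rule integral_density) (auto simp: d0)
  also have "\<dots> = (\<integral>x. indicator A (X x) + (1 / k) * (indicator A (X x) * Y x) \<partial>M)"
    by (intro Bochner_Integration.integral_cong) (auto simp: d_def algebra_simps)
  also have "\<dots> = (\<integral>x. indicator A (X x) \<partial>M) + (1 / k) * (\<integral>x. indicator A (X x) * Y x \<partial>M)"
    using i1 by (subst Bochner_Integration.integral_add) auto
  finally show ?thesis using k(1) by simp
qed

text \<open>The condition for all real \<open>s\<close> is stable under conjugating
  \<open>Y\<close>, because conjugation turns \<open>iexp (s * X x)\<close> into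
  \<open>iexp (- s * X x)\<close>. Hence it passes to \<open>Re Y\<close> and \<open>Im Y\<close>,
  and the real case applies to each.\<close>

lemma fourier_weight_zero:
  fixes X :: "'a \<Rightarrow> real" and Y :: "'a \<Rightarrow> complex"
  assumes [measurable]: "X \<in> borel_measurable M" "Y \<in> borel_measurable M"
    and bd: "\<And>x. cmod (Y x) \<le> c"
    and zero: "\<And>s. (\<integral>x. iexp (s * X x) * Y x \<partial>M) = 0"
    and A[measurable]: "A \<in> sets borel"
  shows "(\<integral>x. indicator A (X x) * Y x \<partial>M) = 0"
proof -
  have i: "integrable M (\<lambda>x. iexp (s * X x) * Y x)" "integrable M (\<lambda>x. iexp (s * X x) * cnj (Y x))" for s
    by (auto intro!: integrable_bounded_complex[where c=c] simp: norm_mult bd)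
  have zero': "(\<integral>x. iexp (s * X x) * cnj (Y x) \<partial>M) = 0" for s
  proof -
    have "(\<integral>x. iexp (s * X x) * cnj (Y x) \<partial>M) = (\<integral>x. cnj (iexp (- s * X x) * Y x) \<partial>M)"
      by (intro Bochner_Integration.integral_cong) (auto simp: exp_cnj)
    also have "\<dots> = cnj (\<integral>x. iexp (- s * X x) * Y x \<partial>M)" by (rule Bochner_Integration.integral_cnj)
    also have "\<dots> = 0" using zero[of "- s"] by simp
    finally show ?thesis .
  qed
  have zRe: "(\<integral>x. iexp (s * X x) * of_real (Re (Y x)) \<partial>M) = 0" for s
  proof -
    have "(\<integral>x. iexp (s * X x) * of_real (Re (Y x)) \<partial>M) = (\<integral>x. (1/2) * (iexp (s * X x) * Y x + iexp (s * X x) * cnj (Y x)) \<partial>M)"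
      by (intro Bochner_Integration.integral_cong) (auto simp: complex_eq_iff)
    also have "\<dots> = (1/2) * (\<integral>x. iexp (s * X x) * Y x + iexp (s * X x) * cnj (Y x) \<partial>M)"
      by (rule integral_mult_right_zero)
    also have "(\<integral>x. iexp (s * X x) * Y x + iexp (s * X x) * cnj (Y x) \<partial>M) = (\<integral>x. iexp (s * X x) * Y x \<partial>M) + (\<integral>x. iexp (s * X x) * cnj (Y x) \<partial>M)"
      by (rule Bochner_Integration.integral_add[OF i])
    finally show ?thesis using zero zero' by simp
  qed
  have re: "(\<integral>x. indicator A (X x) * Re (Y x) \<partial>M) = 0"
    by (intro fourier_weight_zero_real[where c=c])
       (auto simp del: of_real_mult simp: zRe intro: order.trans[OF abs_Re_le_cmod bd])
  have zIm: "(\<integral>x. iexp (s * X x) * of_real (Im (Y x)) \<partial>M) = 0" for s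
  proof -
    have "(\<integral>x. iexp (s * X x) * of_real (Im (Y x)) \<partial>M) = (\<integral>x. (-\<i>/2) * (iexp (s * X x) * Y x - iexp (s * X x) * cnj (Y x)) \<partial>M)"
      by (intro Bochner_Integration.integral_cong) (auto simp: complex_eq_iff)
    also have "\<dots> = (-\<i>/2) * (\<integral>x. iexp (s * X x) * Y x - iexp (s * X x) * cnj (Y x) \<partial>M)"
      by (rule integral_mult_right_zero)
    also have "(\<integral>x. iexp (s * X x) * Y x - iexp (s * X x) * cnj (Y x) \<partial>M) = (\<integral>x. iexp (s * X x) * Y x \<partial>M) - (\<integral>x. iexp (s * X x) * cnj (Y x) \<partial>M)"
      by (rule Bochner_Integration.integral_diff[OF i])
    finally show ?thesis using zero zero' by simp
  qed
  have im: "(\<integral>x. indicator A (X x) * Im (Y x) \<partial>M) = 0"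
    by (intro fourier_weight_zero_real[where c=c])
       (auto simp del: of_real_mult simp: zIm intro: order.trans[OF abs_Im_le_cmod bd])
  have "integrable M (\<lambda>x. indicator A (X x) * Y x)"
    by (rule integrable_bounded_complex[where c=c]) (auto simp: indicator_def bd order.trans[OF norm_ge_zero bd])
  moreover have Re_ind: "Re (indicator A a * b) = indicator A a * Re b" and Im_ind: "Im (indicator A a * b) = indicator A a * Im b" for a :: real and b
    by (auto simp: indicator_def)
  ultimately have "Re (\<integral>x. indicator A (X x) * Y x \<partial>M) = 0" "Im (\<integral>x. indicator A (X x) * Y x \<partial>M) = 0"
    using re im by (auto simp: integral_Re[symmetric] integral_Im[symmetric] Re_ind Im_ind)
  then show ?thesis by (simp add: complex_eq_iff)
qed

text \<open>Coordinates are converted one at a time: with the other frequencies frozen inside the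
  weight, the exponential of one coordinate is exchanged for an indicator, which then joins the
  weight for the next coordinate. This is why \<open>Y\<close> varies in the induction.\<close>

lemma fourier_weight_zero_finite:
  fixes X :: "'i \<Rightarrow> 'a \<Rightarrow> real" and Y :: "'a \<Rightarrow> complex"
  assumes "finite J" and X[measurable]: "\<And>j. X j \<in> borel_measurable M" and "Y \<in> borel_measurable M"
    and "\<And>x. cmod (Y x) \<le> c"
    and "\<And>t. (\<integral>x. iexp (\<Sum>j\<in>J. t j * X j x) * Y x \<partial>M) = 0"
    and A[measurable]: "\<And>j. A j \<in> sets borel"
  shows "(\<integral>x. (\<Prod>j\<in>J. indicator (A j) (X j x)) * Y x \<partial>M) = 0"
  using assms(1,3-5)
proof (induction J arbitrary: Y rule: finite_induct)
  case empty
  then show ?case by simp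
next
  case (insert j J)
  note [measurable] = insert.prems(1)
  have "(\<integral>x. iexp (\<Sum>j\<in>J. t j * X j x) * (indicator (A j) (X j x) * Y x) \<partial>M) = 0" for t
  proof -
    have "(\<integral>x. indicator (A j) (X j x) * (iexp (\<Sum>j\<in>J. t j * X j x) * Y x) \<partial>M) = 0"
    proof (rule fourier_weight_zero[where c=c])
      fix s
      have "(\<Sum>k\<in>insert j J. (t(j := s)) k * X k x) = s * X j x + (\<Sum>j\<in>J. t j * X j x)" for x
        using insert.hyps by (auto intro!: sum.cong)
      then have "(\<integral>x. iexp (s * X j x) * (iexp (\<Sum>j\<in>J. t j * X j x) * Y x) \<partial>M) = (\<integral>x. iexp (\<Sum>k\<in>insert j J. (t(j := s)) k * X k x) * Y x \<partial>M)"
        by (simp add: exp_add algebra_simps del: fun_upd_apply of_real_sum)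
      then show "(\<integral>x. iexp (s * X j x) * (iexp (\<Sum>j\<in>J. t j * X j x) * Y x) \<partial>M) = 0"
        using insert.prems(3) by simp
    qed (auto simp: norm_mult insert.prems)
    then show ?thesis by (simp add: mult_ac)
  qed
  then have "(\<integral>x. (\<Prod>j\<in>J. indicator (A j) (X j x)) * (indicator (A j) (X j x) * Y x) \<partial>M) = 0"
    by (intro insert.IH) (auto simp: norm_mult indicator_def insert.prems order.trans[OF norm_ge_zero insert.prems(2)])
  then show ?case using insert.hyps by (simp add: mult_ac)
qed

text \<open>Two passes with centred weights. The weight \<open>iexp\<close> of the
  \<open>Z\<close>-combination minus its mean turns the exponentials of \<open>X\<close> into
  indicators; then the indicator of the \<open>X\<close>-event minus its mean is the weight that
  does the same for \<open>Z\<close>.\<close>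

lemma fourier_independent:
  fixes X :: "'i \<Rightarrow> 'a \<Rightarrow> real" and Z :: "'k \<Rightarrow> 'a \<Rightarrow> real"
  assumes J: "finite J" "finite K" and X[measurable]: "\<And>j. X j \<in> borel_measurable M"
    and Z[measurable]: "\<And>j. Z j \<in> borel_measurable M"
    and fac: "\<And>s t. (\<integral>x. iexp (\<Sum>j\<in>J. t j * X j x) * iexp (\<Sum>k\<in>K. s k * Z k x) \<partial>M) =
       (\<integral>x. iexp (\<Sum>j\<in>J. t j * X j x) \<partial>M) * (\<integral>x. iexp (\<Sum>k\<in>K. s k * Z k x) \<partial>M)"
    and A[measurable]: "\<And>j. A j \<in> sets borel" and B[measurable]: "\<And>k. B k \<in> sets borel"
  shows "prob ({x\<in>space M. \<forall>j\<in>J. X j x \<in> A j} \<inter> {x\<in>space M. \<forall>k\<in>K. Z k x \<in> B k}) =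
     prob {x\<in>space M. \<forall>j\<in>J. X j x \<in> A j} * prob {x\<in>space M. \<forall>k\<in>K. Z k x \<in> B k}"
proof -
  let ?a = "\<lambda>x. (\<Prod>j\<in>J. indicator (A j) (X j x)) :: complex"
  let ?b = "\<lambda>x. (\<Prod>k\<in>K. indicator (B k) (Z k x)) :: complex"
  let ?e = "\<lambda>s x. iexp (\<Sum>k\<in>K. s k * Z k x)"
  have a: "?a x = indicator {x\<in>space M. \<forall>j\<in>J. X j x \<in> A j} x" if "x \<in> space M" for x
    using J(1) that by (auto simp: indicator_def prod_zero_iff)
  have b: "?b x = indicator {x\<in>space M. \<forall>k\<in>K. Z k x \<in> B k} x" if "x \<in> space M" for x
    using J(2) that by (auto simp: indicator_def prod_zero_iff)
  have na: "cmod (?a x) \<le> 1" for x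
    unfolding prod_norm[symmetric] by (rule prod_le_1) (auto simp: indicator_def)
  have nb: "cmod (?b x) \<le> 1" for x
    unfolding prod_norm[symmetric] by (rule prod_le_1) (auto simp: indicator_def)
  have ia: "integrable M ?a" and ib: "integrable M ?b" and iab: "integrable M (\<lambda>x. ?a x * ?b x)"
    by (auto intro!: integrable_bounded_complex[where c=1] simp: na nb norm_mult mult_le_one)
  have ie: "integrable M (?e s)" for s by (rule integrable_bounded_complex[where c=1]) auto
  have iae: "integrable M (\<lambda>x. ?a x * ?e s x)" for s
    by (rule integrable_bounded_complex[where c=1]) (auto simp: na norm_mult)
  have ae: "(\<integral>x. ?a x * ?e s x \<partial>M) = (\<integral>x. ?a x \<partial>M) * (\<integral>x. ?e s x \<partial>M)" for s
  proof -
    let ?c = "\<integral>x. ?e s x \<partial>M"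
    have "(\<integral>x. ?a x * (?e s x - ?c) \<partial>M) = 0"
    proof (rule fourier_weight_zero_finite[where c="1 + cmod ?c", OF J(1)])
      fix x show "cmod (?e s x - ?c) \<le> 1 + cmod ?c"
        by (rule order.trans[OF norm_triangle_ineq4]) simp
    next
      fix t
      have i: "integrable M (\<lambda>x. iexp (\<Sum>j\<in>J. t j * X j x))" "integrable M (\<lambda>x. iexp (\<Sum>j\<in>J. t j * X j x) * ?e s x)"
        by (auto intro!: integrable_bounded_complex[where c=1] simp: norm_mult)
      then show "(\<integral>x. iexp (\<Sum>j\<in>J. t j * X j x) * (?e s x - ?c) \<partial>M) = 0"
        using fac[of t s] by (simp add: right_diff_distrib Bochner_Integration.integral_diff del: of_real_sum)
    qed auto
    then show ?thesis using ia iae by (simp add: right_diff_distrib Bochner_Integration.integral_diff del: of_real_sum)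
  qed
  let ?p = "\<integral>x. ?a x \<partial>M"
  have "(\<integral>x. ?b x * (?a x - ?p) \<partial>M) = 0"
  proof (rule fourier_weight_zero_finite[where c="1 + cmod ?p", OF J(2)])
    fix x show "cmod (?a x - ?p) \<le> 1 + cmod ?p"
      using na[of x] by (intro order.trans[OF norm_triangle_ineq4]) simp
  next
    fix s
    have "(\<integral>x. ?e s x * (?a x - ?p) \<partial>M) = (\<integral>x. ?a x * ?e s x - ?e s x * ?p \<partial>M)"
      by (intro Bochner_Integration.integral_cong) (auto simp: algebra_simps)
    then show "(\<integral>x. ?e s x * (?a x - ?p) \<partial>M) = 0"
      using ae[of s] iae ie by (simp add: Bochner_Integration.integral_diff del: of_real_sum)
  qed auto
  then have ab: "(\<integral>x. ?a x * ?b x \<partial>M) = ?p * (\<integral>x. ?b x \<partial>M)"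
    using ib iab by (simp add: right_diff_distrib Bochner_Integration.integral_diff mult.commute)
  let ?A = "{x\<in>space M. \<forall>j\<in>J. X j x \<in> A j}" and ?B = "{x\<in>space M. \<forall>k\<in>K. Z k x \<in> B k}"
  have m[measurable]: "?A \<in> sets M" "?B \<in> sets M"
    using J by measurable
  have "?p = (\<integral>x. indicator ?A x \<partial>M)"
    by (intro Bochner_Integration.integral_cong a) auto
  then have pa: "?p = of_real (prob ?A)" using expectation_indicator_complex[OF m(1)] by simp
  have "(\<integral>x. ?b x \<partial>M) = (\<integral>x. indicator ?B x \<partial>M)"
    by (intro Bochner_Integration.integral_cong b) auto
  then have pb: "(\<integral>x. ?b x \<partial>M) = of_real (prob ?B)" using expectation_indicator_complex[OF m(2)] by simp
  have "(\<integral>x. ?a x * ?b x \<partial>M) = (\<integral>x. indicator (?A \<inter> ?B) x \<partial>M)"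
    by (intro Bochner_Integration.integral_cong) (auto simp only: a b indicator_inter_arith)
  then have "(\<integral>x. ?a x * ?b x \<partial>M) = of_real (prob (?A \<inter> ?B))" using expectation_indicator_complex[OF sets.Int[OF m]] by simp
  then have "complex_of_real (prob (?A \<inter> ?B)) = of_real (prob ?A * prob ?B)"
    using ab pa pb by simp
  then show ?thesis by (simp only: of_real_eq_iff)
qed

end

text \<open>The sigma-algebra generated by a possibly uncountable family. Finite-dimensional
  cylinders are taken as generators, rather than preimages under single members, because they are
  closed under intersection and so determine independence.\<close>

definition rv_sigma :: "'a measure \<Rightarrow> ('i \<Rightarrow> 'a \<Rightarrow> complex) \<Rightarrow> 'a measure" where
  "rv_sigma M H = sigma (space M)
     {{x\<in>space M. \<forall>j\<in>J. Re (H j x) \<in> A j \<and> Im (H j x) \<in> B j} | J A B.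
        finite J \<and> (\<forall>j. A j \<in> sets borel \<and> B j \<in> sets (borel :: real measure))}"

lemma space_rv_sigma [simp]: "space (rv_sigma M H) = space M"
  unfolding rv_sigma_def by (rule space_measure_of) auto

lemma sets_rv_sigma: "sets (rv_sigma M H) = sigma_sets (space M)
     {{x\<in>space M. \<forall>j\<in>J. Re (H j x) \<in> A j \<and> Im (H j x) \<in> B j} | J A B.
        finite J \<and> (\<forall>j. A j \<in> sets borel \<and> B j \<in> sets (borel :: real measure))}"
  unfolding rv_sigma_def by (rule sets_measure_of) auto

lemma measurable_rv_sigma: "H j \<in> borel_measurable (rv_sigma M H)"
  unfolding borel_measurable_complex_iff
proof (intro conjI measurableI)
  fix C :: "real set" assume C: "C \<in> sets borel"
  have "{x\<in>space M. \<forall>j\<in>{j}. Re (H j x) \<in> C \<and> Im (H j x) \<in> UNIV} \<in> sets (rv_sigma M H)"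
    unfolding sets_rv_sigma
    by (rule sigma_sets.Basic, rule CollectI, rule exI[of _ "{j}"], rule exI[of _ "\<lambda>_. C"], rule exI[of _ "\<lambda>_. UNIV"])
       (use C in auto)
  also have "{x\<in>space M. \<forall>j\<in>{j}. Re (H j x) \<in> C \<and> Im (H j x) \<in> UNIV} = (\<lambda>x. Re (H j x)) -` C \<inter> space (rv_sigma M H)"
    by auto
  finally show "(\<lambda>x. Re (H j x)) -` C \<inter> space (rv_sigma M H) \<in> sets (rv_sigma M H)" .
  have "{x\<in>space M. \<forall>j\<in>{j}. Re (H j x) \<in> UNIV \<and> Im (H j x) \<in> C} \<in> sets (rv_sigma M H)"
    unfolding sets_rv_sigma
    by (rule sigma_sets.Basic, rule CollectI, rule exI[of _ "{j}"], rule exI[of _ "\<lambda>_. UNIV"], rule exI[of _ "\<lambda>_. C"])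
       (use C in auto)
  also have "{x\<in>space M. \<forall>j\<in>{j}. Re (H j x) \<in> UNIV \<and> Im (H j x) \<in> C} = (\<lambda>x. Im (H j x)) -` C \<inter> space (rv_sigma M H)"
    by auto
  finally show "(\<lambda>x. Im (H j x)) -` C \<inter> space (rv_sigma M H) \<in> sets (rv_sigma M H)" .
qed auto

context prob_space begin

lemma sets_rv_sigma_subset:
  fixes H :: "'i \<Rightarrow> 'a \<Rightarrow> complex"
  assumes [measurable]: "\<And>j. H j \<in> borel_measurable M"
  shows "sets (rv_sigma M H) \<subseteq> sets M"
  unfolding sets_rv_sigma
proof (rule sets.sigma_sets_subset, safe)
  fix J :: "'i set" and A B :: "'i \<Rightarrow> real set" assume "finite J" and A: "\<forall>j. A j \<in> sets borel \<and> B j \<in> sets (borel :: real measure)"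
  then have [measurable]: "A j \<in> sets borel" "B j \<in> sets borel" for j by auto
  show "{x\<in>space M. \<forall>j\<in>J. Re (H j x) \<in> A j \<and> Im (H j x) \<in> B j} \<in> sets M"
    using \<open>finite J\<close> by measurable
qed

text \<open>Cylinder events are independent by characteristic functions, and independence extends
  from intersection-stable generators. The second component of the pair is the sample point itself,
  seen only through \<open>rv_sigma\<close>: Fubini can then integrate \<zeta> out while the whole
  family \<open>H\<close> stays fixed.\<close>

lemma independent_of_rv_sigma:
  fixes \<zeta> :: "'a \<Rightarrow> complex" and H :: "'i \<Rightarrow> 'a \<Rightarrow> complex"
  assumes \<zeta>[measurable]: "\<zeta> \<in> borel_measurable M" and H[measurable]: "\<And>j. H j \<in> borel_measurable M"
    and fac: "\<And>J c d. finite J \<Longrightarrow>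
       (\<integral>x. iexp (Re (\<Sum>j\<in>J. c j * H j x)) * iexp (Re (d * \<zeta> x)) \<partial>M) =
       (\<integral>x. iexp (Re (\<Sum>j\<in>J. c j * H j x)) \<partial>M) * (\<integral>x. iexp (Re (d * \<zeta> x)) \<partial>M)"
  shows "distr M (borel \<Otimes>\<^sub>M rv_sigma M H) (\<lambda>x. (\<zeta> x, x)) =
         distr M borel \<zeta> \<Otimes>\<^sub>M distr M (rv_sigma M H) (\<lambda>x. x)"
proof -
  let ?G1 = "{{x\<in>space M. Re (\<zeta> x) \<in> A \<and> Im (\<zeta> x) \<in> B} | A B. A \<in> sets borel \<and> B \<in> sets (borel :: real measure)}"
  let ?G2 = "{{x\<in>space M. \<forall>j\<in>J. Re (H j x) \<in> A j \<and> Im (H j x) \<in> B j} | J A B.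
        finite J \<and> (\<forall>j. A j \<in> sets borel \<and> B j \<in> sets (borel :: real measure))}"
  have idm: "(\<lambda>x. x) \<in> measurable M (rv_sigma M H)"
    using sets_rv_sigma_subset[of H, OF H] by (auto intro!: measurableI)
  have "indep_set ?G1 ?G2"
  proof (rule indep_setI)
    show "?G1 \<subseteq> events" by (auto intro!: measurable_sets)
    show "?G2 \<subseteq> events"
      using sets_rv_sigma_subset[of H, OF H] unfolding sets_rv_sigma by (meson order.trans sigma_sets_superset_generator)
    fix a b assume "a \<in> ?G1" "b \<in> ?G2"
    then obtain A B J A' B' where ab: "a = {x\<in>space M. Re (\<zeta> x) \<in> A \<and> Im (\<zeta> x) \<in> B}"
      "A \<in> sets borel" "B \<in> sets borel"
      "b = {x\<in>space M. \<forall>j\<in>J. Re (H j x) \<in> A' j \<and> Im (H j x) \<in> B' j}" "finite J" "\<And>j. A' j \<in> sets borel" "\<And>j. B' j \<in> sets borel"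
      by blast
    \<comment> \<open>Real and imaginary parts become separate real coordinates, told apart by a
      boolean, so that the real-valued criterion applies.\<close>
    define X where "X = (\<lambda>(j, k::bool) x. if k then Re (H j x) else Im (H j x))"
    define Z where "Z = (\<lambda>(k::bool) x. if k then Re (\<zeta> x) else Im (\<zeta> x))"
    define AX where "AX = (\<lambda>(j, k::bool). if k then A' j else B' j)"
    define AZ where "AZ = (\<lambda>(k::bool). if k then A else B)"
    have a': "{x\<in>space M. \<forall>k\<in>UNIV. Z k x \<in> AZ k} = a"
      unfolding ab(1) by (auto simp: Z_def AZ_def all_bool_eq)
    have b': "{x\<in>space M. \<forall>k\<in>J\<times>UNIV. X k x \<in> AX k} = b"
      unfolding ab(4) by (auto simp: X_def AX_def all_bool_eq)
    have sX: "(\<Sum>k\<in>J\<times>UNIV. t k * X k x) = Re (\<Sum>j\<in>J. (of_real (t (j, True)) - \<i> * of_real (t (j, False))) * H j x)" for t x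
    proof -
      have "(\<Sum>k\<in>J\<times>UNIV. t k * X k x) = (\<Sum>j\<in>J. \<Sum>b\<in>UNIV. t (j, b) * X (j, b) x)"
        by (simp add: sum.cartesian_product)
      then show ?thesis by (simp add: UNIV_bool X_def add.commute)
    qed
    have sZ: "(\<Sum>k\<in>UNIV. s k * Z k x) = Re ((of_real (s True) - \<i> * of_real (s False)) * \<zeta> x)" for s x
      by (simp add: UNIV_bool Z_def)
    have "prob ({x\<in>space M. \<forall>j\<in>J\<times>UNIV. X j x \<in> AX j} \<inter> {x\<in>space M. \<forall>k\<in>UNIV. Z k x \<in> AZ k}) =
     prob {x\<in>space M. \<forall>j\<in>J\<times>UNIV. X j x \<in> AX j} * prob {x\<in>space M. \<forall>k\<in>UNIV. Z k x \<in> AZ k}"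
    proof (rule fourier_independent)
      show "X j \<in> borel_measurable M" for j by (cases j; cases "snd j") (auto simp: X_def)
      show "Z j \<in> borel_measurable M" for j by (cases j) (auto simp: Z_def)
      show "AX j \<in> sets borel" for j using ab by (auto simp: AX_def split: prod.splits)
      show "AZ j \<in> sets borel" for j using ab by (auto simp: AZ_def)
    next
      fix s t
      show "(\<integral>x. iexp (\<Sum>j\<in>J\<times>UNIV. t j * X j x) * iexp (\<Sum>k\<in>UNIV. s k * Z k x) \<partial>M) =
       (\<integral>x. iexp (\<Sum>j\<in>J\<times>UNIV. t j * X j x) \<partial>M) * (\<integral>x. iexp (\<Sum>k\<in>UNIV. s k * Z k x) \<partial>M)"
        unfolding sX sZ by (rule fac[OF ab(5)])
    qed (use ab in auto)
    then show "prob (a \<inter> b) = prob a * prob b" unfolding a' b' by (simp add: mult.commute Int_commute)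
  qed
  moreover have "Int_stable ?G1"
  proof (rule Int_stableI)
    fix a b assume "a \<in> ?G1" "b \<in> ?G1"
    then obtain A B A' B' where *: "a = {x\<in>space M. Re (\<zeta> x) \<in> A \<and> Im (\<zeta> x) \<in> B}" "A \<in> sets borel" "B \<in> sets borel"
      "b = {x\<in>space M. Re (\<zeta> x) \<in> A' \<and> Im (\<zeta> x) \<in> B'}" "A' \<in> sets borel" "B' \<in> sets borel" by blast
    then have "a \<inter> b = {x\<in>space M. Re (\<zeta> x) \<in> A \<inter> A' \<and> Im (\<zeta> x) \<in> B \<inter> B'}" by auto
    then show "a \<inter> b \<in> ?G1" using *(2,3,5,6) by (blast intro: sets.Int)
  qed
  moreover have "Int_stable ?G2"
  proof (rule Int_stableI)
    fix a b assume "a \<in> ?G2" "b \<in> ?G2"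
    then obtain J A B J' A' B' where *: "a = {x\<in>space M. \<forall>j\<in>J. Re (H j x) \<in> A j \<and> Im (H j x) \<in> B j}"
       "finite J" "\<And>j. A j \<in> sets borel" "\<And>j. B j \<in> sets borel"
      "b = {x\<in>space M. \<forall>j\<in>J'. Re (H j x) \<in> A' j \<and> Im (H j x) \<in> B' j}"
       "finite J'" "\<And>j. A' j \<in> sets borel" "\<And>j. B' j \<in> sets borel" by blast
    define A'' where "A'' j = (if j \<in> J then A j else UNIV) \<inter> (if j \<in> J' then A' j else UNIV)" for j
    define B'' where "B'' j = (if j \<in> J then B j else UNIV) \<inter> (if j \<in> J' then B' j else UNIV)" for j
    have "a \<inter> b = {x\<in>space M. \<forall>j\<in>J\<union>J'. Re (H j x) \<in> A'' j \<and> Im (H j x) \<in> B'' j}"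
      unfolding * A''_def B''_def by (auto split: if_splits)
    moreover have "A'' j \<in> sets borel \<and> B'' j \<in> sets borel" for j
      unfolding A''_def B''_def using * by auto
    ultimately show "a \<inter> b \<in> ?G2" using *(2,6) by (blast intro: finite_UnI)
  qed
  ultimately have ind: "indep_set (sigma_sets (space M) ?G1) (sigma_sets (space M) ?G2)"
    by (rule indep_set_sigma_sets)
  have G1: "\<zeta> -` A \<inter> space M \<in> sigma_sets (space M) ?G1" if A: "A \<in> sets borel" for A
  proof -
    have s: "sets (sigma (space M) ?G1) = sigma_sets (space M) ?G1" by (rule sets_measure_of) auto
    have "\<zeta> \<in> borel_measurable (sigma (space M) ?G1)"
      unfolding borel_measurable_complex_iff
    proof (intro conjI measurableI)
      fix C :: "real set" assume C: "C \<in> sets borel"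
      have "(\<lambda>x. Re (\<zeta> x)) -` C \<inter> space M = {x\<in>space M. Re (\<zeta> x) \<in> C \<and> Im (\<zeta> x) \<in> UNIV}"
        "(\<lambda>x. Im (\<zeta> x)) -` C \<inter> space M = {x\<in>space M. Re (\<zeta> x) \<in> UNIV \<and> Im (\<zeta> x) \<in> C}" by auto
      moreover have "\<dots> \<in> ?G1" "{x\<in>space M. Re (\<zeta> x) \<in> C \<and> Im (\<zeta> x) \<in> UNIV} \<in> ?G1"
        using C by (blast intro: sets.top[of borel, simplified space_borel])+
      ultimately show "(\<lambda>x. Re (\<zeta> x)) -` C \<inter> space (sigma (space M) ?G1) \<in> sets (sigma (space M) ?G1)"
         "(\<lambda>x. Im (\<zeta> x)) -` C \<inter> space (sigma (space M) ?G1) \<in> sets (sigma (space M) ?G1)"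
        unfolding s by (auto simp: space_measure_of_conv intro: sigma_sets.Basic)
    qed auto
    from measurable_sets[OF this A] show ?thesis unfolding s by (simp add: space_measure_of_conv)
  qed
  show ?thesis
  proof (rule pair_measure_eqI[symmetric])
    show "sigma_finite_measure (distr M borel \<zeta>)" "sigma_finite_measure (distr M (rv_sigma M H) (\<lambda>x. x))"
      using idm by (auto intro!: prob_space_imp_sigma_finite prob_space_distr)
    show "sets (distr M borel \<zeta> \<Otimes>\<^sub>M distr M (rv_sigma M H) (\<lambda>x. x)) = sets (distr M (borel \<Otimes>\<^sub>M rv_sigma M H) (\<lambda>x. (\<zeta> x, x)))"
      by (simp cong: sets_pair_measure_cong)
    fix A B assume "A \<in> sets (distr M borel \<zeta>)" "B \<in> sets (distr M (rv_sigma M H) (\<lambda>x. x))"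
    then have A: "A \<in> sets borel" and B: "B \<in> sets (rv_sigma M H)" by auto
    have Bs: "B \<subseteq> space M" using sets.sets_into_space[OF B] by simp
    have "B \<in> sigma_sets (space M) ?G2" using B unfolding sets_rv_sigma .
    from indep_setD[OF ind G1[OF A] this]
    have p: "prob ((\<zeta> -` A \<inter> space M) \<inter> B) = prob (\<zeta> -` A \<inter> space M) * prob B" .
    have j: "(\<lambda>x. (\<zeta> x, x)) \<in> measurable M (borel \<Otimes>\<^sub>M rv_sigma M H)" using idm by measurable
    have "emeasure (distr M (borel \<Otimes>\<^sub>M rv_sigma M H) (\<lambda>x. (\<zeta> x, x))) (A \<times> B) = emeasure M ((\<lambda>x. (\<zeta> x, x)) -` (A \<times> B) \<inter> space M)"
      using A B by (intro emeasure_distr[OF j]) auto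
    also have "(\<lambda>x. (\<zeta> x, x)) -` (A \<times> B) \<inter> space M = (\<zeta> -` A \<inter> space M) \<inter> B" using Bs by auto
    also have "emeasure M \<dots> = ennreal (prob (\<zeta> -` A \<inter> space M)) * ennreal (prob B)"
      by (simp add: emeasure_eq_measure p ennreal_mult)
    also have "\<dots> = emeasure (distr M borel \<zeta>) A * emeasure (distr M (rv_sigma M H) (\<lambda>x. x)) B"
      using A B Bs by (simp add: emeasure_distr[OF idm] emeasure_distr emeasure_eq_measure Int_absorb2)
    finally show "emeasure (distr M borel \<zeta>) A * emeasure (distr M (rv_sigma M H) (\<lambda>x. x)) B =
      emeasure (distr M (borel \<Otimes>\<^sub>M rv_sigma M H) (\<lambda>x. (\<zeta> x, x))) (A \<times> B)" by simp
  qed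
qed

end

section \<open>Complex Gaussian variables\<close>

text \<open>The circularly symmetric normal law with \<open>v\<close> the mean of the squared
  modulus. \<open>Re (c * U)\<close> has variance \<open>(cmod c)\<^sup>2 * v / 2\<close>, which
  explains the 4. The characteristic function also covers \<open>v = 0\<close>, where there is no
  density.\<close>

definition complex_gaussian :: "'a measure \<Rightarrow> ('a \<Rightarrow> complex) \<Rightarrow> real \<Rightarrow> bool" where
  "complex_gaussian M U v \<longleftrightarrow> U \<in> borel_measurable M \<and>
     (\<forall>c. (\<integral>x. iexp (Re (c * U x)) \<partial>M) = of_real (exp (- (cmod c)\<^sup>2 * v / 4)))"

definition complex_normal_density :: "complex \<Rightarrow> real \<Rightarrow> complex \<Rightarrow> real" where
  "complex_normal_density m v w = exp (- (cmod (w - m))\<^sup>2 / v) / (pi * v)"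

lemma complex_normal_density_eq:
  assumes "v > 0"
  shows "complex_normal_density m v (Complex x y) =
    normal_density (Re m) (sqrt (v / 2)) x * normal_density (Im m) (sqrt (v / 2)) y"
proof -
  have "normal_density (Re m) (sqrt (v / 2)) x * normal_density (Im m) (sqrt (v / 2)) y =
     (1 / sqrt (pi * v) * (1 / sqrt (pi * v))) * (exp (- (x - Re m)\<^sup>2 / v) * exp (- (y - Im m)\<^sup>2 / v))"
    using assms by (simp add: normal_density_def)
  also have "1 / sqrt (pi * v) * (1 / sqrt (pi * v)) = 1 / (pi * v)" using assms by simp
  also have "exp (- (x - Re m)\<^sup>2 / v) * exp (- (y - Im m)\<^sup>2 / v) = exp (- (cmod (Complex x y - m))\<^sup>2 / v)"
    unfolding exp_add[symmetric] by (simp add: cmod_power2 diff_divide_distrib add_divide_distrib)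
  finally show ?thesis by (simp add: complex_normal_density_def)
qed

lemma complex_normal_density_measurable [measurable]: "complex_normal_density m v \<in> borel_measurable borel"
  unfolding complex_normal_density_def[abs_def] by measurable

lemma complex_normal_density_nonneg: "v \<ge> 0 \<Longrightarrow> complex_normal_density m v w \<ge> 0"
  by (simp add: complex_normal_density_def)

lemma measurable_Complex [measurable (raw)]:
  assumes [measurable]: "f \<in> borel_measurable M" "g \<in> borel_measurable M"
  shows "(\<lambda>x. Complex (f x) (g x)) \<in> borel_measurable M"
  unfolding Complex_eq by measurable

lemma lborel_complex_eq_distr_pair: "lborel = distr (lborel \<Otimes>\<^sub>M lborel) borel (\<lambda>(x, y). Complex x y)"
proof (rule lborel_eqI)
  fix l u :: complex assume lu: "\<And>b. b \<in> Basis \<Longrightarrow> l \<bullet> b \<le> u \<bullet> b"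
  have le: "Re l \<le> Re u" "Im l \<le> Im u" using lu[of 1] lu[of \<i>] by (auto simp: Basis_complex_def)
  have "(\<lambda>(x, y). Complex x y) -` box l u \<inter> space (lborel \<Otimes>\<^sub>M lborel) = {Re l<..<Re u} \<times> {Im l<..<Im u}"
    by (auto simp: in_box_complex_iff space_pair_measure)
  then have "emeasure (distr (lborel \<Otimes>\<^sub>M lborel) borel (\<lambda>(x, y). Complex x y)) (box l u) = emeasure (lborel \<Otimes>\<^sub>M lborel) ({Re l<..<Re u} \<times> {Im l<..<Im u})"
    by (subst emeasure_distr) (auto simp: space_pair_measure)
  also have "\<dots> = ennreal (Re u - Re l) * ennreal (Im u - Im l)"
    using le by (subst lborel.emeasure_pair_measure_Times) auto
  also have "\<dots> = ennreal (prod ((\<bullet>) (u - l)) Basis)"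
    using le by (simp add: Basis_complex_def ennreal_mult)
  finally show "emeasure (distr (lborel \<Otimes>\<^sub>M lborel) borel (\<lambda>(x, y). Complex x y)) (box l u) = ennreal (prod ((\<bullet>) (u - l)) Basis)" .
qed simp

lemma nn_integral_lborel_complex:
  assumes [measurable]: "f \<in> borel_measurable borel"
  shows "(\<integral>\<^sup>+w. f w \<partial>lborel) = (\<integral>\<^sup>+x. \<integral>\<^sup>+y. f (Complex x y) \<partial>lborel \<partial>lborel)"
proof -
  have "(\<integral>\<^sup>+w. f w \<partial>lborel) = (\<integral>\<^sup>+p. f (case p of (x, y) \<Rightarrow> Complex x y) \<partial>(lborel \<Otimes>\<^sub>M lborel))"
    by (subst lborel_complex_eq_distr_pair, subst nn_integral_distr) (auto simp: case_prod_beta)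
  also have "\<dots> = (\<integral>\<^sup>+x. \<integral>\<^sup>+y. f (Complex x y) \<partial>lborel \<partial>lborel)"
    by (subst lborel.nn_integral_fst[symmetric]) (auto simp: case_prod_beta)
  finally show ?thesis .
qed

text \<open>Expand around \<mu> and use the moments 1, 0 and \<open>\<sigma>\<^sup>2\<close>. The
  constant \<open>C\<close> allows iteration: integrating the imaginary part of a complex variable
  leaves a constant behind for the real part, and later \<open>C\<close> carries the variance of an
  independent summand.\<close>

lemma nn_integral_normal_quadratic:
  assumes \<sigma>: "\<sigma> > 0" and C: "C \<ge> 0"
  shows "(\<integral>\<^sup>+x. ennreal (normal_density \<mu> \<sigma> x) * ennreal ((cmod (A + B * of_real x))\<^sup>2 + C) \<partial>lborel) =
     ennreal ((cmod (A + B * of_real \<mu>))\<^sup>2 + (cmod B)\<^sup>2 * \<sigma>\<^sup>2 + C)"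
proof -
  define D where "D = A + B * of_real \<mu>"
  define k where "k = 2 * Re (cnj D * B)"
  have e: "(cmod (A + B * of_real x))\<^sup>2 + C = ((cmod D)\<^sup>2 + C) + k * (x - \<mu>) + (cmod B)\<^sup>2 * (x - \<mu>)\<^sup>2" for x
  proof -
    have "A + B * of_real x = D + B * of_real (x - \<mu>)" by (simp add: D_def algebra_simps)
    then show ?thesis unfolding k_def by (simp only: cmod_power2) (simp add: power2_eq_square algebra_simps)
  qed
  have m0: "has_bochner_integral lborel (\<lambda>x. normal_density \<mu> \<sigma> x) 1"
    using normal_moment_even[OF \<sigma>, of \<mu> 0] by simp
  have m1: "has_bochner_integral lborel (\<lambda>x. normal_density \<mu> \<sigma> x * (x - \<mu>)) 0"
    using normal_moment_odd[OF \<sigma>, of \<mu> 0] by simp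
  have m2: "has_bochner_integral lborel (\<lambda>x. normal_density \<mu> \<sigma> x * (x - \<mu>)\<^sup>2) (\<sigma>\<^sup>2)"
    using normal_moment_even[OF \<sigma>, of \<mu> 1] by (simp add: numeral_2_eq_2)
  have "has_bochner_integral lborel
     (\<lambda>x. ((cmod D)\<^sup>2 + C) * normal_density \<mu> \<sigma> x + k * (normal_density \<mu> \<sigma> x * (x - \<mu>)) + (cmod B)\<^sup>2 * (normal_density \<mu> \<sigma> x * (x - \<mu>)\<^sup>2))
     (((cmod D)\<^sup>2 + C) * 1 + k * 0 + (cmod B)\<^sup>2 * \<sigma>\<^sup>2)"
    by (intro has_bochner_integral_add has_bochner_integral_mult_right m0 m1 m2)
  then have h: "has_bochner_integral lborel (\<lambda>x. normal_density \<mu> \<sigma> x * ((cmod (A + B * of_real x))\<^sup>2 + C)) ((cmod D)\<^sup>2 + (cmod B)\<^sup>2 * \<sigma>\<^sup>2 + C)"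
    unfolding e by (simp add: algebra_simps)
  have "(\<integral>\<^sup>+x. ennreal (normal_density \<mu> \<sigma> x * ((cmod (A + B * of_real x))\<^sup>2 + C)) \<partial>lborel) = ennreal ((cmod D)\<^sup>2 + (cmod B)\<^sup>2 * \<sigma>\<^sup>2 + C)"
    using h C by (subst nn_integral_eq_integral) (auto simp: has_bochner_integral_iff)
  then show ?thesis unfolding D_def using C by (simp add: ennreal_mult)
qed

lemma nn_integral_complex_normal_quadratic:
  assumes v: "v > 0" and C: "C \<ge> 0"
  shows "(\<integral>\<^sup>+w. ennreal (complex_normal_density m v w) * ennreal ((cmod (\<alpha> + \<beta> * w))\<^sup>2 + C) \<partial>lborel) =
    ennreal ((cmod (\<alpha> + \<beta> * m))\<^sup>2 + (cmod \<beta>)\<^sup>2 * v + C)"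
proof -
  define \<sigma> where "\<sigma> = sqrt (v / 2)"
  have \<sigma>: "\<sigma> > 0" "\<sigma>\<^sup>2 = v / 2" using v by (auto simp: \<sigma>_def)
  let ?n = "normal_density"
  have "(\<integral>\<^sup>+w. ennreal (complex_normal_density m v w) * ennreal ((cmod (\<alpha> + \<beta> * w))\<^sup>2 + C) \<partial>lborel) =
    (\<integral>\<^sup>+x. \<integral>\<^sup>+y. ennreal (complex_normal_density m v (Complex x y)) * ennreal ((cmod (\<alpha> + \<beta> * Complex x y))\<^sup>2 + C) \<partial>lborel \<partial>lborel)"
    by (rule nn_integral_lborel_complex) measurable
  also have "\<dots> = (\<integral>\<^sup>+x. ennreal (?n (Re m) \<sigma> x) * (\<integral>\<^sup>+y. ennreal (?n (Im m) \<sigma> y) * ennreal ((cmod ((\<alpha> + \<beta> * of_real x) + (\<beta> * \<i>) * of_real y))\<^sup>2 + C) \<partial>lborel) \<partial>lborel)"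
    unfolding complex_normal_density_eq[OF v] \<sigma>_def[symmetric]
    by (subst nn_integral_cmult[symmetric]) (auto simp: ennreal_mult Complex_eq algebra_simps intro!: nn_integral_cong)
  also have "\<dots> = (\<integral>\<^sup>+x. ennreal (?n (Re m) \<sigma> x) * ennreal ((cmod ((\<alpha> + \<beta> * \<i> * of_real (Im m)) + \<beta> * of_real x))\<^sup>2 + ((cmod \<beta>)\<^sup>2 * (v / 2) + C)) \<partial>lborel)"
    unfolding nn_integral_normal_quadratic[OF \<sigma>(1) C] \<sigma>(2) by (simp add: norm_mult algebra_simps)
  also have "\<dots> = ennreal ((cmod ((\<alpha> + \<beta> * \<i> * of_real (Im m)) + \<beta> * of_real (Re m)))\<^sup>2 + (cmod \<beta>)\<^sup>2 * \<sigma>\<^sup>2 + ((cmod \<beta>)\<^sup>2 * (v / 2) + C))"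
    by (rule nn_integral_normal_quadratic[OF \<sigma>(1)]) (use C v in auto)
  also have "(\<alpha> + \<beta> * \<i> * of_real (Im m)) + \<beta> * of_real (Re m) = \<alpha> + \<beta> * m"
    by (subst (3) complex_eq[of m]) (simp add: algebra_simps)
  finally show ?thesis unfolding \<sigma>(2) by (simp add: algebra_simps)
qed

lemma (in prob_space) distr_real_gaussian:
  assumes X[measurable]: "X \<in> borel_measurable M" and v: "v > 0"
    and ch: "\<And>t. (\<integral>x. iexp (t * X x) \<partial>M) = of_real (exp (- t\<^sup>2 * v / 4))"
  shows "distr M borel X = density lborel (normal_density 0 (sqrt (v / 2)))"
proof -
  define \<sigma> where "\<sigma> = sqrt (v / 2)"
  have \<sigma>: "\<sigma> > 0" "\<sigma>\<^sup>2 = v / 2" using v by (auto simp: \<sigma>_def)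
  have "distr M borel (\<lambda>x. X x / \<sigma>) = std_normal_distribution"
  proof (rule Levy_uniqueness)
    show "char (distr M borel (\<lambda>x. X x / \<sigma>)) = char std_normal_distribution"
    proof
      fix t
      have "char (distr M borel (\<lambda>x. X x / \<sigma>)) t = (\<integral>x. iexp ((t / \<sigma>) * X x) \<partial>M)"
        unfolding char_def by (subst integral_distr) auto
      also have "\<dots> = of_real (exp (- (t / \<sigma>)\<^sup>2 * v / 4))" by (rule ch)
      also have "- (t / \<sigma>)\<^sup>2 * v / 4 = - (t\<^sup>2) / 2" using v by (simp add: power_divide \<sigma>(2) field_simps)
      finally show "char (distr M borel (\<lambda>x. X x / \<sigma>)) t = char std_normal_distribution t"
        by (simp add: char_std_normal_distribution)
    qed
  qed (auto intro: real_distribution_distr real_dist_normal_dist)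
  then have "distributed M lborel (\<lambda>x. X x / \<sigma>) std_normal_density"
    unfolding distributed_def by (simp cong: distr_cong)
  from normal_density_affine[OF this, of \<sigma> 0] \<sigma>(1)
  have "distributed M lborel X (normal_density 0 \<sigma>)" by simp
  then show ?thesis unfolding distributed_def \<sigma>_def by (simp cong: distr_cong)
qed

text \<open>The characteristic function factors over real and imaginary parts, which are therefore
  independent centred normal variables of variance \<open>v / 2\<close>; the product of their
  densities is the complex one.\<close>

lemma (in prob_space) complex_gaussian_distr:
  assumes U: "complex_gaussian M U v" and v: "v > 0"
  shows "distr M borel U = density lborel (\<lambda>w. ennreal (complex_normal_density 0 v w))"
proof -
  have m[measurable]: "U \<in> borel_measurable M" using U by (simp add: complex_gaussian_def)
  have ch: "(\<integral>x. iexp (Re (c * U x)) \<partial>M) = of_real (exp (- (cmod c)\<^sup>2 * v / 4))" for c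
    using U by (simp add: complex_gaussian_def)
  let ?n = "\<lambda>x. ennreal (normal_density 0 (sqrt (v / 2)) x)"
  have dR: "distr M borel (\<lambda>x. Re (U x)) = density lborel ?n"
    by (rule distr_real_gaussian[OF _ v]) (use ch[of "of_real t" for t] in auto)
  have dI: "distr M borel (\<lambda>x. Im (U x)) = density lborel ?n"
    by (rule distr_real_gaussian[OF _ v]) (use ch[of "- \<i> * of_real t" for t] in \<open>auto simp: norm_mult\<close>)
  have sf: "prob_space (distr M borel (\<lambda>x. Re (U x)))" "prob_space (distr M borel (\<lambda>x. Im (U x)))"
    by (auto intro!: prob_space_distr)
  have joint: "distr M borel (\<lambda>x. Re (U x)) \<Otimes>\<^sub>M distr M borel (\<lambda>x. Im (U x)) = distr M (borel \<Otimes>\<^sub>M borel) (\<lambda>x. (Re (U x), Im (U x)))"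
  proof (rule pair_measure_eqI)
    show "sigma_finite_measure (distr M borel (\<lambda>x. Re (U x)))" "sigma_finite_measure (distr M borel (\<lambda>x. Im (U x)))"
      using sf by (auto intro: prob_space_imp_sigma_finite)
    fix A B assume "A \<in> sets (distr M borel (\<lambda>x. Re (U x)))" "B \<in> sets (distr M borel (\<lambda>x. Im (U x)))"
    then have [measurable]: "A \<in> sets borel" "B \<in> sets borel" by auto
    have "prob ({x\<in>space M. \<forall>j\<in>{()}. Re (U x) \<in> A} \<inter> {x\<in>space M. \<forall>k\<in>{()}. Im (U x) \<in> B}) =
      prob {x\<in>space M. \<forall>j\<in>{()}. Re (U x) \<in> A} * prob {x\<in>space M. \<forall>k\<in>{()}. Im (U x) \<in> B}"
    proof (rule fourier_independent)
      fix s t :: "unit \<Rightarrow> real"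
      have "iexp (\<Sum>j\<in>{()}. t j * Re (U x)) * iexp (\<Sum>k\<in>{()}. s k * Im (U x)) = iexp (Re ((of_real (t ()) - \<i> * of_real (s ())) * U x))" for x
        by (simp add: exp_add[symmetric] algebra_simps)
      then have "(\<integral>x. iexp (\<Sum>j\<in>{()}. t j * Re (U x)) * iexp (\<Sum>k\<in>{()}. s k * Im (U x)) \<partial>M) = of_real (exp (- ((t ())\<^sup>2 + (s ())\<^sup>2) * v / 4))"
        by (simp only: ch) (simp add: cmod_power2)
      also have "\<dots> = of_real (exp (- (t ())\<^sup>2 * v / 4)) * of_real (exp (- (s ())\<^sup>2 * v / 4))"
        unfolding of_real_mult[symmetric] exp_add[symmetric] by (simp add: field_simps)
      also have "of_real (exp (- (t ())\<^sup>2 * v / 4)) = (\<integral>x. iexp (\<Sum>j\<in>{()}. t j * Re (U x)) \<partial>M)"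
        using ch[of "of_real (t ())"] by simp
      also have "of_real (exp (- (s ())\<^sup>2 * v / 4)) = (\<integral>x. iexp (\<Sum>k\<in>{()}. s k * Im (U x)) \<partial>M)"
        using ch[of "- \<i> * of_real (s ())"] by (simp add: norm_mult)
      finally show "(\<integral>x. iexp (\<Sum>j\<in>{()}. t j * Re (U x)) * iexp (\<Sum>k\<in>{()}. s k * Im (U x)) \<partial>M) =
        (\<integral>x. iexp (\<Sum>j\<in>{()}. t j * Re (U x)) \<partial>M) * (\<integral>x. iexp (\<Sum>k\<in>{()}. s k * Im (U x)) \<partial>M)" .
    qed auto
    moreover have "{x\<in>space M. Re (U x) \<in> A} \<inter> {x\<in>space M. Im (U x) \<in> B} = {x\<in>space M. Re (U x) \<in> A \<and> Im (U x) \<in> B}" by auto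
    ultimately have "prob {x\<in>space M. Re (U x) \<in> A \<and> Im (U x) \<in> B} = prob {x\<in>space M. Re (U x) \<in> A} * prob {x\<in>space M. Im (U x) \<in> B}" by simp
    then show "emeasure (distr M borel (\<lambda>x. Re (U x))) A * emeasure (distr M borel (\<lambda>x. Im (U x))) B =
       emeasure (distr M (borel \<Otimes>\<^sub>M borel) (\<lambda>x. (Re (U x), Im (U x)))) (A \<times> B)"
      by (simp add: emeasure_distr emeasure_eq_measure ennreal_mult[symmetric] vimage_def Int_def conj_commute)
  qed simp
  have "distr M borel U = distr (distr M (borel \<Otimes>\<^sub>M borel) (\<lambda>x. (Re (U x), Im (U x)))) borel (\<lambda>(x, y). Complex x y)"
    by (subst distr_distr) (auto simp: o_def case_prod_beta)
  also have "\<dots> = distr (density lborel ?n \<Otimes>\<^sub>M density lborel ?n) borel (\<lambda>(x, y). Complex x y)"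
    unfolding joint[symmetric] dR dI ..
  also have "density lborel ?n \<Otimes>\<^sub>M density lborel ?n = density (lborel \<Otimes>\<^sub>M lborel) (\<lambda>(x, y). ?n x * ?n y)"
    using sf(2) unfolding dI by (intro pair_measure_density) (auto intro: prob_space_imp_sigma_finite lborel.sigma_finite_measure_axioms)
  also have "(\<lambda>(x, y). ?n x * ?n y) = (\<lambda>p. ennreal (complex_normal_density 0 v (case p of (x, y) \<Rightarrow> Complex x y)))"
    by (auto simp: complex_normal_density_eq[OF v] ennreal_mult fun_eq_iff)
  also have "distr (density (lborel \<Otimes>\<^sub>M lborel) (\<lambda>p. ennreal (complex_normal_density 0 v (case p of (x, y) \<Rightarrow> Complex x y)))) borel (\<lambda>(x, y). Complex x y)
     = density (distr (lborel \<Otimes>\<^sub>M lborel) borel (\<lambda>(x, y). Complex x y)) (\<lambda>w. ennreal (complex_normal_density 0 v w))"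
    by (rule density_distr[symmetric]) (auto simp: case_prod_beta)
  finally show ?thesis unfolding lborel_complex_eq_distr_pair[symmetric] .
qed


text \<open>A normal density times a Gaussian weight is again a multiple of a normal density, as for
  a posterior law: the mean is pulled from 0 towards \<open>- m\<close>, and the variances combine
  harmonically to \<open>q * s / (q + s)\<close>. The square is completed for real and imaginary
  parts separately.\<close>

lemma complete_square_complex:
  assumes q: "q > 0" and s: "s > 0"
  shows "complex_normal_density 0 s u * exp (- (cmod (m + u))\<^sup>2 / q) =
    (q / (q + s) * exp (- (cmod m)\<^sup>2 / (q + s))) * complex_normal_density (- m * of_real (s / (q + s))) (q * s / (q + s)) u"
proof -
  define r where "r = q * s / (q + s)"
  have qs: "q + s > 0" using assms by simp
  have r: "r > 0" using assms qs by (simp add: r_def)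
  have re: "a\<^sup>2 / s + (b + a)\<^sup>2 / q = b\<^sup>2 / (q + s) + (a + b * (s / (q + s)))\<^sup>2 / r" for a b :: real
    unfolding r_def using q s qs by (simp add: divide_simps) (simp add: power2_eq_square algebra_simps)
  have "(cmod u)\<^sup>2 / s + (cmod (m + u))\<^sup>2 / q = (cmod m)\<^sup>2 / (q + s) + (cmod (u - (- m * of_real (s / (q + s)))))\<^sup>2 / r"
    using re[of "Re u" "Re m"] re[of "Im u" "Im m"] by (simp only: cmod_power2) (simp add: add_divide_distrib)
  then have "exp (- (cmod u)\<^sup>2 / s) * exp (- (cmod (m + u))\<^sup>2 / q) = exp (- (cmod m)\<^sup>2 / (q + s)) * exp (- (cmod (u - (- m * of_real (s / (q + s)))))\<^sup>2 / r)"
    by (simp only: exp_add[symmetric]) simp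
  moreover have "1 / (pi * s) = (q / (q + s)) * (1 / (pi * r))"
    unfolding r_def using q s qs by (simp add: divide_simps)
  moreover have "x / P * e = (K * c) * (d / Q)" if "x * e = c * d" "1 / P = K * (1 / Q)" for x P e K c d Q :: real
  proof -
    have "x / P * e = (x * e) * (1 / P)" by simp
    also have "\<dots> = (c * d) * (K * (1 / Q))" by (simp only: that)
    finally show ?thesis by simp
  qed
  ultimately show ?thesis unfolding complex_normal_density_def r_def[symmetric] diff_0_right by blast
qed

text \<open>After completing the square only the second moment of a shifted complex normal law is
  left. The case \<open>s = 0\<close> occurs in the application: the residual noise vanishes at the
  point on which the noise is conditioned.\<close>

lemma (in prob_space) gaussian_tilt:
  assumes U: "complex_gaussian M U s" and s: "s \<ge> 0" "s = 0 \<Longrightarrow> AE x in M. U x = 0"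
    and q: "q > 0" and C: "C \<ge> 0"
  shows "(\<integral>\<^sup>+x. ennreal (exp (- (cmod (m + U x))\<^sup>2 / q)) * ennreal ((cmod (\<alpha> + \<beta> * U x))\<^sup>2 + C) \<partial>M) =
    ennreal (q / (q + s) * exp (- (cmod m)\<^sup>2 / (q + s)) *
      ((cmod (\<alpha> - \<beta> * m * of_real (s / (q + s))))\<^sup>2 + (cmod \<beta>)\<^sup>2 * (q * s / (q + s)) + C))"
proof (cases "s = 0")
  case True
  have "(\<integral>\<^sup>+x. ennreal (exp (- (cmod (m + U x))\<^sup>2 / q)) * ennreal ((cmod (\<alpha> + \<beta> * U x))\<^sup>2 + C) \<partial>M) =
    (\<integral>\<^sup>+x. ennreal (exp (- (cmod m)\<^sup>2 / q)) * ennreal ((cmod \<alpha>)\<^sup>2 + C) \<partial>M)"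
    by (rule nn_integral_cong_AE, rule AE_mp[OF s(2)[OF True]]) auto
  then show ?thesis using True q C by (simp add: emeasure_space_1 ennreal_mult)
next
  case False
  then have s0: "s > 0" using s by simp
  have [measurable]: "U \<in> borel_measurable M" using U by (simp add: complex_gaussian_def)
  define k where "k = q / (q + s) * exp (- (cmod m)\<^sup>2 / (q + s))"
  have k: "k \<ge> 0" using q s by (simp add: k_def)
  have r: "q * s / (q + s) > 0" using q s0 by simp
  have "(\<integral>\<^sup>+x. ennreal (exp (- (cmod (m + U x))\<^sup>2 / q)) * ennreal ((cmod (\<alpha> + \<beta> * U x))\<^sup>2 + C) \<partial>M) =
    (\<integral>\<^sup>+u. ennreal (exp (- (cmod (m + u))\<^sup>2 / q)) * ennreal ((cmod (\<alpha> + \<beta> * u))\<^sup>2 + C) \<partial>distr M borel U)"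
    by (subst nn_integral_distr) auto
  also have "\<dots> = (\<integral>\<^sup>+u. ennreal (complex_normal_density 0 s u) * (ennreal (exp (- (cmod (m + u))\<^sup>2 / q)) * ennreal ((cmod (\<alpha> + \<beta> * u))\<^sup>2 + C)) \<partial>lborel)"
    unfolding complex_gaussian_distr[OF U s0] by (subst nn_integral_density) auto
  also have "\<dots> = (\<integral>\<^sup>+u. ennreal k * (ennreal (complex_normal_density (- m * of_real (s / (q + s))) (q * s / (q + s)) u) * ennreal ((cmod (\<alpha> + \<beta> * u))\<^sup>2 + C)) \<partial>lborel)"
  proof (rule nn_integral_cong)
    fix u
    let ?D = "complex_normal_density (- m * of_real (s / (q + s))) (q * s / (q + s)) u"
    have D: "?D \<ge> 0" by (rule complex_normal_density_nonneg) (use r in linarith)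
    have "ennreal (complex_normal_density 0 s u) * ennreal (exp (- (cmod (m + u))\<^sup>2 / q)) = ennreal k * ennreal ?D"
      using complete_square_complex[OF q s0, of u m] k D complex_normal_density_nonneg[OF s(1), of 0 u]
      unfolding k_def[symmetric] by (simp only: ennreal_mult[symmetric] exp_ge_zero)
    then show "ennreal (complex_normal_density 0 s u) * (ennreal (exp (- (cmod (m + u))\<^sup>2 / q)) * ennreal ((cmod (\<alpha> + \<beta> * u))\<^sup>2 + C)) =
      ennreal k * (ennreal ?D * ennreal ((cmod (\<alpha> + \<beta> * u))\<^sup>2 + C))"
      by (simp only: mult.assoc[symmetric])
  qed
  also have "\<dots> = ennreal k * ennreal ((cmod (\<alpha> + \<beta> * (- m * of_real (s / (q + s)))))\<^sup>2 + (cmod \<beta>)\<^sup>2 * (q * s / (q + s)) + C)"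
    by (subst nn_integral_cmult) (auto simp: nn_integral_complex_normal_quadratic[OF r C])
  finally show ?thesis using k r C unfolding k_def[symmetric]
    by (simp add: ennreal_mult'[symmetric] mult.assoc)
qed

text \<open>Integrating \<open>R\<close> out first leaves only its variance, since \<open>R\<close>
  enters through a square, is centred and is independent of \<open>U\<close>. That variance plays
  the role of \<open>C\<close> in \<open>gaussian_tilt\<close>.\<close>

lemma (in prob_space) gaussian_tilt_independent:
  assumes U: "complex_gaussian M U s" and s: "s \<ge> 0" "s = 0 \<Longrightarrow> AE x in M. U x = 0"
    and q: "q > 0"
    and R[measurable]: "R \<in> borel_measurable M" and R1: "(\<integral>x. R x \<partial>M) = 0"
    and R2: "integrable M (\<lambda>x. (cmod (R x))\<^sup>2)"
    and fac: "\<And>c d. (\<integral>x. iexp (Re (c * R x)) * iexp (Re (d * U x)) \<partial>M) =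
       (\<integral>x. iexp (Re (c * R x)) \<partial>M) * (\<integral>x. iexp (Re (d * U x)) \<partial>M)"
  shows "(\<integral>\<^sup>+x. ennreal (exp (- (cmod (m + U x))\<^sup>2 / q)) * ennreal ((cmod (\<alpha> + \<beta> * U x + R x))\<^sup>2) \<partial>M) =
    ennreal (q / (q + s) * exp (- (cmod m)\<^sup>2 / (q + s)) *
      ((cmod (\<alpha> - \<beta> * m * of_real (s / (q + s))))\<^sup>2 + (cmod \<beta>)\<^sup>2 * (q * s / (q + s)) + (\<integral>x. (cmod (R x))\<^sup>2 \<partial>M)))"
proof -
  have Um[measurable]: "U \<in> borel_measurable M" using U by (simp add: complex_gaussian_def)
  \<comment> \<open>A family with one member, so that the independence theorem for families can be
    used.\<close>
  define H where "H = (\<lambda>_::unit. R)"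
  define N where "N = rv_sigma M H"
  define V where "V = (\<integral>x. (cmod (R x))\<^sup>2 \<partial>M)"
  have Hm: "H j \<in> borel_measurable M" for j by (simp add: H_def)
  have RN[measurable]: "R \<in> borel_measurable N" using measurable_rv_sigma[of H "()" M] by (simp add: H_def N_def)
  have idm[measurable]: "(\<lambda>x. x) \<in> measurable M N"
    using sets_rv_sigma_subset[of H, OF Hm] by (auto intro!: measurableI simp: N_def)
  have ind: "distr M (borel \<Otimes>\<^sub>M N) (\<lambda>x. (U x, x)) = distr M borel U \<Otimes>\<^sub>M distr M N (\<lambda>x. x)"
    unfolding N_def
  proof (rule independent_of_rv_sigma[OF Um Hm])
    fix J :: "unit set" and c d
    have "\<exists>c'. \<forall>x. (\<Sum>j\<in>J. c j * H j x) = c' * R x"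
      by (rule exI[of _ "\<Sum>j\<in>J. c j"]) (simp add: H_def sum_distrib_right)
    then obtain c' where "\<And>x. (\<Sum>j\<in>J. c j * H j x) = c' * R x" by blast
    then show "(\<integral>x. iexp (Re (\<Sum>j\<in>J. c j * H j x)) * iexp (Re (d * U x)) \<partial>M) =
       (\<integral>x. iexp (Re (\<Sum>j\<in>J. c j * H j x)) \<partial>M) * (\<integral>x. iexp (Re (d * U x)) \<partial>M)"
      using fac[of c' d] by simp
  qed
  interpret N: prob_space "distr M N (\<lambda>x. x)" by (rule prob_space_distr) measurable
  interpret UU: prob_space "distr M borel U" by (rule prob_space_distr) measurable
  interpret P: pair_sigma_finite "distr M borel U" "distr M N (\<lambda>x. x)" ..
  have iR: "integrable M R"
    using square_integrable_imp_integrable[of "\<lambda>x. cmod (R x)"] R2 by (simp add: integrable_norm_iff)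
  have inner: "(\<integral>\<^sup>+x. ennreal ((cmod (A + R x))\<^sup>2) \<partial>M) = ennreal ((cmod A)\<^sup>2 + V)" for A
  proof -
    have e: "(cmod (A + R x))\<^sup>2 = (cmod A)\<^sup>2 + 2 * Re (cnj A * R x) + (cmod (R x))\<^sup>2" for x
      by (simp only: cmod_power2) (simp add: power2_eq_square algebra_simps)
    have "(\<integral>x. Re (cnj A * R x) \<partial>M) = Re (\<integral>x. cnj A * R x \<partial>M)" using iR by (intro integral_Re) auto
    then have z: "(\<integral>x. Re (cnj A * R x) \<partial>M) = 0" using R1 by simp
    have "integrable M (\<lambda>x. cnj A * R x)" using iR by simp
    then have iRe: "integrable M (\<lambda>x. Re (cnj A * R x))" by (rule integrable_Re)
    have i: "integrable M (\<lambda>x. (cmod A)\<^sup>2 + 2 * Re (cnj A * R x) + (cmod (R x))\<^sup>2)"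
      by (intro Bochner_Integration.integrable_add integrable_mult_right iRe R2) simp
    have "(\<integral>x. (cmod A)\<^sup>2 + 2 * Re (cnj A * R x) + (cmod (R x))\<^sup>2 \<partial>M) = (\<integral>x. (cmod A)\<^sup>2 + 2 * Re (cnj A * R x) \<partial>M) + V"
      unfolding V_def by (intro Bochner_Integration.integral_add Bochner_Integration.integrable_add integrable_mult_right iRe R2) simp
    also have "(\<integral>x. (cmod A)\<^sup>2 + 2 * Re (cnj A * R x) \<partial>M) = (\<integral>x. (cmod A)\<^sup>2 \<partial>M) + (\<integral>x. 2 * Re (cnj A * R x) \<partial>M)"
      by (intro Bochner_Integration.integral_add integrable_mult_right iRe) simp
    also have "\<dots> = (cmod A)\<^sup>2" using z by (simp add: prob_space del: times_complex.sel complex_cnj)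
    finally show ?thesis using i unfolding e[symmetric] by (subst nn_integral_eq_integral) auto
  qed
  have V0: "V \<ge> 0" unfolding V_def by simp
  have "(\<integral>\<^sup>+x. ennreal (exp (- (cmod (m + U x))\<^sup>2 / q)) * ennreal ((cmod (\<alpha> + \<beta> * U x + R x))\<^sup>2) \<partial>M) =
    (\<integral>\<^sup>+(u, x). ennreal (exp (- (cmod (m + u))\<^sup>2 / q)) * ennreal ((cmod (\<alpha> + \<beta> * u + R x))\<^sup>2) \<partial>(distr M (borel \<Otimes>\<^sub>M N) (\<lambda>x. (U x, x))))"
    by (subst nn_integral_distr) (auto simp: case_prod_beta)
  also have "\<dots> = (\<integral>\<^sup>+u. \<integral>\<^sup>+x. ennreal (exp (- (cmod (m + u))\<^sup>2 / q)) * ennreal ((cmod (\<alpha> + \<beta> * u + R x))\<^sup>2) \<partial>distr M N (\<lambda>x. x) \<partial>distr M borel U)"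
    unfolding ind by (subst N.nn_integral_fst[symmetric]) (auto simp: case_prod_beta)
  also have "\<dots> = (\<integral>\<^sup>+u. ennreal (exp (- (cmod (m + u))\<^sup>2 / q)) * ennreal ((cmod (\<alpha> + \<beta> * u))\<^sup>2 + V) \<partial>distr M borel U)"
    by (intro nn_integral_cong, subst nn_integral_distr) (auto simp: nn_integral_cmult inner)
  also have "\<dots> = (\<integral>\<^sup>+x. ennreal (exp (- (cmod (m + U x))\<^sup>2 / q)) * ennreal ((cmod (\<alpha> + \<beta> * U x))\<^sup>2 + V) \<partial>M)"
    by (subst nn_integral_distr) auto
  also note gaussian_tilt[OF U s q V0]
  finally show ?thesis unfolding V_def .
qed

section \<open>The area formula for holomorphic functions\<close>

text \<open>\<open>has_measure_differentiable_image\<close> and \<open>baby_Sard\<close> speak of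
  \<open>real ^ 'n\<close>; this pair of inverse isometries carries them over to the complex
  plane.\<close>

definition vec2_to_complex :: "real ^ 2 \<Rightarrow> complex" where
  "vec2_to_complex v = Complex (v $ 1) (v $ 2)"

definition complex_to_vec2 :: "complex \<Rightarrow> real ^ 2" where
  "complex_to_vec2 z = (\<chi> i. if i = 1 then Re z else Im z)"

lemma vec2_inverse [simp]: "vec2_to_complex (complex_to_vec2 z) = z"
  "complex_to_vec2 (vec2_to_complex v) = v"
  by (auto simp: vec2_to_complex_def complex_to_vec2_def vec_eq_iff forall_2)

lemma bounded_linear_vec2_to_complex: "bounded_linear vec2_to_complex"
  unfolding vec2_to_complex_def Complex_eq
  by (intro bounded_linear_intros bounded_linear_compose[OF bounded_linear_of_real] bounded_linear_vec_nth)

lemma linear_complex_to_vec2: "linear complex_to_vec2"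
  by (rule linearI) (auto simp: complex_to_vec2_def vec_eq_iff)

lemma bounded_linear_complex_to_vec2: "bounded_linear complex_to_vec2"
  by (rule linear_conv_bounded_linear[THEN iffD1, OF linear_complex_to_vec2])

lemma measurable_vec2 [measurable]:
  "vec2_to_complex \<in> borel_measurable borel" "complex_to_vec2 \<in> borel_measurable borel"
  by (auto intro!: borel_measurable_continuous_onI linear_continuous_on
      bounded_linear_vec2_to_complex bounded_linear_complex_to_vec2)

lemma lborel_complex_eq_distr_vec2: "lborel = distr lborel borel vec2_to_complex"
proof (rule lborel_eqI)
  fix l u :: complex assume lu: "\<And>b. b \<in> Basis \<Longrightarrow> l \<bullet> b \<le> u \<bullet> b"
  have "vec2_to_complex -` box l u = box (complex_to_vec2 l) (complex_to_vec2 u)"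
    by (auto simp: in_box_complex_iff mem_box_cart vec2_to_complex_def complex_to_vec2_def forall_2 box_Complex_eq)
  moreover have "Re l \<le> Re u" "Im l \<le> Im u" using lu[of 1] lu[of \<i>] by (auto simp: Basis_complex_def)
  then have "emeasure lborel (box (complex_to_vec2 l) (complex_to_vec2 u)) = ennreal (prod ((\<bullet>) (complex_to_vec2 u - complex_to_vec2 l)) Basis)"
    by (intro emeasure_lborel_box)
       (auto simp: Basis_vec_def inner_axis complex_to_vec2_def)
  moreover have "prod ((\<bullet>) (complex_to_vec2 u - complex_to_vec2 l)) Basis = prod ((\<bullet>) (u - l)) Basis"
  proof -
    have B: "(Basis :: (real^2) set) = (\<lambda>i. axis i 1) ` UNIV" by (auto simp: Basis_vec_def)
    have "inj (\<lambda>i::2. axis i (1::real))" by (auto simp: inj_on_def axis_eq_axis)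
    then have "prod ((\<bullet>) (complex_to_vec2 u - complex_to_vec2 l)) Basis = (Re u - Re l) * (Im u - Im l)"
      unfolding B by (simp add: prod.reindex inner_axis complex_to_vec2_def UNIV_2)
    also have "\<dots> = prod ((\<bullet>) (u - l)) Basis"
      by (simp add: Basis_complex_def)
    finally show ?thesis .
  qed
  ultimately show "emeasure (distr lborel borel vec2_to_complex) (box l u) = ennreal (prod ((\<bullet>) (u - l)) Basis)"
    by (simp add: emeasure_distr)
qed simp

lemma emeasure_vec2_to_complex_borel:
  assumes "A \<in> sets borel"
  shows "vec2_to_complex ` A \<in> sets borel" "emeasure lborel (vec2_to_complex ` A) = emeasure lborel A"
proof -
  have e: "vec2_to_complex ` A = complex_to_vec2 -` A \<inter> space borel"
    by (auto intro: rev_image_eqI)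
  show b: "vec2_to_complex ` A \<in> sets borel"
    unfolding e by (rule measurable_sets[OF _ assms]) measurable
  have i: "vec2_to_complex -` vec2_to_complex ` A = A"
    by (metis inj_on_def inj_vimage_image_eq vec2_inverse(2))
  show "emeasure lborel (vec2_to_complex ` A) = emeasure lborel A"
    by (subst lborel_complex_eq_distr_vec2) (simp add: emeasure_distr b i)
qed

text \<open>Images under \<open>h\<close> are obtained only as Lebesgue measurable sets, so the
  Borel case is extended by splitting off a subset of a Borel null set.\<close>

lemma emeasure_vec2_to_complex_lebesgue:
  assumes "A \<in> sets lebesgue"
  shows "vec2_to_complex ` A \<in> sets lebesgue" "emeasure lebesgue (vec2_to_complex ` A) = emeasure lebesgue A"
proof -
  from sets_completionE[OF assms] obtain S N N' where
    SN: "A = S \<union> N" "N \<subseteq> N'" "N' \<in> null_sets lborel" "S \<in> sets lborel" .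
  let ?f = "\<lambda>A. vec2_to_complex ` A"
  have N': "?f N' \<in> null_sets lborel"
    using emeasure_vec2_to_complex_borel[of N'] SN(3) by (auto simp: null_sets_def)
  have e: "?f A = ?f S \<union> ?f N" "?f N \<subseteq> ?f N'" "?f S \<in> sets lborel"
    using SN emeasure_vec2_to_complex_borel(1)[of S] by auto
  show m: "?f A \<in> sets lebesgue"
    using sets_completionI[OF e(1,2) N' e(3)] .
  have null: "N \<in> null_sets lebesgue" "?f N \<in> null_sets lebesgue"
    using SN(2,3) e(2) N' by (meson null_sets_completion_subset null_sets_completionI)+
  have "emeasure lebesgue (?f A) = emeasure lebesgue (?f S)"
    unfolding e(1) using null e(3) by (intro emeasure_Un_null_set) auto
  also have "\<dots> = emeasure lborel (?f S)" using e(3) by simp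
  also have "\<dots> = emeasure lborel S" using emeasure_vec2_to_complex_borel(2)[of S] SN(4) by simp
  also have "\<dots> = emeasure lebesgue S" using SN(4) by simp
  also have "\<dots> = emeasure lebesgue A"
    unfolding SN(1) using null SN(4) by (intro emeasure_Un_null_set[symmetric]) auto
  finally show "emeasure lebesgue (?f A) = emeasure lebesgue A" .
qed

definition vec2_map :: "(complex \<Rightarrow> complex) \<Rightarrow> real ^ 2 \<Rightarrow> real ^ 2" where
  "vec2_map h = complex_to_vec2 \<circ> h \<circ> vec2_to_complex"

text \<open>By the Cauchy-Riemann equations the real derivative of a holomorphic map is
  multiplication by a complex number \<open>d\<close>, a rotation with scaling, whose determinant is
  the square of \<open>cmod d\<close>.\<close>

lemma vec2_map_derivative:
  assumes "(h has_field_derivative d) (at (vec2_to_complex x))"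
  shows "(vec2_map h has_derivative vec2_map ((*) d)) (at x within S)"
    and "det (matrix (vec2_map ((*) d))) = (cmod d)\<^sup>2"
proof -
  have "((\<lambda>x. complex_to_vec2 (h (vec2_to_complex x))) has_derivative
     (\<lambda>v. complex_to_vec2 (d * vec2_to_complex v))) (at x)"
    by (rule bounded_linear.has_derivative[OF bounded_linear_complex_to_vec2
          has_derivative_compose[OF bounded_linear_imp_has_derivative[OF bounded_linear_vec2_to_complex]
          assms[unfolded has_field_derivative_def]]])
  then show "(vec2_map h has_derivative vec2_map ((*) d)) (at x within S)"
    by (auto simp: vec2_map_def o_def intro: has_derivative_at_withinI)
  show "det (matrix (vec2_map ((*) d))) = (cmod d)\<^sup>2"
    by (simp add: det_2 matrix_def vec2_map_def complex_to_vec2_def vec2_to_complex_def axis_def cmod_power2)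
       (simp add: power2_eq_square)
qed

lemma vec2_map_image: "vec2_to_complex ` vec2_map h ` (complex_to_vec2 ` B) = h ` B"
  by (force simp: vec2_map_def image_iff)

text \<open>Change of variables with Jacobian \<open>(cmod (h' z))\<^sup>2\<close>. Boundedness of
  \<open>B\<close> and of \<open>h'\<close> makes the integral of the Jacobian finite, which the
  underlying equivalence between a Henstock integral and a finite measure requires.\<close>

lemma emeasure_holomorphic_image:
  assumes B: "B \<in> sets borel" "bounded B" and der: "\<And>z. z \<in> B \<Longrightarrow> (h has_field_derivative h' z) (at z)"
    and inj: "inj_on h B" and bd: "\<And>z. z \<in> B \<Longrightarrow> cmod (h' z) \<le> C"
    and [measurable]: "(\<lambda>z. if z \<in> B then h' z else 0) \<in> borel_measurable borel"
  shows "h ` B \<in> sets lebesgue"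
    and "emeasure lebesgue (h ` B) = (\<integral>\<^sup>+z\<in>B. ennreal ((cmod (h' z))\<^sup>2) \<partial>lborel)"
proof -
  note B(1)[measurable]
  define B2 where "B2 = complex_to_vec2 ` B"
  define k where "k z = (if z \<in> B then h' z else 0)" for z
  have km[measurable]: "k \<in> borel_measurable borel" unfolding k_def[abs_def] by measurable
  have B2e: "B2 = vec2_to_complex -` B \<inter> space borel" unfolding B2_def by (auto intro: rev_image_eqI)
  have B2 [measurable]: "B2 \<in> sets borel" unfolding B2e by (rule measurable_sets[OF _ B(1)]) measurable
  have bB2: "bounded B2" unfolding B2_def by (rule bounded_linear_image[OF B(2) bounded_linear_complex_to_vec2])
  have z: "x \<in> B2 \<Longrightarrow> vec2_to_complex x \<in> B" for x unfolding B2e by auto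
  let ?D = "\<lambda>x. (cmod (k (vec2_to_complex x)))\<^sup>2"
  have C0: "C \<ge> 0" if "B \<noteq> {}" using that bd order.trans[OF norm_ge_zero] by blast
  have fin: "emeasure lborel B2 < \<infinity>" using emeasure_bounded_finite[OF bB2] .
  have int: "set_integrable lborel B2 ?D"
    unfolding set_integrable_def
  proof (rule integrableI_bounded_set[where A=B2 and B="C\<^sup>2"])
    show "AE x\<in>B2 in lborel. norm (indicat_real B2 x *\<^sub>R (cmod (k (vec2_to_complex x)))\<^sup>2) \<le> C\<^sup>2"
      using bd z by (auto simp: k_def intro!: power_mono)
  qed (use fin in \<open>auto simp: indicator_def\<close>)
  have "(?D has_integral set_lebesgue_integral lborel B2 ?D) B2"
    using set_borel_integral_eq_integral[OF int] by (simp add: has_integral_integral)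
  moreover have eq: "\<bar>det (matrix (vec2_map ((*) (h' (vec2_to_complex x)))))\<bar> = ?D x" if "x \<in> B2" for x
    using vec2_map_derivative(2)[OF der[OF z[OF that]]] z[OF that] by (simp add: k_def)
  ultimately have hi: "((\<lambda>x. \<bar>det (matrix (vec2_map ((*) (h' (vec2_to_complex x)))))\<bar>) has_integral set_lebesgue_integral lborel B2 ?D) B2"
    by (subst has_integral_cong[OF eq]) auto
  have inj2: "inj_on (vec2_map h) B2"
    using inj unfolding B2_def vec2_map_def inj_on_def by (metis comp_apply image_iff vec2_inverse(1))
  have "vec2_map h ` B2 \<in> lmeasurable \<and> measure lebesgue (vec2_map h ` B2) = set_lebesgue_integral lborel B2 ?D"
    using hi by (subst has_measure_differentiable_image) (use B2 vec2_map_derivative(1)[OF der[OF z]] inj2 in auto)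
  then have m: "vec2_map h ` B2 \<in> sets lebesgue" and em: "emeasure lebesgue (vec2_map h ` B2) = ennreal (set_lebesgue_integral lborel B2 ?D)"
    by (auto simp: emeasure_eq_measure2 fmeasurableD fmeasurableD2)
  have im: "h ` B = vec2_to_complex ` (vec2_map h ` B2)" unfolding B2_def vec2_map_image ..
  show "h ` B \<in> sets lebesgue" unfolding im by (rule emeasure_vec2_to_complex_lebesgue(1)[OF m])
  have "emeasure lebesgue (h ` B) = ennreal (set_lebesgue_integral lborel B2 ?D)"
    unfolding im emeasure_vec2_to_complex_lebesgue(2)[OF m] em ..
  also have "\<dots> = (\<integral>\<^sup>+x. ennreal (indicat_real B2 x *\<^sub>R ?D x) \<partial>lborel)"
    using int unfolding set_integrable_def set_lebesgue_integral_def
    by (intro nn_integral_eq_integral[symmetric]) auto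
  also have "\<dots> = (\<integral>\<^sup>+x. (\<lambda>z. ennreal ((cmod (k z))\<^sup>2) * indicator B z) (vec2_to_complex x) \<partial>lborel)"
    by (intro nn_integral_cong) (auto simp: indicator_def B2e)
  also have "\<dots> = (\<integral>\<^sup>+z. ennreal ((cmod (k z))\<^sup>2) * indicator B z \<partial>distr lborel borel vec2_to_complex)"
    by (intro nn_integral_distr[symmetric]) measurable
  also have "\<dots> = (\<integral>\<^sup>+z\<in>B. ennreal ((cmod (h' z))\<^sup>2) \<partial>lborel)"
    unfolding lborel_complex_eq_distr_vec2[symmetric] by (intro nn_integral_cong) (auto simp: indicator_def k_def)
  finally show "emeasure lebesgue (h ` B) = (\<integral>\<^sup>+z\<in>B. ennreal ((cmod (h' z))\<^sup>2) \<partial>lborel)" .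
qed

text \<open>The formula for the measure of images, applied to the parts
  \<open>B \<inter> h -\<close> A\<open>of\<close>B\<open>, identifies two measures on the target:
  the image of the Jacobian density and Lebesgue measure on\<close>h \<open>B\<close>. Integrating
  \<open>p\<close> against both gives the claim.\<close>

lemma nn_integral_injective_holomorphic:
  fixes p :: "complex \<Rightarrow> ennreal"
  assumes B: "B \<in> sets borel" "bounded B" and der: "\<And>z. z \<in> B \<Longrightarrow> (h has_field_derivative h' z) (at z)"
    and inj: "inj_on h B" and bd: "\<And>z. z \<in> B \<Longrightarrow> cmod (h' z) \<le> C"
    and h'm: "(\<lambda>z. if z \<in> B then h' z else 0) \<in> borel_measurable borel"
    and p[measurable]: "p \<in> borel_measurable borel"
  shows "(\<integral>\<^sup>+z\<in>B. p (h z) * ennreal ((cmod (h' z))\<^sup>2) \<partial>lborel) = (\<integral>\<^sup>+w\<in>h ` B. p w \<partial>lebesgue)"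
proof -
  note B(1)[measurable]
  have "continuous_on B h" using der by (meson DERIV_isCont continuous_at_imp_continuous_on)
  define k where "k z = (if z \<in> B then h z else 0)" for z
  have k[measurable]: "k \<in> borel_measurable borel"
    unfolding k_def[abs_def] by (rule borel_measurable_continuous_on_if[OF B(1) \<open>continuous_on B h\<close> continuous_on_const])
  \<comment> \<open>\<open>d\<close> is 0 outside \<open>B\<close>, so the default value 0 of
    \<open>k\<close> there carries no mass.\<close>
  define d where "d z = ennreal ((cmod (if z \<in> B then h' z else 0))\<^sup>2)" for z
  have d[measurable]: "d \<in> borel_measurable borel"
    unfolding d_def[abs_def] using h'm by measurable
  have hB: "h ` B \<in> sets lebesgue" by (rule emeasure_holomorphic_image(1)[OF B der inj bd h'm])
  define N1 where "N1 = distr (density lborel d) borel k"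
  define N2 where "N2 = distr (density lebesgue (indicator (h ` B))) borel (\<lambda>x. x)"
  have idm: "(\<lambda>x. x) \<in> measurable (density lebesgue (indicator (h ` B))) borel"
    by (simp add: measurable_completion)
  have "N1 = N2"
  proof (rule measure_eqI)
    fix A assume "A \<in> sets N1"
    then have A[measurable]: "A \<in> sets borel" by (simp add: N1_def)
    define D where "D = B \<inter> (k -` A \<inter> space borel)"
    have D: "D \<in> sets borel" unfolding D_def by measurable
    have kA: "k -` A \<in> sets borel" using measurable_sets[OF k A] by simp
    have DB: "D \<subseteq> B" by (auto simp: D_def)
    have "emeasure N1 A = (\<integral>\<^sup>+z. d z * indicator (k -` A) z \<partial>lborel)"
      unfolding N1_def by (subst emeasure_distr) (auto simp: emeasure_density kA)
    also have "\<dots> = (\<integral>\<^sup>+z\<in>D. ennreal ((cmod (h' z))\<^sup>2) \<partial>lborel)"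
      by (intro nn_integral_cong) (auto simp: d_def D_def indicator_def)
    also have "\<dots> = emeasure lebesgue (h ` D)"
    proof (rule emeasure_holomorphic_image(2)[symmetric, OF D])
      have "(\<lambda>z. if z \<in> D then h' z else 0) = (\<lambda>z. if z \<in> D then (if z \<in> B then h' z else 0) else 0)"
        using DB by (intro ext) auto
      also have "\<dots> \<in> borel_measurable borel" using h'm D by measurable
      finally show "(\<lambda>z. if z \<in> D then h' z else 0) \<in> borel_measurable borel" .
    qed (use DB B bd inj in \<open>auto intro: bounded_subset inj_on_subset der\<close>)
    also have "h ` D = h ` B \<inter> A" by (auto simp: D_def k_def split: if_splits)
    also have "emeasure lebesgue (h ` B \<inter> A) = emeasure N2 A"
    proof -
      have AL: "A \<in> sets lebesgue" using A by simp
      have "emeasure N2 A = emeasure (density lebesgue (indicator (h ` B))) A"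
        unfolding N2_def using A by (subst emeasure_distr[OF idm]) (auto simp: space_borel)
      also have "\<dots> = (\<integral>\<^sup>+x. indicator (h ` B) x * indicator A x \<partial>lebesgue)"
        using hB AL by (intro emeasure_density) auto
      also have "\<dots> = (\<integral>\<^sup>+x. indicator (h ` B \<inter> A) x \<partial>lebesgue)"
        by (simp only: indicator_inter_arith)
      also have "\<dots> = emeasure lebesgue (h ` B \<inter> A)" using hB AL by (intro nn_integral_indicator) auto
      finally show ?thesis by (rule sym)
    qed
    finally show "emeasure N1 A = emeasure N2 A" .
  qed (simp add: N1_def N2_def)
  have "(\<integral>\<^sup>+z\<in>B. p (h z) * ennreal ((cmod (h' z))\<^sup>2) \<partial>lborel) = (\<integral>\<^sup>+z. d z * p (k z) \<partial>lborel)"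
    by (intro nn_integral_cong) (auto simp: d_def k_def indicator_def mult_ac)
  also have "\<dots> = (\<integral>\<^sup>+w. p w \<partial>N1)"
    unfolding N1_def by (subst nn_integral_distr) (auto simp: nn_integral_density)
  also have "\<dots> = (\<integral>\<^sup>+w. p w \<partial>N2)" by (simp add: \<open>N1 = N2\<close>)
  also have "\<dots> = (\<integral>\<^sup>+w. indicator (h ` B) w * p w \<partial>lebesgue)"
    unfolding N2_def using hB idm
    by (subst nn_integral_distr) (auto simp: nn_integral_density measurable_completion)
  finally show ?thesis by (simp add: mult.commute)
qed

text \<open>A vanishing complex derivative has real rank 0, which is below 2, so Sard's theorem
  applies. Thus values taken at critical points do not contribute to the integral over
  \<open>w\<close>.\<close>

lemma null_sets_critical_values:
  fixes h :: "complex \<Rightarrow> complex"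
  assumes der: "\<And>z. z \<in> A \<Longrightarrow> (h has_field_derivative 0) (at z)"
  shows "h ` A \<in> null_sets lebesgue"
proof -
  let ?A = "complex_to_vec2 ` A"
  have "negligible (vec2_map h ` ?A)"
  proof (rule baby_Sard)
    fix x assume "x \<in> ?A"
    then have x: "vec2_to_complex x \<in> A" by auto
    show "(vec2_map h has_derivative vec2_map ((*) 0)) (at x within ?A)"
      by (rule vec2_map_derivative(1)[OF der[OF x]])
    have "vec2_map ((*) 0) = (\<lambda>x. 0)" by (auto simp: vec2_map_def complex_to_vec2_def vec_eq_iff)
    then have "matrix (vec2_map ((*) 0)) = 0" by (simp add: matrix_def vec_eq_iff)
    then show "rank (matrix (vec2_map ((*) 0))) < CARD(2)" by simp
  qed simp
  then have "vec2_map h ` ?A \<in> null_sets lebesgue" by (simp add: negligible_iff_null_sets)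
  then show ?thesis
    using emeasure_vec2_to_complex_lebesgue[of "vec2_map h ` ?A"] unfolding vec2_map_image null_sets_def by auto
qed

text \<open>Noncritical points are covered by countably many discs on which \<open>h\<close> is
  injective with bounded derivative. On disjoint pieces of these the injective formula holds, and
  summing the indicators of the images counts preimages. The remaining critical points add 0 on the
  left and affect only a null set of \<open>w\<close> on the right, so even a constant
  \<open>h\<close> is covered.\<close>

theorem area_formula_holomorphic:
  fixes p :: "complex \<Rightarrow> ennreal"
  assumes U: "open U" and h: "h holomorphic_on U" and \<Omega>: "\<Omega> \<in> sets borel" "\<Omega> \<subseteq> U"
    and p[measurable]: "p \<in> borel_measurable borel"
  shows "(\<integral>\<^sup>+z\<in>\<Omega>. p (h z) * ennreal ((cmod (deriv h z))\<^sup>2) \<partial>lborel) =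
         (\<integral>\<^sup>+w. p w * emeasure (count_space UNIV) {z\<in>\<Omega>. h z = w} \<partial>lborel)"
proof -
  note \<Omega>(1)[measurable]
  have der: "z \<in> U \<Longrightarrow> (h has_field_derivative deriv h z) (at z)" for z
    using holomorphic_derivI[OF h U] by simp
  have cd: "continuous_on U (deriv h)" by (intro holomorphic_on_imp_continuous_on holomorphic_deriv h U)
  define F where "F = {B. open B \<and> bounded B \<and> B \<subseteq> U \<and> inj_on h B \<and> (\<exists>C. \<forall>z\<in>B. cmod (deriv h z) \<le> C)}"
  have cov: "\<exists>B\<in>F. z \<in> B" if z: "z \<in> U" "deriv h z \<noteq> 0" for z
  proof -
    obtain r where r: "r > 0" "inj_on h (ball z r)" "ball z r \<subseteq> U"
      using has_complex_derivative_locally_injective[OF h z(1) U z(2)] by blast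
    \<comment> \<open>Half the radius leaves a compact closed disc inside \<open>U\<close>, on which
      \<open>deriv h\<close> is bounded.\<close>
    define B where "B = ball z (r/2)"
    have cB: "cball z (r/2) \<subseteq> U" using r by (intro order.trans[OF _ r(3)]) auto
    have "compact (deriv h ` cball z (r/2))"
      by (intro compact_continuous_image continuous_on_subset[OF cd cB]) auto
    then obtain C where "\<And>w. w \<in> cball z (r/2) \<Longrightarrow> cmod (deriv h w) \<le> C"
      using compact_imp_bounded bounded_iff by (metis imageI)
    then have "B \<in> F" unfolding F_def B_def using cB r(1)
      by (auto intro!: inj_on_subset[OF r(2)] exI[of _ C])
    then show ?thesis using r(1) by (intro bexI[of _ B]) (auto simp: B_def)
  qed
  obtain F' where F': "F' \<subseteq> F" "countable F'" "\<Union>F' = \<Union>F"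
    using Lindelof[of F] unfolding F_def by blast
  \<comment> \<open>If there are no noncritical points the cover is empty and has no enumeration;
    the empty set is then used throughout.\<close>
  define E where "E = (\<lambda>n. if F' = {} then {} else from_nat_into F' n)"
  have EF: "F' = {} \<and> E n = {} \<or> E n \<in> F" for n
    using F'(1) from_nat_into[of F' n] by (auto simp: E_def)
  have EU: "(\<Union>n. E n) = \<Union>F"
    using F'(2,3) range_from_nat_into[of F'] by (cases "F' = {}") (auto simp: E_def)
  have Eo: "open (E n)" "bounded (E n)" "E n \<subseteq> U" "inj_on h (E n)" "\<exists>C. \<forall>z\<in>E n. cmod (deriv h z) \<le> C" for n
    using EF[of n] unfolding F_def by auto
  define D where "D n = \<Omega> \<inter> disjointed E n" for n
  have Eb: "range E \<subseteq> sets borel" using Eo(1) by auto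
  have Db[measurable]: "D n \<in> sets borel" for n
    using sets.range_disjointed_sets[OF Eb] unfolding D_def by (intro sets.Int \<Omega>(1)) auto
  have Dd: "disjoint_family D" using disjoint_family_disjointed[of E] unfolding D_def disjoint_family_on_def by auto
  have DE: "D n \<subseteq> E n" for n using disjointed_subset[of E n] by (auto simp: D_def)
  have DU: "(\<Union>n. D n) = \<Omega> \<inter> \<Union>F" using UN_disjointed_eq[of E] EU by (auto simp: D_def)
  define Z where "Z = \<Omega> - \<Union>F"
  have Z0: "z \<in> Z \<Longrightarrow> deriv h z = 0" for z using cov \<Omega>(2) by (auto simp: Z_def)
  have Zn: "h ` Z \<in> null_sets lebesgue"
    by (rule null_sets_critical_values) (use der Z0 \<Omega>(2) in \<open>metis Z_def Diff_iff subsetD\<close>)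
  have Dp: "bounded (D n)" "inj_on h (D n)" for n
    using Eo(2,4)[of n] DE[of n] by (auto intro: bounded_subset inj_on_subset)
  have Dm: "(\<lambda>z. if z \<in> D n then deriv h z else 0) \<in> borel_measurable borel" for n
    using continuous_on_subset[OF cd, of "D n"] Eo(3)[of n] DE[of n] by (intro borel_measurable_continuous_on_if Db continuous_on_const) auto
  have "(\<integral>\<^sup>+z\<in>\<Omega>. p (h z) * ennreal ((cmod (deriv h z))\<^sup>2) \<partial>lborel) =
     (\<integral>\<^sup>+z. (\<Sum>n. p (h z) * ennreal ((cmod (deriv h z))\<^sup>2) * indicator (D n) z) \<partial>lborel)"
  proof (rule nn_integral_cong)
    fix z
    have "(\<Sum>n. indicator (D n) z :: ennreal) = indicator (\<Union>n. D n) z"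
      by (rule suminf_indicator[OF Dd])
    then show "p (h z) * ennreal ((cmod (deriv h z))\<^sup>2) * indicator \<Omega> z = (\<Sum>n. p (h z) * ennreal ((cmod (deriv h z))\<^sup>2) * indicator (D n) z)"
      unfolding ennreal_suminf_cmult DU using Z0[of z] by (auto simp: indicator_def Z_def)
  qed
  also have "\<dots> = (\<Sum>n. \<integral>\<^sup>+z. p (h z) * ennreal ((cmod (deriv h z))\<^sup>2) * indicator (D n) z \<partial>lborel)"
  proof (rule nn_integral_suminf)
    fix n
    have hm[measurable]: "(\<lambda>z. if z \<in> D n then h z else 0) \<in> borel_measurable borel"
      using der Eo(3) DE by (intro borel_measurable_continuous_on_if Db continuous_on_const) (meson DERIV_isCont continuous_at_imp_continuous_on subsetD)
    note Dm[measurable]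
    have "(\<lambda>z. p (if z \<in> D n then h z else 0) * ennreal ((cmod (if z \<in> D n then deriv h z else 0))\<^sup>2) * indicator (D n) z) \<in> borel_measurable lborel"
      by measurable
    then show "(\<lambda>z. p (h z) * ennreal ((cmod (deriv h z))\<^sup>2) * indicator (D n) z) \<in> borel_measurable lborel"
      by (rule measurable_cong[THEN iffD1, rotated]) (auto simp: indicator_def)
  qed
  also have "\<dots> = (\<Sum>n. \<integral>\<^sup>+w\<in>h ` D n. p w \<partial>lebesgue)"
  proof (rule suminf_cong)
    fix n
    obtain C where C: "\<forall>z\<in>E n. cmod (deriv h z) \<le> C" using Eo(5) by blast
    show "(\<integral>\<^sup>+z\<in>D n. p (h z) * ennreal ((cmod (deriv h z))\<^sup>2) \<partial>lborel) = (\<integral>\<^sup>+w\<in>h ` D n. p w \<partial>lebesgue)"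
    proof (rule nn_integral_injective_holomorphic)
    qed (use der Eo(3)[of n] DE[of n] C Dp Dm in auto)
  qed
  also have "\<dots> = (\<integral>\<^sup>+w. (\<Sum>n. p w * indicator (h ` D n) w) \<partial>lebesgue)"
  proof (rule nn_integral_suminf[symmetric])
    fix n
    obtain C where C: "\<forall>z\<in>E n. cmod (deriv h z) \<le> C" using Eo(5) by blast
    have [measurable]: "h ` D n \<in> sets lebesgue"
    proof (rule emeasure_holomorphic_image(1))
    qed (use der Eo(3)[of n] DE[of n] C Dp Dm in auto)
    have [measurable]: "p \<in> borel_measurable lebesgue" using p by (simp add: measurable_completion)
    show "(\<lambda>w. p w * indicator (h ` D n) w) \<in> borel_measurable lebesgue" by measurable
  qed
  also have "\<dots> = (\<integral>\<^sup>+w. p w * emeasure (count_space UNIV) {z\<in>\<Omega>. h z = w} \<partial>lebesgue)"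
  proof (rule nn_integral_cong_AE, rule AE_I'[OF Zn], rule subsetI, rule ccontr)
    fix w assume w: "w \<in> {w \<in> space lebesgue. (\<Sum>n. p w * indicator (h ` D n) w) \<noteq> p w * emeasure (count_space UNIV) {z \<in> \<Omega>. h z = w}}" "w \<notin> h ` Z"
    have "emeasure (count_space UNIV) {z\<in>\<Omega>. h z = w} = emeasure (count_space UNIV) (\<Union>n. {z\<in>D n. h z = w})"
      using w(2) DU by (intro arg_cong[where f="emeasure _"]) (auto simp: Z_def)
    also have "\<dots> = (\<Sum>n. emeasure (count_space UNIV) {z\<in>D n. h z = w})"
      using Dd by (intro suminf_emeasure[symmetric]) (auto simp: disjoint_family_on_def)
    also have "\<dots> = (\<Sum>n. indicator (h ` D n) w)"
    proof (rule suminf_cong)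
      fix n
      show "emeasure (count_space UNIV) {z\<in>D n. h z = w} = indicator (h ` D n) w"
      proof (cases "w \<in> h ` D n")
        case True
        then obtain z where z: "z \<in> D n" "h z = w" by auto
        then have "{z\<in>D n. h z = w} = {z}" using inj_onD[OF Eo(4)[of n]] DE[of n] by blast
        then show ?thesis using True by simp
      next
        case False
        then have "{z\<in>D n. h z = w} = {}" by auto
        then show ?thesis unfolding \<open>{z\<in>D n. h z = w} = {}\<close> using False by simp
      qed
    qed
    finally show False using w(1) by (simp add: ennreal_suminf_cmult)
  qed
  finally show ?thesis by (simp only: nn_integral_completion)
qed

section \<open>Measurability of zero counts\<close>

lemma sets_Collect_Bex_countable:
  assumes "countable X" "\<And>i. i \<in> X \<Longrightarrow> {x\<in>space N. P i x} \<in> sets N"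
  shows "{x\<in>space N. \<exists>i\<in>X. P i x} \<in> sets N"
proof -
  have "(\<Union>i\<in>X. {x\<in>space N. P i x}) \<in> sets N" by (rule sets.countable_UN'[OF assms(1)]) (use assms(2) in auto)
  also have "(\<Union>i\<in>X. {x\<in>space N. P i x}) = {x\<in>space N. \<exists>i\<in>X. P i x}" by auto
  finally show ?thesis .
qed

lemma sets_Collect_Ball_countable:
  assumes "countable X" "\<And>i. i \<in> X \<Longrightarrow> {x\<in>space N. P i x} \<in> sets N"
  shows "{x\<in>space N. \<forall>i\<in>X. P i x} \<in> sets N"
proof -
  have "{x\<in>space N. \<exists>i\<in>X. \<not> P i x} \<in> sets N"
    by (rule sets_Collect_Bex_countable[OF assms(1)]) (use assms(2) in \<open>auto intro: sets.sets_Collect_neg\<close>)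
  from sets.sets_Collect_neg[OF this] show ?thesis by simp
qed

text \<open>Rounding \<open>z\<close> down to the grid of mesh \<open>1 / (n + 1)\<close> leaves
  countably many parameter values, so the rounded function is jointly measurable; by continuity in
  \<open>z\<close> these functions converge pointwise.\<close>

lemma measurable_continuous_parameter:
  fixes G :: "'x \<Rightarrow> complex \<Rightarrow> complex"
  assumes m[measurable]: "\<And>z. (\<lambda>x. G x z) \<in> borel_measurable N"
    and c: "\<And>x. x \<in> space N \<Longrightarrow> continuous_on UNIV (G x)"
  shows "(\<lambda>(z, x). G x z) \<in> borel_measurable (borel \<Otimes>\<^sub>M N)"
proof -
  define g where "g n z = Complex (of_int \<lfloor>real (Suc n) * Re z\<rfloor> / real (Suc n)) (of_int \<lfloor>real (Suc n) * Im z\<rfloor> / real (Suc n))" for n z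
  have fl: "(\<lambda>n. of_int \<lfloor>real (Suc n) * a\<rfloor> / real (Suc n)) \<longlonglongrightarrow> a" for a :: real
  proof (rule LIMSEQ_I)
    fix r :: real assume "r > 0"
    then obtain n0 where n0: "1 / real (Suc n0) < r" using nat_approx_posE by metis
    show "\<exists>no. \<forall>n\<ge>no. norm (of_int \<lfloor>real (Suc n) * a\<rfloor> / real (Suc n) - a) < r"
    proof (intro exI[of _ n0] allI impI)
      fix n assume n: "n \<ge> n0"
      have "\<bar>of_int \<lfloor>real (Suc n) * a\<rfloor> - real (Suc n) * a\<bar> \<le> 1" by linarith
      then have "\<bar>of_int \<lfloor>real (Suc n) * a\<rfloor> - real (Suc n) * a\<bar> / real (Suc n) \<le> 1 / real (Suc n)"
        by (intro divide_right_mono) auto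
      also have "\<bar>of_int \<lfloor>real (Suc n) * a\<rfloor> - real (Suc n) * a\<bar> / real (Suc n) = \<bar>(of_int \<lfloor>real (Suc n) * a\<rfloor> - real (Suc n) * a) / real (Suc n)\<bar>"
        by (simp only: abs_divide abs_of_nat)
      also have "(of_int \<lfloor>real (Suc n) * a\<rfloor> - real (Suc n) * a) / real (Suc n) = of_int \<lfloor>real (Suc n) * a\<rfloor> / real (Suc n) - a"
        by (subst diff_divide_distrib) simp
      also have "1 / real (Suc n) \<le> 1 / real (Suc n0)" using n by (intro divide_left_mono) auto
      finally show "norm (of_int \<lfloor>real (Suc n) * a\<rfloor> / real (Suc n) - a) < r" using n0 by simp
    qed
  qed
  have gl: "(\<lambda>n. g n z) \<longlonglongrightarrow> z" for z
    unfolding g_def tendsto_complex_iff by (simp add: fl del: of_nat_Suc)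
  show ?thesis
  proof (rule borel_measurable_LIMSEQ_metric)
    fix n
    define h where "h = (\<lambda>(i::int, j::int) (z::complex, x). G x (Complex (of_int i / real (Suc n)) (of_int j / real (Suc n))))"
    have "(\<lambda>p. h ((\<lambda>(z, x). (\<lfloor>real (Suc n) * Re z\<rfloor>, \<lfloor>real (Suc n) * Im z\<rfloor>)) p) p) \<in> borel_measurable (borel \<Otimes>\<^sub>M N)"
    proof (rule measurable_compose_countable)
      show "h i \<in> borel_measurable (borel \<Otimes>\<^sub>M N)" for i
        unfolding h_def by (cases i) (simp add: case_prod_beta)
      have "(\<lambda>p::complex \<times> 'x. (\<lfloor>real (Suc n) * Re (fst p)\<rfloor>, \<lfloor>real (Suc n) * Im (fst p)\<rfloor>)) \<in> measurable (borel \<Otimes>\<^sub>M N) (count_space UNIV \<Otimes>\<^sub>M count_space UNIV)"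
        by measurable
      then show "(\<lambda>(z, x). (\<lfloor>real (Suc n) * Re z\<rfloor>, \<lfloor>real (Suc n) * Im z\<rfloor>)) \<in> measurable (borel \<Otimes>\<^sub>M N) (count_space UNIV)"
        by (simp add: pair_measure_countable case_prod_beta)
    qed
    then show "(\<lambda>(z, x). G x (g n z)) \<in> borel_measurable (borel \<Otimes>\<^sub>M N)"
      unfolding h_def g_def by (simp add: case_prod_beta)
  next
    fix p :: "complex \<times> 'x" assume "p \<in> space (borel \<Otimes>\<^sub>M N)"
    then obtain z x where p: "p = (z, x)" "x \<in> space N" by (auto simp: space_pair_measure)
    have "isCont (G x) z" using c[OF p(2)] by (simp add: continuous_on_eq_continuous_at)
    then have "(\<lambda>n. G x (g n z)) \<longlonglongrightarrow> G x z" using gl isCont_tendsto_compose by blast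
    then show "(\<lambda>n. case p of (z, x) \<Rightarrow> G x (g n z)) \<longlonglongrightarrow> (case p of (z, x) \<Rightarrow> G x z)" by (simp add: p)
  qed
qed

definition zero_count :: "(complex \<Rightarrow> complex) \<Rightarrow> complex set \<Rightarrow> ennreal" where
  "zero_count F \<Omega> = emeasure (count_space UNIV) {z\<in>\<Omega>. F z = 0}"

text \<open>The value 0 at the zero function makes the count finite on bounded sets for every entire
  function, which the complement step of the Dynkin argument below needs.\<close>

definition zero_count_nz :: "(complex \<Rightarrow> complex) \<Rightarrow> complex set \<Rightarrow> ennreal" where
  "zero_count_nz F \<Omega> = (if \<forall>z. F z = 0 then 0 else zero_count F \<Omega>)"

lemma zero_count_nz_disjoint_UN:
  assumes "disjoint_family D"
  shows "zero_count_nz F (\<Union>n. D n) = (\<Sum>n. zero_count_nz F (D n))"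
proof (cases "\<forall>z. F z = 0")
  case False
  have "{z\<in>(\<Union>n. D n). F z = 0} = (\<Union>n. {z\<in>D n. F z = 0})" by auto
  moreover have "disjoint_family (\<lambda>n. {z\<in>D n. F z = 0})" using assms by (auto simp: disjoint_family_on_def)
  ultimately have "zero_count F (\<Union>n. D n) = (\<Sum>n. zero_count F (D n))"
    unfolding zero_count_def by (simp add: suminf_emeasure)
  then show ?thesis using False by (simp only: zero_count_nz_def if_False)
qed (simp add: zero_count_nz_def)

text \<open>Infinitely many zeros in a disc would accumulate, and the identity theorem would force
  \<open>F\<close> to vanish everywhere.\<close>

lemma finite_zeros_bounded:
  assumes "F holomorphic_on UNIV" "F w \<noteq> 0" shows "finite {z\<in>\<Omega> \<inter> ball 0 r. F z = 0}"
proof (rule ccontr)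
  let ?S = "{z\<in>\<Omega> \<inter> ball 0 r. F z = 0}"
  assume "infinite ?S"
  moreover have "?S \<subseteq> cball 0 r" by auto
  ultimately obtain l where l: "l islimpt ?S" using compact_cball[of "0::complex" r]
    unfolding compact_eq_Bolzano_Weierstrass by blast
  have "F w = 0"
    by (rule analytic_continuation[OF assms(1) open_UNIV connected_UNIV _ _ l]) auto
  with assms(2) show False by simp
qed

text \<open>Kept abstract because it is used on two spaces: the probability space itself, and the
  product of the complex plane with the sigma-algebra of the residual noise, where the value at
  \<open>z0\<close> is a free variable.\<close>

locale measurable_entire =
  fixes N :: "'x measure" and F :: "'x \<Rightarrow> complex \<Rightarrow> complex"
  assumes meas[measurable]: "\<And>z. (\<lambda>x. F x z) \<in> borel_measurable N"
    and hol: "\<And>x. x \<in> space N \<Longrightarrow> F x holomorphic_on UNIV"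
begin

lemma cont: "x \<in> space N \<Longrightarrow> continuous_on A (F x)"
  using holomorphic_on_imp_continuous_on[OF hol] continuous_on_subset by blast

text \<open>Compactness replaces the uncountable existential: a zero exists iff
  \<open>cmod (F x d)\<close> becomes arbitrarily small for \<open>d\<close> in a countable dense
  subset of the open ball. Positivity of \<open>r\<close> makes the closed ball the closure of the
  open one.\<close>

lemma zero_in_cball_measurable:
  assumes r: "r > 0"
  shows "{x\<in>space N. \<exists>z\<in>cball a r. F x z = 0} \<in> sets N"
proof -
  obtain D :: "complex set" where D: "countable D" "\<And>X. open X \<Longrightarrow> X \<noteq> {} \<Longrightarrow> \<exists>d\<in>D. d \<in> X"
    using countable_dense_setE by blast
  have "(\<exists>z\<in>cball a r. F x z = 0) \<longleftrightarrow> (\<forall>n. \<exists>d\<in>D \<inter> ball a r. cmod (F x d) < 1 / real (Suc n))" if x: "x \<in> space N" for x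
  proof
    assume "\<exists>z\<in>cball a r. F x z = 0"
    then obtain z where z: "z \<in> cball a r" "F x z = 0" by blast
    show "\<forall>n. \<exists>d\<in>D \<inter> ball a r. cmod (F x d) < 1 / real (Suc n)"
    proof
      fix n
      have "isCont (F x) z" using cont[OF x, of UNIV] by (simp add: continuous_on_eq_continuous_at)
      then obtain e where e: "e > 0" "\<And>w. dist w z < e \<Longrightarrow> dist (F x w) (F x z) < 1 / real (Suc n)"
        unfolding continuous_at_eps_delta by (metis of_nat_0_less_iff zero_less_Suc zero_less_divide_1_iff)
      have "z \<in> closure (ball a r)" using z r by simp
      then obtain y where "y \<in> ball a r" "dist y z < e" using e(1) closure_approachable by blast
      then have "ball a r \<inter> ball z e \<noteq> {}" by (auto simp: dist_commute)
      then obtain d where "d \<in> D" "d \<in> ball a r \<inter> ball z e" using D(2)[of "ball a r \<inter> ball z e"] by auto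
      then show "\<exists>d\<in>D \<inter> ball a r. cmod (F x d) < 1 / real (Suc n)"
        using e(2)[of d] z(2) by (auto simp: dist_commute)
    qed
  next
    assume *: "\<forall>n. \<exists>d\<in>D \<inter> ball a r. cmod (F x d) < 1 / real (Suc n)"
    have "continuous_on (cball a r) (\<lambda>z. cmod (F x z))" by (intro continuous_on_norm cont[OF x])
    then obtain z where z: "z \<in> cball a r" "\<And>y. y \<in> cball a r \<Longrightarrow> cmod (F x z) \<le> cmod (F x y)"
      using continuous_attains_inf[of "cball a r" "\<lambda>z. cmod (F x z)"] r by auto
    have "cmod (F x z) = 0"
    proof (rule ccontr)
      assume "cmod (F x z) \<noteq> 0"
      then obtain n where "1 / real (Suc n) < cmod (F x z)" using nat_approx_posE[of "cmod (F x z)"] by auto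
      moreover obtain d where "d \<in> ball a r" "cmod (F x d) < 1 / real (Suc n)" using * by blast
      ultimately show False using z(2)[of d] by auto
    qed
    then show "\<exists>z\<in>cball a r. F x z = 0" using z(1) by auto
  qed
  then have "{x\<in>space N. \<exists>z\<in>cball a r. F x z = 0} = {x\<in>space N. \<forall>n. \<exists>d\<in>D \<inter> ball a r. cmod (F x d) < 1 / real (Suc n)}" by auto
  also have "\<dots> \<in> sets N"
    by (intro sets.sets_Collect_countable_All sets_Collect_Bex_countable countable_Int1 D(1)) measurable
  finally show ?thesis .
qed

text \<open>There are at least \<open>k\<close> zeros in an open set iff it contains \<open>k\<close> disjoint closed balls from a
  countable family that each contain a zero.\<close>

lemma zero_count_open_measurable:
  assumes B: "open B" shows "(\<lambda>x. zero_count (F x) B) \<in> borel_measurable N"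
proof -
  obtain D :: "complex set" where D: "countable D" "\<And>X. open X \<Longrightarrow> X \<noteq> {} \<Longrightarrow> \<exists>d\<in>D. d \<in> X"
    using countable_dense_setE by blast
  define K where "K = (\<lambda>(d, n). cball d (1 / real (Suc n))) ` (D \<times> (UNIV :: nat set))"
  have K: "countable K" unfolding K_def using D(1) by auto
  have Knear: "\<exists>C\<in>K. z \<in> C \<and> C \<subseteq> ball z e" if "e > 0" for z and e :: real
  proof -
    have "e / 2 > 0" using that by simp
    then obtain n where n: "1 / real (Suc n) < e / 2" by (rule nat_approx_posE)
    have "ball z (1 / real (Suc n)) \<noteq> {}" by simp
    then obtain d where d: "d \<in> D" "dist z d < 1 / real (Suc n)" using D(2)[of "ball z (1 / real (Suc n))"] by auto
    have "cball d (1 / real (Suc n)) \<subseteq> ball z e"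
    proof
      fix y assume "y \<in> cball d (1 / real (Suc n))"
      then have "dist d y \<le> 1 / real (Suc n)" by simp
      then show "y \<in> ball z e" using d(2) n dist_triangle[of z y d] by simp
    qed
    moreover have "cball d (1 / real (Suc n)) \<in> K" using d(1) unfolding K_def by (auto intro!: image_eqI[where x="(d, n)"])
    ultimately show ?thesis using d(2) by (intro bexI[of _ "cball d (1 / real (Suc n))"]) (auto simp: dist_commute)
  qed
  define Fk where "Fk k = {\<C>. finite \<C> \<and> \<C> \<subseteq> K \<and> card \<C> = k \<and> disjoint \<C> \<and> \<Union>\<C> \<subseteq> B}" for k
  have Fkc: "countable (Fk k)" for k
    by (rule countable_subset[OF _ countable_Collect_finite_subset[OF K]]) (auto simp: Fk_def)
  define E where "E k = {x\<in>space N. \<exists>\<C>\<in>Fk k. \<forall>C\<in>\<C>. \<exists>z\<in>C. F x z = 0}" for k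
  have E[measurable]: "E k \<in> sets N" for k
    unfolding E_def
  proof (rule sets_Collect_Bex_countable[OF Fkc])
    fix \<C> assume \<C>: "\<C> \<in> Fk k"
    have m: "{x\<in>space N. \<exists>z\<in>C. F x z = 0} \<in> sets N" if "C \<in> \<C>" for C
    proof -
      have "C \<in> K" using that \<C> unfolding Fk_def by blast
      then obtain d n where "C = cball d (1 / real (Suc n))" unfolding K_def by (auto simp del: of_nat_Suc)
      then show ?thesis using zero_in_cball_measurable[of "1 / real (Suc n)" d] by simp
    qed
    show "{x\<in>space N. \<forall>C\<in>\<C>. \<exists>z\<in>C. F x z = 0} \<in> sets N"
      using \<C> by (intro sets_Collect_Ball_countable m) (auto simp: Fk_def intro: countable_finite)
  qed
  have Eiff: "x \<in> E k \<longleftrightarrow> (\<exists>S\<subseteq>{z\<in>B. F x z = 0}. finite S \<and> card S = k)" if x: "x \<in> space N" for x k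
  proof
    assume "x \<in> E k"
    then obtain \<C> where \<C>: "\<C> \<in> Fk k" "\<forall>C\<in>\<C>. \<exists>z\<in>C. F x z = 0" unfolding E_def by blast
    then obtain f where f: "\<And>C. C \<in> \<C> \<Longrightarrow> f C \<in> C \<and> F x (f C) = 0" by metis
    have "inj_on f \<C>"
    proof (rule inj_onI)
      fix C C' assume "C \<in> \<C>" "C' \<in> \<C>" "f C = f C'"
      then show "C = C'" using f[of C] f[of C'] \<C>(1) unfolding Fk_def disjoint_def by auto
    qed
    then show "\<exists>S\<subseteq>{z\<in>B. F x z = 0}. finite S \<and> card S = k"
      using \<C>(1) f by (intro exI[of _ "f ` \<C>"]) (auto simp: Fk_def card_image)
  next
    assume "\<exists>S\<subseteq>{z\<in>B. F x z = 0}. finite S \<and> card S = k"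
    then obtain S where S: "S \<subseteq> {z\<in>B. F x z = 0}" "finite S" "card S = k" by blast
    \<comment> \<open>The factor 2 makes the balls of radius \<open>e\<close> around different
      points of \<open>S\<close> disjoint.\<close>
    have "\<exists>e>0. ball z e \<subseteq> B \<and> (\<forall>y\<in>S. y \<noteq> z \<longrightarrow> 2 * e \<le> dist z y)" if z: "z \<in> S" for z
    proof -
      obtain e1 where e1: "e1 > 0" "ball z e1 \<subseteq> B" using S z B open_contains_ball by (metis (no_types, lifting) mem_Collect_eq subsetD)
      obtain e2 where e2: "e2 > 0" "\<forall>y\<in>S. y \<noteq> z \<longrightarrow> e2 \<le> dist z y" using finite_set_avoid[OF S(2), of z] by blast
      show ?thesis using e1 e2 by (intro exI[of _ "min e1 (e2 / 2)"]) auto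
    qed
    then obtain e where e: "\<And>z. z \<in> S \<Longrightarrow> e z > 0 \<and> ball z (e z) \<subseteq> B \<and> (\<forall>y\<in>S. y \<noteq> z \<longrightarrow> 2 * e z \<le> dist z y)" by metis
    have "\<exists>C\<in>K. z \<in> C \<and> C \<subseteq> ball z (e z)" if "z \<in> S" for z
      using Knear[of "e z" z] e[OF that] by blast
    then obtain C where C: "\<And>z. z \<in> S \<Longrightarrow> C z \<in> K \<and> z \<in> C z \<and> C z \<subseteq> ball z (e z)" by metis
    have dj: "C z \<inter> C z' = {}" if "z \<in> S" "z' \<in> S" "z \<noteq> z'" for z z'
    proof (rule ccontr)
      assume "C z \<inter> C z' \<noteq> {}"
      then obtain y where "y \<in> C z" "y \<in> C z'" by blast
      then have "y \<in> ball z (e z)" "y \<in> ball z' (e z')" using C[OF that(1)] C[OF that(2)] by blast+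
      then have "dist z y < e z" "dist z' y < e z'" by auto
      moreover have "2 * e z \<le> dist z z'" "2 * e z' \<le> dist z z'" using e[of z] e[of z'] that by (auto simp: dist_commute)
      ultimately show False using dist_triangle2[of z z' y] by linarith
    qed
    have inj: "inj_on C S" using dj C by (intro inj_onI) blast
    have "C ` S \<in> Fk k"
      unfolding Fk_def disjoint_def using S(2,3) C e dj by (auto simp: card_image[OF inj]) (blast dest: subsetD)+
    moreover have "\<forall>A\<in>C ` S. \<exists>z\<in>A. F x z = 0" using C S(1) by blast
    ultimately show "x \<in> E k" unfolding E_def using x by blast
  qed
  have "zero_count (F x) B = (SUP k. of_nat k * indicator (E k) x)" if x: "x \<in> space N" for x
  proof -
    let ?Z = "{z\<in>B. F x z = 0}"
    show ?thesis
    proof (rule antisym)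
      show "(SUP k. of_nat k * indicator (E k) x) \<le> zero_count (F x) B"
      proof (rule SUP_least)
        fix k
        show "of_nat k * indicator (E k) x \<le> zero_count (F x) B"
        proof (cases "x \<in> E k")
          case True
          then obtain S where S: "S \<subseteq> ?Z" "finite S" "card S = k" using Eiff[OF x] by blast
          have "emeasure (count_space UNIV) S \<le> emeasure (count_space UNIV) ?Z" by (rule emeasure_mono[OF S(1)]) simp
          then show ?thesis using S True by (simp add: zero_count_def emeasure_count_space_finite)
        qed simp
      qed
      show "zero_count (F x) B \<le> (SUP k. of_nat k * indicator (E k) x)"
      proof (cases "finite ?Z")
        case True
        then have "x \<in> E (card ?Z)" using Eiff[OF x] by blast
        then have "zero_count (F x) B = of_nat (card ?Z) * indicator (E (card ?Z)) x"
          using True by (simp add: zero_count_def emeasure_count_space_finite)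
        also have "\<dots> \<le> (SUP k. of_nat k * indicator (E k) x)" by (rule SUP_upper) simp
        finally show ?thesis .
      next
        case False
        have "x \<in> E k" for k using infinite_arbitrarily_large[OF False, of k] Eiff[OF x] by blast
        then have "(SUP k. of_nat k * indicator (E k) x) = (SUP k. of_nat k :: ennreal)" by simp
        also have "\<dots> = \<top>" by (rule ennreal_SUP_of_nat_eq_top)
        finally have "(SUP k. of_nat k * indicator (E k) x) = (\<top> :: ennreal)" .
        then show ?thesis by (simp only: top_greatest)
      qed
    qed
  qed
  then show ?thesis
    by (subst measurable_cong[of N _ "\<lambda>x. SUP k. of_nat k * indicator (E k) x"]) auto
qed

lemma zero_set_measurable [measurable]: "{x\<in>space N. \<forall>z. F x z = 0} \<in> sets N"
proof -
  obtain D :: "complex set" where D: "countable D" "\<And>X. open X \<Longrightarrow> X \<noteq> {} \<Longrightarrow> \<exists>d\<in>D. d \<in> X"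
    using countable_dense_setE by blast
  have "(\<forall>z. F x z = 0) \<longleftrightarrow> (\<forall>d\<in>D. F x d = 0)" if x: "x \<in> space N" for x
  proof safe
    fix z assume *: "\<forall>d\<in>D. F x d = 0"
    show "F x z = 0"
    proof (rule ccontr)
      assume z: "F x z \<noteq> 0"
      have "open {z. F x z \<noteq> 0}"
        using cont[OF x, of UNIV] continuous_on_const[of UNIV "0::complex"] by (intro open_Collect_neq)
      then show False using D(2)[of "{z. F x z \<noteq> 0}"] z * by blast
    qed
  qed auto
  then have "{x\<in>space N. \<forall>z. F x z = 0} = {x\<in>space N. \<forall>d\<in>D. F x d = 0}" by auto
  also have "\<dots> \<in> sets N" by (rule sets_Collect_Ball_countable[OF D(1)]) measurable
  finally show ?thesis .
qed

text \<open>A Dynkin argument from the open sets. Intersecting with a ball makes all counts finite,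
  so complements are handled by subtraction; letting the radius grow removes the ball.\<close>

theorem zero_count_nz_measurable:
  assumes \<Omega>: "\<Omega> \<in> sets borel"
  shows "(\<lambda>x. zero_count_nz (F x) \<Omega>) \<in> borel_measurable N"
proof -
  define G where "G = {x\<in>space N. \<not> (\<forall>z. F x z = 0)}"
  have nz: "zero_count_nz (F x) A = zero_count (F x) A * indicator G x" if "x \<in> space N" for x A
    using that by (auto simp: zero_count_nz_def G_def)
  have [measurable]: "G \<in> sets N"
    unfolding G_def using zero_set_measurable by (rule sets.sets_Collect_neg)
  have nz': "zero_count_nz (F x) A = zero_count (F x) A" if "\<not> (\<forall>z. F x z = 0)" for x A
    using that by (simp only: zero_count_nz_def if_False)
  have op: "(\<lambda>x. zero_count_nz (F x) A) \<in> borel_measurable N" if "open A" for A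
    using zero_count_open_measurable[OF that] by (subst measurable_cong[OF nz]) auto
  have loc: "(\<lambda>x. zero_count_nz (F x) (A \<inter> ball 0 r)) \<in> borel_measurable N" if "A \<in> sets borel" for A r
  proof -
    have "Int_stable {S::complex set. open S}" "{S::complex set. open S} \<subseteq> Pow UNIV" "A \<in> sigma_sets UNIV {S. open S}"
      using that by (auto simp: Int_stable_def borel_def)
    then show ?thesis
    proof (induction rule: sigma_sets_induct_disjoint)
      fix A assume "A \<in> {S::complex set. open S}"
      then show "(\<lambda>x. zero_count_nz (F x) (A \<inter> ball 0 r)) \<in> borel_measurable N" by (intro op) auto
    next
      have "zero_count_nz (F x) ({} \<inter> ball 0 r) = 0" for x
        by (cases "\<forall>z. F x z = 0") (simp_all add: zero_count_nz_def zero_count_def)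
      then show "(\<lambda>x. zero_count_nz (F x) ({} \<inter> ball 0 r)) \<in> borel_measurable N" by simp
    next
      fix A :: "complex set" assume A: "(\<lambda>x. zero_count_nz (F x) (A \<inter> ball 0 r)) \<in> borel_measurable N"
      have "zero_count_nz (F x) ((UNIV - A) \<inter> ball 0 r) = zero_count_nz (F x) (ball 0 r) - zero_count_nz (F x) (A \<inter> ball 0 r)" if x: "x \<in> space N" for x
      proof (cases "\<forall>z. F x z = 0")
        case False
        then obtain w where w: "F x w \<noteq> 0" by blast
        have e: "{z\<in>(UNIV - A) \<inter> ball 0 r. F x z = 0} = {z\<in>ball 0 r. F x z = 0} - {z\<in>A \<inter> ball 0 r. F x z = 0}" by auto
        have "finite {z\<in>A \<inter> ball 0 r. F x z = 0}" by (rule finite_zeros_bounded[OF hol[OF x] w])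
        then have "emeasure (count_space UNIV) {z\<in>(UNIV - A) \<inter> ball 0 r. F x z = 0} =
          emeasure (count_space UNIV) {z\<in>ball 0 r. F x z = 0} - emeasure (count_space UNIV) {z\<in>A \<inter> ball 0 r. F x z = 0}"
          unfolding e by (intro emeasure_Diff) (auto simp: emeasure_count_space_finite)
        then show ?thesis unfolding nz'[OF False] zero_count_def .
      qed (simp add: zero_count_nz_def)
      then show "(\<lambda>x. zero_count_nz (F x) ((UNIV - A) \<inter> ball 0 r)) \<in> borel_measurable N"
        using A op[of "ball 0 r"] by (subst measurable_cong[where g="\<lambda>x. zero_count_nz (F x) (ball 0 r) - zero_count_nz (F x) (A \<inter> ball 0 r)"]) auto
    next
      fix A :: "nat \<Rightarrow> complex set" assume d: "disjoint_family A"
        and A[measurable]: "\<And>i. (\<lambda>x. zero_count_nz (F x) (A i \<inter> ball 0 r)) \<in> borel_measurable N"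
      have "zero_count_nz (F x) ((\<Union>i. A i) \<inter> ball 0 r) = (\<Sum>i. zero_count_nz (F x) (A i \<inter> ball 0 r))" for x
      proof (cases "\<forall>z. F x z = 0")
        case False
        have "{z\<in>(\<Union>i. A i) \<inter> ball 0 r. F x z = 0} = (\<Union>i. {z\<in>A i \<inter> ball 0 r. F x z = 0})" by auto
        moreover have "disjoint_family (\<lambda>i. {z\<in>A i \<inter> ball 0 r. F x z = 0})" using d by (auto simp: disjoint_family_on_def)
        ultimately have "emeasure (count_space UNIV) {z\<in>(\<Union>i. A i) \<inter> ball 0 r. F x z = 0} = (\<Sum>i. emeasure (count_space UNIV) {z\<in>A i \<inter> ball 0 r. F x z = 0})"
          by (simp add: suminf_emeasure)
        then show ?thesis unfolding nz'[OF False] zero_count_def .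
      qed (simp add: zero_count_nz_def)
      then show "(\<lambda>x. zero_count_nz (F x) ((\<Union>i. A i) \<inter> ball 0 r)) \<in> borel_measurable N" by simp
    qed
  qed
  have "zero_count_nz (F x) \<Omega> = (SUP n. zero_count_nz (F x) (\<Omega> \<inter> ball 0 (real n)))" for x
  proof (cases "\<forall>z. F x z = 0")
    case False
    have "{z\<in>\<Omega>. F x z = 0} = (\<Union>n. {z\<in>\<Omega> \<inter> ball 0 (real n). F x z = 0})"
      using reals_Archimedean2 by auto
    moreover have "incseq (\<lambda>n. {z\<in>\<Omega> \<inter> ball 0 (real n). F x z = 0})"
      by (rule incseq_SucI) auto
    ultimately have "emeasure (count_space UNIV) {z\<in>\<Omega>. F x z = 0} = (SUP n. emeasure (count_space UNIV) {z\<in>\<Omega> \<inter> ball 0 (real n). F x z = 0})"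
      by (simp add: SUP_emeasure_incseq)
    then show ?thesis unfolding nz'[OF False] zero_count_def .
  qed (simp add: zero_count_nz_def)
  then show ?thesis using loc[OF \<Omega>] by simp
qed

end

section \<open>Tempered distributions and the Bargmann transform\<close>

text \<open>By Cauchy's estimate this class is closed under differentiation, so bounds on all Schwartz
  seminorms come for free.\<close>

definition strip_decay :: "(complex \<Rightarrow> complex) \<Rightarrow> bool" where
  "strip_decay F \<longleftrightarrow> F holomorphic_on UNIV \<and>
     (\<forall>j C. \<exists>B. \<forall>t::real. \<forall>w. cmod w \<le> C \<longrightarrow> \<bar>t\<bar> ^ j * cmod (F (of_real t + w)) \<le> B)"

lemma strip_decayD:
  assumes "strip_decay F"
  obtains B where "\<And>t w. cmod w \<le> C \<Longrightarrow> \<bar>t\<bar> ^ j * cmod (F (of_real t + w)) \<le> B" "B \<ge> 0"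
proof -
  obtain B where B: "\<And>t w. cmod w \<le> C \<Longrightarrow> \<bar>t\<bar> ^ j * cmod (F (of_real t + w)) \<le> B"
    using assms unfolding strip_decay_def by blast
  show ?thesis
    by (rule that[of "max B 0"]) (use B in \<open>auto intro: max.coboundedI1\<close>)
qed

lemma strip_decay_holomorphic: "strip_decay F \<Longrightarrow> F holomorphic_on A"
  unfolding strip_decay_def using holomorphic_on_subset by blast

lemma strip_decay_field_derivative:
  "strip_decay F \<Longrightarrow> (F has_field_derivative deriv F z) (at z)"
  using holomorphic_derivI[OF strip_decay_holomorphic[of F UNIV], of z] by simp

lemma strip_decay_shift:
  assumes "strip_decay F" shows "strip_decay (\<lambda>s. F (s + c))"
  unfolding strip_decay_def
proof (intro conjI allI)
  show "(\<lambda>s. F (s + c)) holomorphic_on UNIV"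
    by (rule holomorphic_on_compose_gen[of "\<lambda>s. s + c" UNIV F UNIV, unfolded o_def])
       (use strip_decay_holomorphic[OF assms] in \<open>auto intro!: holomorphic_intros\<close>)
  fix j C
  obtain B where B: "\<And>t w. cmod w \<le> C + cmod c \<Longrightarrow> \<bar>t\<bar> ^ j * cmod (F (of_real t + w)) \<le> B"
    using strip_decayD[OF assms] by metis
  show "\<exists>B. \<forall>t w. cmod w \<le> C \<longrightarrow> \<bar>t\<bar> ^ j * cmod (F (of_real t + w + c)) \<le> B"
  proof (intro exI allI impI)
    fix t w assume "cmod w \<le> C"
    then have "cmod (w + c) \<le> C + cmod c" using norm_triangle_ineq[of w c] by linarith
    from B[OF this, of t] show "\<bar>t\<bar> ^ j * cmod (F (of_real t + w + c)) \<le> B" by (simp add: add.assoc)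
  qed
qed

lemma strip_decay_lincomb:
  assumes "strip_decay F" "strip_decay G" shows "strip_decay (\<lambda>s. a * F s + b * G s)"
  unfolding strip_decay_def
proof (intro conjI allI)
  show "(\<lambda>s. a * F s + b * G s) holomorphic_on UNIV"
    using strip_decay_holomorphic[OF assms(1)] strip_decay_holomorphic[OF assms(2)]
    by (intro holomorphic_intros)
  fix j C
  obtain B1 where B1: "\<And>t w. cmod w \<le> C \<Longrightarrow> \<bar>t\<bar> ^ j * cmod (F (of_real t + w)) \<le> B1"
    using strip_decayD[OF assms(1)] by metis
  obtain B2 where B2: "\<And>t w. cmod w \<le> C \<Longrightarrow> \<bar>t\<bar> ^ j * cmod (G (of_real t + w)) \<le> B2"
    using strip_decayD[OF assms(2)] by metis
  show "\<exists>B. \<forall>t w. cmod w \<le> C \<longrightarrow> \<bar>t\<bar> ^ j * cmod (a * F (of_real t + w) + b * G (of_real t + w)) \<le> B"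
  proof (intro exI allI impI)
    fix t w assume w: "cmod w \<le> C"
    have "\<bar>t\<bar> ^ j * cmod (a * F (of_real t + w) + b * G (of_real t + w)) \<le>
       \<bar>t\<bar> ^ j * (cmod a * cmod (F (of_real t + w)) + cmod b * cmod (G (of_real t + w)))"
      by (intro mult_left_mono order.trans[OF norm_triangle_ineq]) (auto simp: norm_mult)
    also have "\<dots> = cmod a * (\<bar>t\<bar> ^ j * cmod (F (of_real t + w))) + cmod b * (\<bar>t\<bar> ^ j * cmod (G (of_real t + w)))"
      by (simp add: algebra_simps)
    also have "\<dots> \<le> cmod a * B1 + cmod b * B2"
      by (intro add_mono mult_left_mono B1 B2 w) auto
    finally show "\<bar>t\<bar> ^ j * cmod (a * F (of_real t + w) + b * G (of_real t + w)) \<le> cmod a * B1 + cmod b * B2" .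
  qed
qed

lemma strip_decay_deriv:
  assumes "strip_decay F" shows "strip_decay (deriv F)"
  unfolding strip_decay_def
proof (intro conjI allI)
  show "deriv F holomorphic_on UNIV"
    using strip_decay_holomorphic[OF assms] by (intro holomorphic_deriv) auto
  fix j C
  \<comment> \<open>The strip is widened by 1 to contain the unit circle of Cauchy's
    estimate.\<close>
  obtain B where B: "\<And>t w. cmod w \<le> C + 1 \<Longrightarrow> \<bar>t\<bar> ^ j * cmod (F (of_real t + w)) \<le> B" "B \<ge> 0"
    using strip_decayD[OF assms, of "C + 1" j] by metis
  show "\<exists>B. \<forall>t w. cmod w \<le> C \<longrightarrow> \<bar>t\<bar> ^ j * cmod (deriv F (of_real t + w)) \<le> B"
  proof (intro exI allI impI)
    fix t :: real and w assume w: "cmod w \<le> C"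
    show "\<bar>t\<bar> ^ j * cmod (deriv F (of_real t + w)) \<le> B"
    proof (cases "\<bar>t\<bar> ^ j = 0")
      case False
      then have p: "\<bar>t\<bar> ^ j > 0" by (metis abs_ge_zero less_eq_real_def zero_le_power)
      have "cmod ((deriv ^^ 1) F (of_real t + w)) \<le> fact 1 * (B / \<bar>t\<bar> ^ j) / 1 ^ 1"
      proof (rule Cauchy_inequality)
        show "continuous_on (cball (of_real t + w) 1) F"
          by (rule holomorphic_on_imp_continuous_on[OF strip_decay_holomorphic[OF assms]])
        fix x assume x: "cmod (of_real t + w - x) = 1"
        have "cmod (x - of_real t) \<le> C + 1"
          using norm_triangle_ineq[of w "x - of_real t - w"] x w
          by (simp add: algebra_simps norm_minus_commute)
        from B(1)[OF this, of t] show "cmod (F x) \<le> B / \<bar>t\<bar> ^ j"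
          using p by (simp add: field_simps)
      qed (use strip_decay_holomorphic[OF assms] in auto)
      then show ?thesis using p by (simp add: field_simps)
    next
      case True then show ?thesis unfolding True using B(2) by simp
    qed
  qed
qed

lemma strip_decay_higher_deriv: "strip_decay F \<Longrightarrow> strip_decay ((deriv ^^ k) F)"
  by (induction k) (auto intro: strip_decay_deriv)

text \<open>On the real axis this reflected function is the conjugate of \<open>F\<close>, now
  written as the restriction of an entire function. It is needed because \<open>pairing\<close>
  conjugates its test function.\<close>

lemma strip_decay_cnj:
  assumes "strip_decay F" shows "strip_decay (\<lambda>s. cnj (F (cnj s)))"
  unfolding strip_decay_def
proof (intro conjI allI)
  show "(\<lambda>s. cnj (F (cnj s))) holomorphic_on UNIV"
    using holomorphic_on_compose_cnj_cnj[of F UNIV] strip_decay_holomorphic[OF assms] by (auto simp: o_def)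
  fix j C
  obtain B where B: "\<And>t w. cmod w \<le> C \<Longrightarrow> \<bar>t\<bar> ^ j * cmod (F (of_real t + w)) \<le> B"
    using strip_decayD[OF assms] by metis
  show "\<exists>B. \<forall>t w. cmod w \<le> C \<longrightarrow> \<bar>t\<bar> ^ j * cmod (cnj (F (cnj (of_real t + w)))) \<le> B"
    using B[of "cnj w" for w] by (intro exI[of _ B]) auto
qed

lemma nth_vderiv_strip_decay:
  assumes "strip_decay F"
  shows "nth_vderiv k (\<lambda>t. F (of_real t)) = (\<lambda>t. (deriv ^^ k) F (of_real t))"
proof (induction k)
  case 0 show ?case by (simp add: nth_vderiv_def)
next
  case (Suc k)
  have "nth_vderiv (Suc k) (\<lambda>t. F (of_real t)) = (\<lambda>t. vector_derivative (nth_vderiv k (\<lambda>t. F (of_real t))) (at t))"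
    by (simp add: nth_vderiv_def)
  also have "\<dots> = (\<lambda>t. vector_derivative (\<lambda>t. (deriv ^^ k) F (of_real t)) (at t))"
    by (simp add: Suc)
  also have "\<dots> = (\<lambda>t. (deriv ^^ Suc k) F (of_real t))"
    using strip_decay_field_derivative[OF strip_decay_higher_deriv[OF assms, of k]]
    by (intro ext vector_derivative_at has_vector_derivative_real_field) auto
  finally show ?case .
qed

lemma strip_decay_schwartz:
  assumes "strip_decay F" shows "(\<lambda>t. F (of_real t)) \<in> schwartz"
  unfolding schwartz_def nth_vderiv_strip_decay[OF assms] mem_Collect_eq
proof (intro conjI allI)
  fix k and t :: real
  show "(\<lambda>t. (deriv ^^ k) F (of_real t)) differentiable (at t)"
    using has_vector_derivative_real_field[OF strip_decay_field_derivative[OF strip_decay_higher_deriv[OF assms, of k], of "of_real t"]]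
    by (auto simp: has_vector_derivative_def differentiable_def)
next
  fix j k
  obtain B where B: "\<And>t w. cmod w \<le> 0 \<Longrightarrow> \<bar>t\<bar> ^ j * cmod ((deriv ^^ k) F (of_real t + w)) \<le> B"
    using strip_decayD[OF strip_decay_higher_deriv[OF assms, of k]] by metis
  show "bounded (range (\<lambda>t. of_real (t ^ j) * (deriv ^^ k) F (of_real t)))"
    using B[of 0] by (intro boundedI[of _ B]) (auto simp: norm_mult norm_power)
qed

lemma deriv_lincomb_shift:
  assumes "strip_decay F" "strip_decay G"
  shows "(deriv ^^ k) (\<lambda>s. a * F (s + c) + b * G (s + d)) =
         (\<lambda>s. a * (deriv ^^ k) F (s + c) + b * (deriv ^^ k) G (s + d))"
proof (induction k)
  case (Suc k)
  have "((\<lambda>s. a * (deriv ^^ k) F (s + c) + b * (deriv ^^ k) G (s + d)) has_field_derivative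
      (a * (deriv ^^ Suc k) F (s + c) + b * (deriv ^^ Suc k) G (s + d))) (at s)" for s
    using strip_decay_field_derivative[OF strip_decay_higher_deriv[OF assms(1), of k], of "s + c"]
      strip_decay_field_derivative[OF strip_decay_higher_deriv[OF assms(2), of k], of "s + d"]
    by (auto intro!: derivative_eq_intros simp: DERIV_shift[symmetric])
  then show ?case by (auto simp: Suc fun_eq_iff intro!: DERIV_imp_deriv)
qed simp

text \<open>The z-derivative of \<open>F (t - z)\<close> is \<open>- deriv F (t - z)\<close>, hence
  the plus sign. The second-order Taylor remainder divided by \<open>h n\<close> is of order
  \<open>cmod (h n)\<close>, uniformly against every power of \<open>t\<close>, because the
  derivative of order \<open>k + 2\<close> decays on a wider strip.\<close>

lemma schwartz_null_seq_difference_quotient: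
  assumes F: "strip_decay F" and h: "h \<longlonglongrightarrow> 0" "\<And>n. h n \<noteq> 0"
  shows "schwartz_null_seq (\<lambda>n t. (F (of_real t - z - h n) - F (of_real t - z)) / h n + deriv F (of_real t - z))"
proof -
  \<comment> \<open>Nested two-term combinations of shifts, so that the closure lemma for
    \<open>strip_decay\<close> and \<open>deriv_lincomb_shift\<close> apply literally; the shift by
    0 serves only this shape.\<close>
  define R where "R n = (\<lambda>s. (1 / h n) * F (s + (- z - h n)) + 1 * (\<lambda>s. (- 1 / h n) * F (s + (-z)) + 1 * deriv F (s + (-z))) (s + 0))" for n
  have sd: "strip_decay (\<lambda>s. (- 1 / h n) * F (s + (-z)) + 1 * deriv F (s + (-z)))" for n
    by (intro strip_decay_lincomb strip_decay_shift F strip_decay_deriv)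
  have R: "strip_decay (R n)" for n
    unfolding R_def by (intro strip_decay_lincomb strip_decay_shift F sd)
  have Req: "(F (of_real t - z - h n) - F (of_real t - z)) / h n + deriv F (of_real t - z) = R n (of_real t)" for n and t :: real
  proof -
    have e: "of_real t + (- z - h n) = of_real t - z - h n" "of_real t + 0 + - z = of_real t - z" by auto
    have "(a - b) / d + c = 1 / d * a + 1 * (- 1 / d * b + 1 * c)" for a b c d :: complex
      by (simp add: diff_divide_distrib)
    then show ?thesis unfolding R_def e .
  qed
  have dR: "(deriv ^^ k) (R n) s = (1 / h n) * ((deriv ^^ k) F (s - z - h n) - (deriv ^^ k) F (s - z) + h n * (deriv ^^ Suc k) F (s - z))" for n k s
  proof -
    have e: "s + (- z - h n) = s - z - h n" "s + 0 + - z = s - z" "(deriv ^^ Suc k) F = (deriv ^^ k) (deriv F)"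
      by (auto simp: funpow_swap1)
    have "1 / d * a + 1 * (- 1 / d * b + 1 * c) = 1 / d * (a - b + d * c)" if "d \<noteq> 0" for a b c d :: complex
      using that by (simp add: field_simps)
    from this[OF h(2)[of n]] show ?thesis
      unfolding R_def deriv_lincomb_shift[OF F sd] deriv_lincomb_shift[OF F strip_decay_deriv[OF F]] e .
  qed
  have est: "\<exists>B\<ge>0. \<forall>n. cmod (h n) \<le> 1 \<longrightarrow> schwartz_seminorm j k (\<lambda>t. R n (of_real t)) \<le> B * cmod (h n)" for j k
  proof -
    \<comment> \<open>The segment from \<open>t - z\<close> to \<open>t - z - h n\<close> stays
      within distance \<open>cmod z + 1\<close> of \<open>t\<close> once \<open>cmod (h n)\<close>
      is at most 1.\<close>
    obtain B where B: "\<And>t w. cmod w \<le> cmod z + 1 \<Longrightarrow> \<bar>t\<bar> ^ j * cmod ((deriv ^^ (Suc (Suc k))) F (of_real t + w)) \<le> B" "B \<ge> 0"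
      using strip_decayD[OF strip_decay_higher_deriv[OF F, of "Suc (Suc k)"], of "cmod z + 1" j] by metis
    show ?thesis
    proof (intro exI[of _ B] conjI allI impI)
      fix n assume hn: "cmod (h n) \<le> 1"
      have "cmod (of_real (t ^ j) * (deriv ^^ k) (R n) (of_real t)) \<le> B * cmod (h n)" for t :: real
      proof (cases "\<bar>t\<bar> ^ j = 0")
        case False
        then have p: "\<bar>t\<bar> ^ j > 0" by (metis abs_ge_zero less_eq_real_def zero_le_power)
        have sub: "x \<in> cball (of_real t - z) 1 \<Longrightarrow> cmod (x - of_real t) \<le> cmod z + 1" for x
          using norm_triangle_ineq[of "x - (of_real t - z)" "- z"]
          by (simp add: dist_norm norm_minus_commute algebra_simps)
        have "cmod ((deriv ^^ (k + 0)) F (of_real t - z - h n) - (\<Sum>i\<le>1. (deriv ^^ (k + i)) F (of_real t - z) * (of_real t - z - h n - (of_real t - z)) ^ i / fact i))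
           \<le> (B / \<bar>t\<bar> ^ j) * cmod (of_real t - z - h n - (of_real t - z)) ^ Suc 1 / fact 1"
        proof (rule field_Taylor[of "cball (of_real t - z) 1" 1 "\<lambda>i. (deriv ^^ (k + i)) F"])
          fix i x
          show "((deriv ^^ (k + i)) F has_field_derivative (deriv ^^ (k + Suc i)) F x) (at x within cball (of_real t - z) 1)"
            using strip_decay_field_derivative[OF strip_decay_higher_deriv[OF F, of "k + i"], of x]
            by (auto intro: has_field_derivative_at_within)
        next
          fix x assume "x \<in> cball (of_real t - z) 1"
          from B(1)[OF sub[OF this], of t] show "cmod ((deriv ^^ (k + Suc 1)) F x) \<le> B / \<bar>t\<bar> ^ j"
            using p by (simp add: field_simps)
        qed (use hn in \<open>auto simp: dist_norm\<close>)
        then have "cmod ((deriv ^^ k) F (of_real t - z - h n) - (deriv ^^ k) F (of_real t - z) + h n * (deriv ^^ Suc k) F (of_real t - z)) \<le> B / \<bar>t\<bar> ^ j * (cmod (h n))\<^sup>2"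
          by (simp add: algebra_simps power2_eq_square)
        then have "\<bar>t\<bar> ^ j * (cmod ((deriv ^^ k) F (of_real t - z - h n) - (deriv ^^ k) F (of_real t - z) + h n * (deriv ^^ Suc k) F (of_real t - z)) / cmod (h n)) \<le> B * cmod (h n)"
          using p h(2)[of n] by (simp add: field_simps power2_eq_square)
        then show ?thesis unfolding dR by (simp add: norm_mult norm_divide norm_power)
      next
        case True
        then have "t ^ j = 0" by (metis power_abs abs_eq_0)
        then show ?thesis unfolding \<open>t ^ j = 0\<close> using B(2) by simp
      qed
      then show "schwartz_seminorm j k (\<lambda>t. R n (of_real t)) \<le> B * cmod (h n)"
        unfolding schwartz_seminorm_def nth_vderiv_strip_decay[OF R] by (intro cSUP_least) auto
    qed (rule B(2))
  qed
  have ge: "schwartz_seminorm j k (\<lambda>t. R n (of_real t)) \<ge> 0" for j k n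
  proof -
    have "bdd_above (range (\<lambda>t. cmod (of_real (t ^ j) * nth_vderiv k (\<lambda>t. R n (of_real t)) t)))"
    proof -
      have "bounded (range (\<lambda>t. of_real (t ^ j) * nth_vderiv k (\<lambda>t. R n (of_real t)) t))"
        using strip_decay_schwartz[OF R[of n]] unfolding schwartz_def by blast
      then obtain B where "\<forall>x\<in>range (\<lambda>t. of_real (t ^ j) * nth_vderiv k (\<lambda>t. R n (of_real t)) t). cmod x \<le> B"
        unfolding bounded_iff by blast
      then show ?thesis by (intro bdd_aboveI2[of _ _ B]) simp
    qed
    from cSUP_upper[OF UNIV_I this, of 0] show ?thesis
      unfolding schwartz_seminorm_def by (intro order.trans[OF norm_ge_zero])
  qed
  show ?thesis
    unfolding schwartz_null_seq_def Req
  proof (intro conjI allI strip_decay_schwartz R)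
    fix j k
    obtain B where B: "\<And>n. cmod (h n) \<le> 1 \<Longrightarrow> schwartz_seminorm j k (\<lambda>t. R n (of_real t)) \<le> B * cmod (h n)"
      using est by blast
    have "eventually (\<lambda>n. cmod (h n) < 1) sequentially"
      using tendstoD[OF h(1), of 1] by simp
    then have "eventually (\<lambda>n. schwartz_seminorm j k (\<lambda>t. R n (of_real t)) \<le> B * cmod (h n)) sequentially"
      by eventually_elim (intro B, simp)
    moreover have "(\<lambda>n. B * cmod (h n)) \<longlonglongrightarrow> 0"
      using tendsto_mult_right_zero[OF tendsto_norm_zero[OF h(1)]] by blast
    ultimately show "(\<lambda>n. schwartz_seminorm j k (\<lambda>t. R n (of_real t))) \<longlonglongrightarrow> 0"
      by (rule tendsto_sandwich[OF _ _ tendsto_const, rotated]) (auto simp: ge)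
  qed
qed

lemma tempered_lincomb:
  assumes "tempered_distribution u" "strip_decay F" "strip_decay G"
  shows "u (\<lambda>t. a * F (of_real t) + b * G (of_real t)) = a * u (\<lambda>t. F (of_real t)) + b * u (\<lambda>t. G (of_real t))"
proof -
  have "\<forall>\<phi>\<in>schwartz. \<forall>\<psi>\<in>schwartz. \<forall>a b. u (\<lambda>t. a * \<phi> t + b * \<psi> t) = a * u \<phi> + b * u \<psi>"
    using assms(1) unfolding tempered_distribution_def by (rule conjunct1)
  from this[rule_format, OF strip_decay_schwartz[OF assms(2)] strip_decay_schwartz[OF assms(3)]]
  show ?thesis .
qed

text \<open>Continuity of \<open>u\<close> in the Schwartz topology carries the convergence of
  difference quotients through \<open>u\<close>; sequences suffice, as continuity is sequential
  here. It is applied to three kinds of distribution: realizations of the noise, Fourier evaluation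
  at a frequency, and covariance with a fixed value of the noise.\<close>

lemma tempered_field_derivative:
  assumes u: "tempered_distribution u" and F: "strip_decay F"
  shows "((\<lambda>z. u (\<lambda>t. F (of_real t - z))) has_field_derivative u (\<lambda>t. - deriv F (of_real t - z))) (at z)"
  unfolding has_field_derivative_iff tendsto_at_iff_sequentially
proof (intro allI impI)
  fix X assume X: "\<forall>i. X i \<in> UNIV - {z}" "X \<longlonglongrightarrow> z"
  define h where "h n = X n - z" for n
  have h: "h \<longlonglongrightarrow> 0" "\<And>n. h n \<noteq> 0"
    using X unfolding h_def by (auto intro: LIM_zero)
  have s: "strip_decay (\<lambda>s. F (s - c))" "strip_decay (\<lambda>s. deriv F (s - c))" for c
    using strip_decay_shift[OF F, of "-c"] strip_decay_shift[OF strip_decay_deriv[OF F], of "-c"] by auto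
  have "u (\<lambda>t. (F (of_real t - z - h n) - F (of_real t - z)) / h n + deriv F (of_real t - z)) =
     (u (\<lambda>t. F (of_real t - X n)) - u (\<lambda>t. F (of_real t - z))) / (X n - z) - u (\<lambda>t. - deriv F (of_real t - z))" for n
  proof -
    have e: "complex_of_real t - z - h n = of_real t - X n" for t by (simp add: h_def)
    have aux: "(a - b) / d + c = 1 * (1 / d * a + - 1 / d * b) + 1 * c" for a b c d :: complex
      by (simp add: diff_divide_distrib)
    have sl: "strip_decay (\<lambda>s. (1 / h n) * F (s - X n) + (- 1 / h n) * F (s - z))"
      by (rule strip_decay_lincomb[OF s(1) s(1)])
    note L1 = tempered_lincomb[OF u sl s(2)[of z], of 1 1]
    note L2 = tempered_lincomb[OF u s(1)[of "X n"] s(1)[of z], of "1 / h n" "- 1 / h n"]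
    have 0: "(\<lambda>t. (F (of_real t - z - h n) - F (of_real t - z)) / h n + deriv F (of_real t - z))
      = (\<lambda>t. 1 * ((1 / h n) * F (of_real t - X n) + (- 1 / h n) * F (of_real t - z)) + 1 * deriv F (of_real t - z))"
      unfolding e by (rule ext, rule aux)
    have 1: "u (\<lambda>t. (F (of_real t - z - h n) - F (of_real t - z)) / h n + deriv F (of_real t - z)) =
      1 * ((1 / h n) * u (\<lambda>t. F (of_real t - X n)) + (- 1 / h n) * u (\<lambda>t. F (of_real t - z))) + 1 * u (\<lambda>t. deriv F (of_real t - z))"
      unfolding 0 L1 L2 ..
    have 2: "u (\<lambda>t. - deriv F (of_real t - z)) = - u (\<lambda>t. deriv F (of_real t - z))"
      using tempered_lincomb[OF u s(2) s(2), of "-1" z 0 z] by simp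
    have "h n = X n - z" by (simp add: h_def)
    then show ?thesis unfolding 1 2 by (simp add: diff_divide_distrib)
  qed
  moreover have "(\<lambda>n. u (\<lambda>t. (F (of_real t - z - h n) - F (of_real t - z)) / h n + deriv F (of_real t - z))) \<longlonglongrightarrow> 0"
    using u schwartz_null_seq_difference_quotient[OF F h] unfolding tempered_distribution_def by blast
  ultimately have "(\<lambda>n. (u (\<lambda>t. F (of_real t - X n)) - u (\<lambda>t. F (of_real t - z))) / (X n - z) - u (\<lambda>t. - deriv F (of_real t - z))) \<longlonglongrightarrow> 0"
    by simp
  from LIM_zero_cancel[OF this]
  show "((\<lambda>w. (u (\<lambda>t. F (of_real t - w)) - u (\<lambda>t. F (of_real t - z))) / (w - z)) \<circ> X) \<longlonglongrightarrow> u (\<lambda>t. - deriv F (of_real t - z))"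
    by (simp add: o_def)
qed

definition gam :: "complex \<Rightarrow> complex" where
  "gam s = exp (- of_real pi * s\<^sup>2)"

lemma power_times_exp_neg_square_bounded:
  "\<exists>B. \<forall>t::real. \<bar>t\<bar> ^ j * exp (- (t\<^sup>2)) \<le> B"
proof -
  have "((\<lambda>t::real. t ^ j / exp t) \<longlongrightarrow> 0) at_top" by (rule tendsto_power_div_exp_0)
  then have "eventually (\<lambda>t::real. t ^ j / exp t < 1) at_top"
    by (rule order_tendstoD) simp
  then obtain N where N: "\<And>t::real. t \<ge> N \<Longrightarrow> t ^ j / exp t < 1" unfolding eventually_at_top_linorder by blast
  define L where "L = max N 1"
  have "\<bar>t\<bar> ^ j * exp (- (t\<^sup>2)) \<le> max 1 (L ^ j)" for t :: real
  proof (cases "\<bar>t\<bar> \<ge> L")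
    case True
    then have t1: "\<bar>t\<bar> \<ge> 1" "\<bar>t\<bar> \<ge> N" by (auto simp: L_def)
    have "\<bar>t\<bar> * 1 \<le> \<bar>t\<bar> * \<bar>t\<bar>" using t1 by (intro mult_left_mono) auto
    then have "\<bar>t\<bar> \<le> t\<^sup>2" by (simp add: power2_eq_square)
    then have "exp (- (t\<^sup>2)) \<le> exp (- \<bar>t\<bar>)" by simp
    then have "\<bar>t\<bar> ^ j * exp (- (t\<^sup>2)) \<le> \<bar>t\<bar> ^ j * exp (- \<bar>t\<bar>)" by (intro mult_left_mono) auto
    also have "\<dots> \<le> 1" using N[OF t1(2)] by (simp add: exp_minus field_simps)
    finally show ?thesis by simp
  next
    case False
    then have "\<bar>t\<bar> ^ j \<le> L ^ j" by (intro power_mono) auto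
    moreover have "\<bar>t\<bar> ^ j * exp (- (t\<^sup>2)) \<le> \<bar>t\<bar> ^ j * 1" by (intro mult_left_mono) auto
    ultimately show ?thesis by linarith
  qed
  then show ?thesis by blast
qed

lemma strip_decay_gam: "strip_decay gam"
  unfolding strip_decay_def
proof (intro conjI allI)
  show "gam holomorphic_on UNIV" unfolding gam_def[abs_def] by (intro holomorphic_intros)
  fix j and C :: real
  obtain B where B: "\<And>t::real. \<bar>t\<bar> ^ j * exp (- (t\<^sup>2)) \<le> B" using power_times_exp_neg_square_bounded by blast
  show "\<exists>B. \<forall>t w. cmod w \<le> C \<longrightarrow> \<bar>t\<bar> ^ j * cmod (gam (of_real t + w)) \<le> B"
  proof (intro exI allI impI)
    fix t w assume w: "cmod w \<le> C"
    define x y where "x = Re w" and "y = Im w"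
    have C: "C \<ge> 0" using w norm_ge_zero[of w] by linarith
    have w2: "x\<^sup>2 + y\<^sup>2 \<le> C\<^sup>2"
      using power_mono[OF w, of 2] by (simp add: cmod_power2 x_def y_def)
    have cm: "cmod (gam (of_real t + w)) = exp (- pi * ((t + x)\<^sup>2 - y\<^sup>2))"
      by (simp add: gam_def x_def y_def power2_eq_square algebra_simps)
    have aux: "T - 2 * D \<le> 2 * (A - Y)" if "T \<le> 2 * A + 2 * X" "X + Y \<le> D" for T A X Y D :: real
      using that by argo
    \<comment> \<open>The difference of the two sides is \<open>(t + 2 * x)\<^sup>2\<close>. After
      multiplication by \<open>pi / 2\<close>, which is at least 1, a factor
      \<open>exp (- (t\<^sup>2))\<close> remains to absorb powers of \<open>t\<close>.\<close>
    have "t\<^sup>2 \<le> 2 * (t + x)\<^sup>2 + 2 * x\<^sup>2"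
      using zero_le_power2[of "t + 2 * x"] by (simp add: power2_eq_square algebra_simps)
    then have "t\<^sup>2 - 2 * C\<^sup>2 \<le> 2 * ((t + x)\<^sup>2 - y\<^sup>2)"
      by (rule aux[OF _ w2])
    then have "(pi / 2) * (t\<^sup>2 - 2 * C\<^sup>2) \<le> (pi / 2) * (2 * ((t + x)\<^sup>2 - y\<^sup>2))" by (intro mult_left_mono) auto
    moreover have "t\<^sup>2 \<le> (pi / 2) * t\<^sup>2"
      using pi_ge_two mult_right_mono[of 1 "pi / 2" "t\<^sup>2"] by simp
    ultimately have "- pi * ((t + x)\<^sup>2 - y\<^sup>2) \<le> - (t\<^sup>2) + pi * C\<^sup>2" by (simp add: algebra_simps)
    then have "exp (- pi * ((t + x)\<^sup>2 - y\<^sup>2)) \<le> exp (- (t\<^sup>2)) * exp (pi * C\<^sup>2)"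
      by (simp add: exp_add[symmetric])
    then have "\<bar>t\<bar> ^ j * cmod (gam (of_real t + w)) \<le> \<bar>t\<bar> ^ j * (exp (- (t\<^sup>2)) * exp (pi * C\<^sup>2))"
      unfolding cm by (intro mult_left_mono) auto
    also have "\<dots> = (\<bar>t\<bar> ^ j * exp (- (t\<^sup>2))) * exp (pi * C\<^sup>2)" by simp
    also have "\<dots> \<le> B * exp (pi * C\<^sup>2)" by (intro mult_right_mono B) auto
    finally show "\<bar>t\<bar> ^ j * cmod (gam (of_real t + w)) \<le> B * exp (pi * C\<^sup>2)" .
  qed
qed

text \<open>The usual Bargmann transform of \<open>u\<close> multiplied by a nonvanishing entire function; with this
  normalization the covariance kernel of stationary noise depends only on \<open>z - cnj w\<close>.\<close>

definition bargmann :: "((real \<Rightarrow> complex) \<Rightarrow> complex) \<Rightarrow> complex \<Rightarrow> complex" where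
  "bargmann u z = u (\<lambda>t. gam (of_real t - z))"

lemma bargmann_field_derivative:
  "tempered_distribution u \<Longrightarrow> (bargmann u has_field_derivative u (\<lambda>t. - deriv gam (of_real t - z))) (at z)"
  unfolding bargmann_def[abs_def] by (rule tempered_field_derivative[OF _ strip_decay_gam])

lemma bargmann_holomorphic: "tempered_distribution u \<Longrightarrow> bargmann u holomorphic_on A"
  using bargmann_field_derivative[of u] has_field_derivative_at_within
  unfolding holomorphic_on_def field_differentiable_def by blast

definition tf_point :: "real \<Rightarrow> real \<Rightarrow> complex" where
  "tf_point \<tau> \<omega> = Complex \<tau> (- \<omega>)"

text \<open>Completing the square in \<open>t\<close>: the linear phase of the modulation moves the
  centre of the Gaussian from \<tau> to the complex point \<tau> - \<i> \<omega>, and what remains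
  is independent of \<open>t\<close>.\<close>

lemma stft_bargmann:
  assumes "tempered_distribution u"
  shows "stft u \<tau> \<omega> = of_real (2 powr (1/4)) * exp (- of_real (pi * \<omega>\<^sup>2) - \<i> * of_real (2 * pi * \<omega> * \<tau>)) * bargmann u (tf_point \<tau> \<omega>)"
proof -
  define z where "z = tf_point \<tau> \<omega>"
  define c where "c = of_real (2 powr (1/4)) * exp (- of_real (pi * \<omega>\<^sup>2) - \<i> * of_real (2 * pi * \<omega> * \<tau>))"
  have z: "z = of_real \<tau> - \<i> * of_real \<omega>" by (simp add: z_def tf_point_def complex_eq_iff)
  have "cnj (modulation \<omega> (translation \<tau> gauss_window) t) = c * gam (of_real t - z)" for t
  proof -
    have e: "cnj (exp (2 * of_real pi * \<i> * of_real \<omega> * of_real t)) = exp (- (2 * of_real pi * \<i> * of_real \<omega> * of_real t))"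
      by (simp add: exp_cnj)
    have "- (2 * of_real pi * \<i> * of_real \<omega> * of_real t) + of_real (- pi * (t - \<tau>)\<^sup>2) =
       (- of_real (pi * \<omega>\<^sup>2) - \<i> * of_real (2 * pi * \<omega> * \<tau>)) + (- of_real pi * (of_real t - z)\<^sup>2)"
      by (simp add: complex_eq_iff z power2_eq_square algebra_simps)
    then have "exp (- (2 * of_real pi * \<i> * of_real \<omega> * of_real t)) * exp (of_real (- pi * (t - \<tau>)\<^sup>2)) =
       exp (- of_real (pi * \<omega>\<^sup>2) - \<i> * of_real (2 * pi * \<omega> * \<tau>)) * exp (- of_real pi * (of_real t - z)\<^sup>2)"
      by (simp only: exp_add[symmetric])
    then show ?thesis
      unfolding modulation_def translation_def gauss_window_def c_def gam_def complex_cnj_mult e complex_cnj_complex_of_real of_real_mult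
      by (simp add: exp_of_real[symmetric] mult_ac)
  qed
  \<comment> \<open>Linearity is available for two-term combinations, so a scalar multiple is
    written with a second term that has coefficient 0. The same device recurs below.\<close>
  then have "stft u \<tau> \<omega> = u (\<lambda>t. c * gam (of_real t - z) + 0 * gam (of_real t - z))"
    by (simp add: stft_def pairing_def)
  also have "\<dots> = c * u (\<lambda>t. gam (of_real t - z)) + 0 * u (\<lambda>t. gam (of_real t - z))"
    using strip_decay_shift[OF strip_decay_gam, of "-z"]
    by (intro tempered_lincomb[OF assms, where F="\<lambda>s. gam (s - z)" and G="\<lambda>s. gam (s - z)"]) auto
  finally show ?thesis by (simp add: c_def z_def bargmann_def)
qed

lemma spectrogram_bargmann:
  assumes "tempered_distribution u"
  shows "spectrogram u \<tau> \<omega> = sqrt 2 * exp (- 2 * pi * \<omega>\<^sup>2) * (cmod (bargmann u (tf_point \<tau> \<omega>)))\<^sup>2"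
proof -
  have "cmod (exp (- of_real (pi * \<omega>\<^sup>2) - \<i> * of_real (2 * pi * \<omega> * \<tau>))) = exp (- pi * \<omega>\<^sup>2)"
    by simp
  moreover have "(2 powr (1/4) :: real)\<^sup>2 = sqrt 2"
    by (simp add: powr_half_sqrt[symmetric] powr_powr flip: powr_numeral)
  moreover have "(exp (- pi * \<omega>\<^sup>2))\<^sup>2 = exp (- 2 * pi * \<omega>\<^sup>2)"
    by (simp add: exp_double[symmetric])
  ultimately show ?thesis
    unfolding spectrogram_def stft_bargmann[OF assms] norm_mult power_mult_distrib norm_of_real by simp
qed

section \<open>Fourier transforms of Gaussians\<close>

lemma integrable_inverse_one_plus_square: "integrable lborel (\<lambda>t::real. inverse (1 + t\<^sup>2))"
  using integrable_inverse_1_plus_square by (simp add: set_integrable_def)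

lemma schwartz_bound:
  assumes "\<phi> \<in> schwartz"
  shows "cmod (\<phi> t) \<le> (schwartz_seminorm 0 0 \<phi> + schwartz_seminorm 2 0 \<phi>) * inverse (1 + t\<^sup>2)"
proof -
  have bd: "bdd_above (range (\<lambda>t. cmod (of_real (t ^ j) * nth_vderiv 0 \<phi> t)))" for j
  proof -
    have "bounded (range (\<lambda>t. of_real (t ^ j) * nth_vderiv 0 \<phi> t))"
      using assms unfolding schwartz_def by blast
    then obtain B where "\<forall>x\<in>range (\<lambda>t. of_real (t ^ j) * nth_vderiv 0 \<phi> t). cmod x \<le> B"
      unfolding bounded_iff by blast
    then show ?thesis by (intro bdd_aboveI2[of _ _ B]) simp
  qed
  have "cmod (of_real (t ^ j) * \<phi> t) \<le> schwartz_seminorm j 0 \<phi>" for j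
    using cSUP_upper[OF UNIV_I bd[of j], of t] by (simp add: schwartz_seminorm_def nth_vderiv_def)
  from this[of 0] this[of 2] have "cmod (\<phi> t) \<le> schwartz_seminorm 0 0 \<phi>" "t\<^sup>2 * cmod (\<phi> t) \<le> schwartz_seminorm 2 0 \<phi>"
    by (auto simp: norm_mult norm_power)
  then have "(1 + t\<^sup>2) * cmod (\<phi> t) \<le> schwartz_seminorm 0 0 \<phi> + schwartz_seminorm 2 0 \<phi>"
    by (simp add: algebra_simps)
  moreover have "1 + t\<^sup>2 > 0" by (simp add: add_pos_nonneg)
  ultimately show ?thesis by (simp add: field_simps)
qed

lemma schwartz_measurable: "\<phi> \<in> schwartz \<Longrightarrow> \<phi> \<in> borel_measurable borel"
proof -
  assume "\<phi> \<in> schwartz"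
  then have "\<forall>t. nth_vderiv 0 \<phi> differentiable (at t)" unfolding schwartz_def by blast
  then have "continuous_on UNIV \<phi>"
    by (simp add: nth_vderiv_def continuous_at_imp_continuous_on differentiable_imp_continuous_within)
  then show ?thesis by (rule borel_measurable_continuous_onI)
qed

text \<open>The positive sign in the exponent reflects the conjugating pairing: the Fourier
  transform of a conjugated test function is the conjugate of this functional.\<close>

definition inv_fourier_at :: "real \<Rightarrow> (real \<Rightarrow> complex) \<Rightarrow> complex" where
  "inv_fourier_at \<nu> \<phi> = (\<integral>t. \<phi> t * exp (2 * of_real pi * \<i> * of_real t * of_real \<nu>) \<partial>lborel)"

lemma cmod_character: "cmod (exp (2 * of_real pi * \<i> * of_real t * of_real \<nu>)) = 1"
  by simp

lemma schwartz_character_integrable: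
  assumes "\<phi> \<in> schwartz"
  shows "integrable lborel (\<lambda>t. \<phi> t * exp (2 * of_real pi * \<i> * of_real t * of_real \<nu>))"
proof (rule Bochner_Integration.integrable_bound)
  show "integrable lborel (\<lambda>t. (schwartz_seminorm 0 0 \<phi> + schwartz_seminorm 2 0 \<phi>) * inverse (1 + t\<^sup>2))"
    by (intro integrable_mult_right integrable_inverse_one_plus_square)
  show "(\<lambda>t. \<phi> t * exp (2 * of_real pi * \<i> * of_real t * of_real \<nu>)) \<in> borel_measurable lborel"
    using schwartz_measurable[OF assms] by measurable
  show "AE t in lborel. norm (\<phi> t * exp (2 * of_real pi * \<i> * of_real t * of_real \<nu>)) \<le> norm ((schwartz_seminorm 0 0 \<phi> + schwartz_seminorm 2 0 \<phi>) * inverse (1 + t\<^sup>2))"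
    using schwartz_bound[OF assms] by (auto simp: norm_mult cmod_character intro: order.trans[OF _ abs_ge_self])
qed

text \<open>As a tempered distribution, evaluation of the transform at a frequency can be
  differentiated along shifted Gaussians by the general lemma, so derivatives of Gaussian transforms
  come without differentiating an integral.\<close>

lemma tempered_inv_fourier: "tempered_distribution (inv_fourier_at \<nu>)"
  unfolding tempered_distribution_def
proof (intro conjI ballI allI impI)
  fix \<phi> \<psi> a b assume "\<phi> \<in> schwartz" "\<psi> \<in> schwartz"
  note i = schwartz_character_integrable[OF this(1), of \<nu>] schwartz_character_integrable[OF this(2), of \<nu>]
  have "inv_fourier_at \<nu> (\<lambda>t. a * \<phi> t + b * \<psi> t) =
    (\<integral>t. a * (\<phi> t * exp (2 * of_real pi * \<i> * of_real t * of_real \<nu>)) + b * (\<psi> t * exp (2 * of_real pi * \<i> * of_real t * of_real \<nu>)) \<partial>lborel)"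
    unfolding inv_fourier_at_def by (intro Bochner_Integration.integral_cong) (auto simp: algebra_simps)
  also have "\<dots> = a * inv_fourier_at \<nu> \<phi> + b * inv_fourier_at \<nu> \<psi>"
    unfolding inv_fourier_at_def using i by (subst Bochner_Integration.integral_add) auto
  finally show "inv_fourier_at \<nu> (\<lambda>t. a * \<phi> t + b * \<psi> t) = a * inv_fourier_at \<nu> \<phi> + b * inv_fourier_at \<nu> \<psi>" .
next
  fix \<Phi> assume \<Phi>: "schwartz_null_seq \<Phi>"
  then have s: "\<Phi> m \<in> schwartz" for m by (simp add: schwartz_null_seq_def)
  define C where "C = (\<integral>t. inverse (1 + (t::real)\<^sup>2) \<partial>lborel)"
  let ?N = "\<lambda>m. schwartz_seminorm 0 0 (\<Phi> m) + schwartz_seminorm 2 0 (\<Phi> m)"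
  have b: "cmod (inv_fourier_at \<nu> (\<Phi> m)) \<le> ?N m * C" for m
  proof -
    have "cmod (inv_fourier_at \<nu> (\<Phi> m)) \<le> (\<integral>t. cmod (\<Phi> m t * exp (2 * of_real pi * \<i> * of_real t * of_real \<nu>)) \<partial>lborel)"
      unfolding inv_fourier_at_def by (rule integral_norm_bound)
    also have "\<dots> \<le> (\<integral>t. ?N m * inverse (1 + t\<^sup>2) \<partial>lborel)"
    proof (rule integral_mono)
      show "integrable lborel (\<lambda>t. ?N m * inverse (1 + t\<^sup>2))" by (intro integrable_mult_right integrable_inverse_one_plus_square)
      show "cmod (\<Phi> m t * exp (2 * of_real pi * \<i> * of_real t * of_real \<nu>)) \<le> ?N m * inverse (1 + t\<^sup>2)" for t
        using schwartz_bound[OF s[of m]] by (simp only: norm_mult cmod_character) simp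
    qed (intro integrable_norm schwartz_character_integrable s)
    also have "\<dots> = ?N m * C" unfolding C_def by simp
    finally show ?thesis .
  qed
  have "(\<lambda>m. ?N m * C) \<longlonglongrightarrow> (0 + 0) * C"
    using \<Phi> unfolding schwartz_null_seq_def by (intro tendsto_mult tendsto_add tendsto_const) auto
  then have lim: "(\<lambda>m. ?N m * C) \<longlonglongrightarrow> 0" by simp
  show "(\<lambda>m. inv_fourier_at \<nu> (\<Phi> m)) \<longlonglongrightarrow> 0"
    by (rule Lim_null_comparison[OF always_eventually[OF allI[OF b]] lim])
qed

text \<open>With \<sigma> the square root of \<open>2 * pi\<close>, the substitution by
  \<open>\<sigma> * x\<close> turns the standard normal density into
  \<open>exp (- pi * x\<^sup>2)\<close>, so the integral is the standard normal characteristic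
  function at \<open>b / \<sigma>\<close>.\<close>

lemma gaussian_char_integral:
  "(\<integral>t. of_real (exp (- pi * t\<^sup>2)) * exp (\<i> * of_real (b * t)) \<partial>lborel) = of_real (exp (- b\<^sup>2 / (4 * pi)))"
proof -
  define \<sigma> where "\<sigma> = sqrt (2 * pi)"
  have \<sigma>: "\<sigma> > 0" "\<sigma>\<^sup>2 = 2 * pi" by (auto simp: \<sigma>_def)
  have "char std_normal_distribution (b / \<sigma>) = (\<integral>x. std_normal_density x *\<^sub>R iexp (b / \<sigma> * x) \<partial>lborel)"
    unfolding char_def by (rule integral_density) auto
  also have "\<dots> = \<bar>\<sigma>\<bar> *\<^sub>R (\<integral>x. std_normal_density (0 + \<sigma> * x) *\<^sub>R iexp (b / \<sigma> * (0 + \<sigma> * x)) \<partial>lborel)"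
    by (rule lborel_integral_real_affine) (use \<sigma> in auto)
  also have "\<dots> = (\<integral>x. of_real (exp (- pi * x\<^sup>2)) * exp (\<i> * of_real (b * x)) \<partial>lborel)"
  proof -
    have "\<sigma> * std_normal_density (0 + \<sigma> * x) = exp (- pi * x\<^sup>2)" for x
      unfolding std_normal_density_def using \<sigma> by (simp add: power_mult_distrib \<sigma>_def[symmetric])
    then show ?thesis using \<sigma>(1)
      by (subst integral_scaleR_right[symmetric]) (simp del: of_real_mult add: scaleR_conv_of_real mult.assoc[symmetric] of_real_mult[symmetric])
  qed
  finally show ?thesis unfolding char_std_normal_distribution using \<sigma> by (simp add: power_divide)
qed

text \<open>Translation removes \<open>Re z\<close>. The imaginary part \<open>y\<close> needs no
  contour shift: expanding the square in the exponent turns it into the factor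
  \<open>exp (pi * y\<^sup>2)\<close> and an additional real frequency, which is why
  \<open>b\<close> contains \<open>y + \<nu>\<close>.\<close>

lemma inv_fourier_gam:
  "inv_fourier_at \<nu> (\<lambda>t. gam (of_real t - z)) = exp (2 * of_real pi * \<i> * of_real \<nu> * z) * of_real (exp (- pi * \<nu>\<^sup>2))"
proof -
  define x y where "x = Re z" and "y = Im z"
  have z: "z = of_real x + \<i> * of_real y" by (simp add: x_def y_def complex_eq)
  define c where "c = of_real (exp (pi * y\<^sup>2)) * exp (\<i> * of_real (2 * pi * \<nu> * x))"
  define b where "b = 2 * pi * (y + \<nu>)"
  have "inv_fourier_at \<nu> (\<lambda>t. gam (of_real t - z)) = \<bar>1\<bar> *\<^sub>R (\<integral>t. gam (of_real (x + 1 * t) - z) * exp (2 * of_real pi * \<i> * of_real (x + 1 * t) * of_real \<nu>) \<partial>lborel)"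
    unfolding inv_fourier_at_def by (rule lborel_integral_real_affine) simp
  also have "\<dots> = (\<integral>t. c * (of_real (exp (- pi * t\<^sup>2)) * exp (\<i> * of_real (b * t))) \<partial>lborel)"
  proof -
    have "gam (of_real (x + 1 * t) - z) * exp (2 * of_real pi * \<i> * of_real (x + 1 * t) * of_real \<nu>) = c * (of_real (exp (- pi * t\<^sup>2)) * exp (\<i> * of_real (b * t)))" for t
      unfolding gam_def c_def exp_of_real[symmetric] exp_add[symmetric]
      by (rule arg_cong[where f=exp]) (simp add: z b_def power2_eq_square algebra_simps)
    then show ?thesis by simp
  qed
  also have "\<dots> = c * of_real (exp (- b\<^sup>2 / (4 * pi)))"
    by (subst integral_mult_right_zero) (simp only: gaussian_char_integral)
  also have "\<dots> = exp (2 * of_real pi * \<i> * of_real \<nu> * z) * of_real (exp (- pi * \<nu>\<^sup>2))"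
  proof -
    have e: "- b\<^sup>2 / (4 * pi) = - pi * (y + \<nu>)\<^sup>2" by (simp add: b_def power2_eq_square)
    show ?thesis unfolding e c_def exp_of_real[symmetric] exp_add[symmetric]
      by (intro arg_cong[where f=exp]) (simp add: z power2_eq_square algebra_simps)
  qed
  finally show ?thesis .
qed

text \<open>Both sides are the z-derivative of the transform of the shifted Gaussian, one computed
  inside the functional and the other from its closed form.\<close>

lemma inv_fourier_deriv_gam:
  "inv_fourier_at \<nu> (\<lambda>t. - deriv gam (of_real t - z)) =
    (2 * of_real pi * \<i> * of_real \<nu>) * exp (2 * of_real pi * \<i> * of_real \<nu> * z) * of_real (exp (- pi * \<nu>\<^sup>2))"
proof (rule DERIV_unique)
  show "((\<lambda>z. inv_fourier_at \<nu> (\<lambda>t. gam (of_real t - z))) has_field_derivative inv_fourier_at \<nu> (\<lambda>t. - deriv gam (of_real t - z))) (at z)"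
    by (rule tempered_field_derivative[OF tempered_inv_fourier strip_decay_gam])
  show "((\<lambda>z. inv_fourier_at \<nu> (\<lambda>t. gam (of_real t - z))) has_field_derivative
    (2 * of_real pi * \<i> * of_real \<nu>) * exp (2 * of_real pi * \<i> * of_real \<nu> * z) * of_real (exp (- pi * \<nu>\<^sup>2))) (at z)"
    unfolding inv_fourier_gam by (auto intro!: derivative_eq_intros)
qed

section \<open>Characteristic functions of centred real and circular complex Gaussian
  variables\<close>

lemma (in prob_space) char_real_gaussian:
  assumes X: "real_gaussian M X" and m0: "(\<integral>x. X x \<partial>M) = 0"
  shows "(\<integral>x. iexp (X x) \<partial>M) = of_real (exp (- (\<integral>x. (X x)\<^sup>2 \<partial>M) / 2))"
  using X unfolding real_gaussian_def
proof (elim disjE exE conjE)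
  fix \<mu> \<sigma> :: real assume \<sigma>: "\<sigma> > 0" and d: "distributed M lborel X (\<lambda>x. ennreal (normal_density \<mu> \<sigma> x))"
  have Xm[measurable]: "X \<in> borel_measurable M" using distributed_measurable[OF d] by simp
  have "\<mu> = 0" using normal_distributed_expectation[OF \<sigma> d] m0 by simp
  note d' = d[unfolded this]
  have v: "(\<integral>x. (X x)\<^sup>2 \<partial>M) = \<sigma>\<^sup>2" using normal_distributed_variance[OF \<sigma> d'] m0 by simp
  have "distributed M lborel (\<lambda>x. (X x - 0) / \<sigma>) (\<lambda>x. ennreal (std_normal_density x))"
    using normal_standard_normal_convert[OF \<sigma>, of X 0] d' by simp
  then have "distr M borel (\<lambda>x. X x / \<sigma>) = std_normal_distribution"
    unfolding distributed_def by (simp cong: distr_cong)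
  moreover have "char (distr M borel (\<lambda>x. X x / \<sigma>)) \<sigma> = (\<integral>x. iexp (\<sigma> * (X x / \<sigma>)) \<partial>M)"
    unfolding char_def by (subst integral_distr) auto
  ultimately have "char std_normal_distribution \<sigma> = (\<integral>x. iexp (\<sigma> * (X x / \<sigma>)) \<partial>M)" by simp
  also have "\<dots> = (\<integral>x. iexp (X x) \<partial>M)" using \<sigma> by simp
  finally show ?thesis unfolding char_std_normal_distribution v by simp
next
  fix \<mu> assume [measurable]: "X \<in> borel_measurable M" and ae: "AE x in M. X x = \<mu>"
  have "(\<integral>x. X x \<partial>M) = (\<integral>x. \<mu> \<partial>M)" by (rule integral_cong_AE) (use ae in auto)
  then have "\<mu> = 0" using m0 by (simp add: prob_space)
  have "(\<integral>x. (X x)\<^sup>2 \<partial>M) = (\<integral>x. 0 \<partial>M)" by (rule integral_cong_AE) (use ae \<open>\<mu> = 0\<close> in auto)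
  moreover have "(\<integral>x. iexp (X x) \<partial>M) = (\<integral>x. 1 \<partial>M)" by (rule integral_cong_AE) (use ae \<open>\<mu> = 0\<close> in auto)
  ultimately show ?thesis by (simp add: prob_space)
qed

text \<open>Rotation by \<open>pi\<close> forces mean zero. Rotation by \<open>pi / 2\<close>
  exchanges the real and imaginary parts of \<open>d * Z\<close> up to sign, so each of them carries
  half of the second moment; joint Gaussianity makes \<open>Re (d * Z)\<close> normal.\<close>

lemma (in prob_space) circular_gaussian_single:
  assumes g: "jointly_complex_gaussian M 1 (\<lambda>_. Z)" and c: "circularly_symmetric M 1 (\<lambda>_. Z)"
    and Z[measurable]: "Z \<in> borel_measurable M" and i2: "integrable M (\<lambda>x. (cmod (Z x))\<^sup>2)"
  shows "(\<integral>x. Z x \<partial>M) = 0"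
    and "(\<integral>x. iexp (Re (d * Z x)) \<partial>M) = of_real (exp (- (cmod d)\<^sup>2 * (\<integral>x. (cmod (Z x))\<^sup>2 \<partial>M) / 4))"
proof -
  have rot: "(\<integral>x. k (cis \<theta> * Z x) \<partial>M) = (\<integral>x. k (Z x) \<partial>M)" if [measurable]: "k \<in> borel_measurable borel"
    for k :: "complex \<Rightarrow> 'b :: {banach, second_countable_topology}" and \<theta>
  proof -
    let ?P = "Pi\<^sub>M {..<1::nat} (\<lambda>_. borel :: complex measure)"
    have [measurable]: "(\<lambda>x. x 0) \<in> borel_measurable ?P" by (rule measurable_component_singleton) simp
    have "(\<integral>x. k (cis \<theta> * Z x) \<partial>M) = (\<integral>y. k (y 0) \<partial>distr M ?P (\<lambda>x. \<lambda>i\<in>{..<1}. cis \<theta> * Z x))"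
      by (subst integral_distr) (auto intro!: measurable_restrict)
    also have "distr M ?P (\<lambda>x. \<lambda>i\<in>{..<1}. cis \<theta> * Z x) = distr M ?P (\<lambda>x. \<lambda>i\<in>{..<1}. Z x)"
      by (rule c[unfolded circularly_symmetric_def, rule_format, of \<theta>])
    also have "(\<integral>y. k (y 0) \<partial>distr M ?P (\<lambda>x. \<lambda>i\<in>{..<1}. Z x)) = (\<integral>x. k (Z x) \<partial>M)"
      by (subst integral_distr) (auto intro!: measurable_restrict)
    finally show ?thesis .
  qed
  have iZ: "integrable M Z"
    using square_integrable_imp_integrable[of "\<lambda>x. cmod (Z x)"] i2 by (simp add: integrable_norm_iff)
  have "(\<integral>x. cis pi * Z x \<partial>M) = (\<integral>x. Z x \<partial>M)" by (rule rot) measurable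
  then show Z0: "(\<integral>x. Z x \<partial>M) = 0" by (simp add: cis_pi)
  define X where "X x = Re (d * Z x)" for x
  define Y where "Y x = Im (d * Z x)" for x
  have "real_gaussian M X"
    using g[unfolded jointly_complex_gaussian_def, THEN conjunct2, rule_format, of "\<lambda>_. Re d" "\<lambda>_. - Im d"]
    by (simp add: X_def[abs_def])
  note gX = this
  have z: "(\<integral>x. d * Z x \<partial>M) = 0" using Z0 by simp
  have re: "(\<integral>x. Re (d * Z x) \<partial>M) = Re (\<integral>x. d * Z x \<partial>M)" by (rule integral_Re) (use iZ in simp)
  have X0: "(\<integral>x. X x \<partial>M) = 0" unfolding X_def re z by simp
  have id2: "integrable M (\<lambda>x. (cmod (d * Z x))\<^sup>2)" using i2 by (simp add: norm_mult power_mult_distrib)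
  have le: "norm ((Re (d * w))\<^sup>2) \<le> norm ((cmod (d * w))\<^sup>2)" "norm ((Im (d * w))\<^sup>2) \<le> norm ((cmod (d * w))\<^sup>2)" for w
    unfolding cmod_power2 by simp_all
  have mX: "(\<lambda>x. (Re (d * Z x))\<^sup>2) \<in> borel_measurable M" "(\<lambda>x. (Im (d * Z x))\<^sup>2) \<in> borel_measurable M"
    by measurable
  have iX: "integrable M (\<lambda>x. (X x)\<^sup>2)" unfolding X_def
    by (rule Bochner_Integration.integrable_bound[OF id2 mX(1)]) (rule AE_I2, rule le)
  have iY: "integrable M (\<lambda>x. (Y x)\<^sup>2)" unfolding Y_def
    by (rule Bochner_Integration.integrable_bound[OF id2 mX(2)]) (rule AE_I2, rule le)
  have "(\<lambda>z. (Re (d * z))\<^sup>2) \<in> borel_measurable borel" by measurable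
  from rot[OF this, of "pi / 2"] have "(\<integral>x. (Re (d * (\<i> * Z x)))\<^sup>2 \<partial>M) = (\<integral>x. (X x)\<^sup>2 \<partial>M)"
    unfolding X_def cis_pi_half .
  moreover have "(Re (d * (\<i> * w)))\<^sup>2 = (Im (d * w))\<^sup>2" for w
  proof -
    have "Re (d * (\<i> * w)) = - Im (d * w)" by (simp add: algebra_simps)
    then show ?thesis by (simp only: power2_minus)
  qed
  ultimately have "(\<integral>x. (X x)\<^sup>2 \<partial>M) = (\<integral>x. (Y x)\<^sup>2 \<partial>M)" unfolding Y_def by simp
  moreover have "(\<integral>x. (X x)\<^sup>2 \<partial>M) + (\<integral>x. (Y x)\<^sup>2 \<partial>M) = (\<integral>x. (cmod (d * Z x))\<^sup>2 \<partial>M)"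
    unfolding Bochner_Integration.integral_add[OF iX iY, symmetric] unfolding X_def Y_def cmod_power2 ..
  moreover have "(\<integral>x. (cmod (d * Z x))\<^sup>2 \<partial>M) = (cmod d)\<^sup>2 * (\<integral>x. (cmod (Z x))\<^sup>2 \<partial>M)"
    by (simp add: norm_mult power_mult_distrib)
  ultimately have "(\<integral>x. (X x)\<^sup>2 \<partial>M) = (cmod d)\<^sup>2 * (\<integral>x. (cmod (Z x))\<^sup>2 \<partial>M) / 2" by simp
  then show "(\<integral>x. iexp (Re (d * Z x)) \<partial>M) = of_real (exp (- (cmod d)\<^sup>2 * (\<integral>x. (cmod (Z x))\<^sup>2 \<partial>M) / 4))"
    using char_real_gaussian[OF gX X0] by (simp add: X_def)
qed

section \<open>The noise as a Gaussian analytic function\<close>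

definition gam_at :: "complex \<Rightarrow> complex \<Rightarrow> complex" where
  "gam_at z s = gam (s - z)"

text \<open>Derivatives of \<open>gam_at z\<close> are taken in the parameter \<open>z\<close>, not
  in the variable \<open>s\<close>; hence the minus sign here and none in the second
  derivative.\<close>

definition dgam_at :: "complex \<Rightarrow> complex \<Rightarrow> complex" where
  "dgam_at z s = - deriv gam (s - z)"

definition ddgam_at :: "complex \<Rightarrow> complex \<Rightarrow> complex" where
  "ddgam_at z s = deriv (deriv gam) (s - z)"

lemma strip_decay_gam_at [intro, simp]: "strip_decay (gam_at z)" "strip_decay (dgam_at z)" "strip_decay (ddgam_at z)"
proof -
  have s: "strip_decay (\<lambda>s. F (s - z))" if "strip_decay F" for F
    using strip_decay_shift[OF that, of "-z"] by simp
  have m: "strip_decay (\<lambda>s. - F s)" if "strip_decay F" for F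
    using strip_decay_lincomb[OF that that, of "-1" 0] by simp
  show "strip_decay (gam_at z)" "strip_decay (dgam_at z)" "strip_decay (ddgam_at z)"
    unfolding gam_at_def[abs_def] dgam_at_def[abs_def] ddgam_at_def[abs_def]
    by (intro s m strip_decay_deriv strip_decay_gam)+
qed

lemma gam_at_derivatives:
  assumes "tempered_distribution u"
  shows "((\<lambda>z. u (\<lambda>t. gam_at z (of_real t))) has_field_derivative u (\<lambda>t. dgam_at z (of_real t))) (at z)"
    and "((\<lambda>z. u (\<lambda>t. dgam_at z (of_real t))) has_field_derivative u (\<lambda>t. ddgam_at z (of_real t))) (at z)"
proof -
  show "((\<lambda>z. u (\<lambda>t. gam_at z (of_real t))) has_field_derivative u (\<lambda>t. dgam_at z (of_real t))) (at z)"
    unfolding gam_at_def dgam_at_def by (rule tempered_field_derivative[OF assms strip_decay_gam])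
  have F: "strip_decay (\<lambda>s. - deriv gam s)"
    using strip_decay_lincomb[OF strip_decay_deriv[OF strip_decay_gam] strip_decay_deriv[OF strip_decay_gam], of "-1" 0] by simp
  have d: "deriv (\<lambda>s. - deriv gam s) = (\<lambda>s. - deriv (deriv gam) s)"
    by (rule ext, rule DERIV_imp_deriv, rule DERIV_minus, rule strip_decay_field_derivative[OF strip_decay_deriv[OF strip_decay_gam]])
  show "((\<lambda>z. u (\<lambda>t. dgam_at z (of_real t))) has_field_derivative u (\<lambda>t. ddgam_at z (of_real t))) (at z)"
    using tempered_field_derivative[OF assms F, of z] unfolding d dgam_at_def ddgam_at_def minus_minus .
qed

text \<open>The Fourier side of \<open>gam_at z\<close>: integrating
  \<open>wave z \<nu> * cnj (wave w \<nu>)\<close> against \<open>S\<close> gives the covariance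
  kernel of the noise.\<close>

definition wave :: "complex \<Rightarrow> real \<Rightarrow> complex" where
  "wave z \<nu> = exp (2 * of_real pi * \<i> * of_real \<nu> * z) * of_real (exp (- pi * \<nu>\<^sup>2))"

lemma inv_fourier_gam_at:
  "inv_fourier_at \<nu> (\<lambda>t. gam_at z (of_real t)) = wave z \<nu>"
  "inv_fourier_at \<nu> (\<lambda>t. dgam_at z (of_real t)) = (2 * of_real pi * \<i> * of_real \<nu>) * wave z \<nu>"
  "inv_fourier_at \<nu> (\<lambda>t. ddgam_at z (of_real t)) = (2 * of_real pi * \<i> * of_real \<nu>)\<^sup>2 * wave z \<nu>"
proof -
  define c where "c = 2 * complex_of_real pi * \<i> * of_real \<nu>"
  have 1: "inv_fourier_at \<nu> (\<lambda>t. gam_at z (of_real t)) = wave z \<nu>" for z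
    unfolding gam_at_def wave_def by (rule inv_fourier_gam)
  have 2: "inv_fourier_at \<nu> (\<lambda>t. dgam_at z (of_real t)) = c * wave z \<nu>" for z
    unfolding dgam_at_def wave_def inv_fourier_deriv_gam c_def by (simp only: mult.assoc)
  have w: "((\<lambda>z. wave z \<nu>) has_field_derivative c * wave z \<nu>) (at z)" for z
    using gam_at_derivatives(1)[OF tempered_inv_fourier, of \<nu> z] unfolding 1 2 .
  have "((\<lambda>z. c * wave z \<nu>) has_field_derivative inv_fourier_at \<nu> (\<lambda>t. ddgam_at z (of_real t))) (at z)"
    using gam_at_derivatives(2)[OF tempered_inv_fourier, of \<nu> z] unfolding 2 .
  from DERIV_unique[OF this DERIV_cmult[OF w]]
  have 3: "inv_fourier_at \<nu> (\<lambda>t. ddgam_at z (of_real t)) = c * (c * wave z \<nu>)" .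
  show "inv_fourier_at \<nu> (\<lambda>t. gam_at z (of_real t)) = wave z \<nu>"
    "inv_fourier_at \<nu> (\<lambda>t. dgam_at z (of_real t)) = (2 * of_real pi * \<i> * of_real \<nu>) * wave z \<nu>"
    "inv_fourier_at \<nu> (\<lambda>t. ddgam_at z (of_real t)) = (2 * of_real pi * \<i> * of_real \<nu>)\<^sup>2 * wave z \<nu>"
    unfolding 1 2 3 power2_eq_square mult.assoc c_def by (rule refl)+
qed

lemma wave_cnj_product:
  "wave z \<nu> * cnj (wave w \<nu>) = exp (2 * of_real pi * \<i> * of_real \<nu> * (z - cnj w)) * of_real (exp (- 2 * pi * \<nu>\<^sup>2))"
  unfolding wave_def complex_cnj_mult complex_cnj_complex_of_real
  by (simp add: exp_cnj exp_of_real[symmetric] exp_add[symmetric] algebra_simps)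

text \<open>Up to the factor \<open>exp (- 2 * pi * \<omega>\<^sup>2)\<close>, the smoothed PSD is the moment of order 0, and
  each derivative in \<open>\<omega>\<close> raises the order by one and contributes a factor 2.\<close>

definition psd_moment :: "(real \<Rightarrow> real) \<Rightarrow> nat \<Rightarrow> real \<Rightarrow> real" where
  "psd_moment S k \<omega> = (\<integral>\<nu>. (2 * pi * \<nu>) ^ k * exp (4 * pi * \<nu> * \<omega> - 2 * pi * \<nu>\<^sup>2) * S \<nu> \<partial>lebesgue)"

lemma smoothed_psd_moment: "smoothed_psd S \<omega> = exp (- 2 * pi * \<omega>\<^sup>2) * psd_moment S 0 \<omega>"
proof -
  have e: "exp (- 2 * pi * (t - \<omega>)\<^sup>2) * S t = exp (- 2 * pi * \<omega>\<^sup>2) * ((2 * pi * t) ^ 0 * exp (4 * pi * t * \<omega> - 2 * pi * t\<^sup>2) * S t)" for t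
  proof -
    have "exp (- 2 * pi * (t - \<omega>)\<^sup>2) = exp (- 2 * pi * \<omega>\<^sup>2) * exp (4 * pi * t * \<omega> - 2 * pi * t\<^sup>2)"
      unfolding exp_add[symmetric] by (rule arg_cong[where f=exp]) (simp add: power2_eq_square algebra_simps)
    then show ?thesis by simp
  qed
  show ?thesis unfolding smoothed_psd_def psd_moment_def e by (rule integral_mult_right_zero)
qed

lemma polynomial_growth_gaussian_integrable:
  assumes [measurable]: "S \<in> borel_measurable lebesgue" and g: "polynomial_growth S"
  shows "integrable lebesgue (\<lambda>\<nu>. exp (4 * pi * \<nu> * \<omega> - 2 * pi * \<nu>\<^sup>2) * S \<nu>)"
proof -
  obtain n :: real where n: "n > 0" "bdd_above (range (\<lambda>\<omega>. (1 + \<bar>\<omega>\<bar>) powr (- n) * \<bar>S \<omega>\<bar>))"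
    using g unfolding polynomial_growth_def by blast
  then obtain B where B: "\<And>\<nu>. (1 + \<bar>\<nu>\<bar>) powr (- n) * \<bar>S \<nu>\<bar> \<le> B" unfolding bdd_above_def by auto
  \<comment> \<open>Polynomial growth is weakened to
    \<open>\<bar>B\<bar> * exp (n * \<bar>\<nu>\<bar>)\<close>. With
    \<open>a = 2 * pi * \<bar>\<omega>\<bar> + n\<close>, the inequality
    \<open>2 * \<bar>\<nu>\<bar> * a \<le> \<nu>\<^sup>2 + a\<^sup>2\<close> bounds all linear terms
    of the exponent, and the Gaussian still leaves \<open>- \<nu>\<^sup>2\<close>.\<close>
  define C where "C = \<bar>B\<bar> * exp ((2 * pi * \<bar>\<omega>\<bar> + n)\<^sup>2)"
  have bound: "\<bar>exp (4 * pi * \<nu> * \<omega> - 2 * pi * \<nu>\<^sup>2) * S \<nu>\<bar> \<le> C * inverse (1 + \<nu>\<^sup>2)" for \<nu>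
  proof -
    have p: "(1 + \<bar>\<nu>\<bar>) powr n > 0" by (simp add: add_pos_nonneg)
    have "\<bar>S \<nu>\<bar> = (1 + \<bar>\<nu>\<bar>) powr n * ((1 + \<bar>\<nu>\<bar>) powr (- n) * \<bar>S \<nu>\<bar>)"
      using p by (simp add: powr_minus field_simps)
    also have "\<dots> \<le> (1 + \<bar>\<nu>\<bar>) powr n * \<bar>B\<bar>"
      using B[of \<nu>] p by (intro mult_left_mono) auto
    also have "(1 + \<bar>\<nu>\<bar>) powr n \<le> exp (n * \<bar>\<nu>\<bar>)"
      using ln_add_one_self_le_self[of "\<bar>\<nu>\<bar>"] n(1) by (simp add: powr_def add_nonneg_eq_0_iff)
    finally have S: "\<bar>S \<nu>\<bar> \<le> exp (n * \<bar>\<nu>\<bar>) * \<bar>B\<bar>" by (simp add: mult_right_mono)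
    have "1 + \<nu>\<^sup>2 \<le> exp (\<nu>\<^sup>2)" by (rule exp_ge_add_one_self)
    then have e: "exp (- (\<nu>\<^sup>2)) \<le> inverse (1 + \<nu>\<^sup>2)"
      unfolding exp_minus by (intro le_imp_inverse_le) (auto simp: add_pos_nonneg)
    have pi2: "2 * pi \<ge> 2" using pi_ge_two by simp
    have "4 * pi * \<nu> * \<omega> \<le> 4 * pi * (\<bar>\<nu>\<bar> * \<bar>\<omega>\<bar>)"
      unfolding abs_mult[symmetric] by simp
    moreover have "2 * \<nu>\<^sup>2 \<le> 2 * pi * \<nu>\<^sup>2" using pi2 by (intro mult_right_mono) auto
    moreover have "0 \<le> (\<bar>\<nu>\<bar> - (2 * pi * \<bar>\<omega>\<bar> + n))\<^sup>2" by simp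
    then have "2 * \<bar>\<nu>\<bar> * (2 * pi * \<bar>\<omega>\<bar> + n) \<le> \<nu>\<^sup>2 + (2 * pi * \<bar>\<omega>\<bar> + n)\<^sup>2"
      unfolding power2_diff by simp
    then have "4 * pi * (\<bar>\<nu>\<bar> * \<bar>\<omega>\<bar>) + 2 * (n * \<bar>\<nu>\<bar>) \<le> \<nu>\<^sup>2 + (2 * pi * \<bar>\<omega>\<bar> + n)\<^sup>2" by (simp add: algebra_simps)
    moreover have "0 \<le> n * \<bar>\<nu>\<bar>" using n(1) by simp
    ultimately have "4 * pi * \<nu> * \<omega> - 2 * pi * \<nu>\<^sup>2 + n * \<bar>\<nu>\<bar> \<le> (2 * pi * \<bar>\<omega>\<bar> + n)\<^sup>2 - \<nu>\<^sup>2" by linarith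
    then have "exp (4 * pi * \<nu> * \<omega> - 2 * pi * \<nu>\<^sup>2) * exp (n * \<bar>\<nu>\<bar>) \<le> exp ((2 * pi * \<bar>\<omega>\<bar> + n)\<^sup>2) * exp (- (\<nu>\<^sup>2))"
      unfolding exp_add[symmetric] by simp
    then have "exp (4 * pi * \<nu> * \<omega> - 2 * pi * \<nu>\<^sup>2) * exp (n * \<bar>\<nu>\<bar>) * \<bar>B\<bar> \<le> exp ((2 * pi * \<bar>\<omega>\<bar> + n)\<^sup>2) * exp (- (\<nu>\<^sup>2)) * \<bar>B\<bar>"
      by (rule mult_right_mono) simp
    also have "\<dots> = C * exp (- (\<nu>\<^sup>2))" by (simp add: C_def)
    also have "\<dots> \<le> C * inverse (1 + \<nu>\<^sup>2)" by (intro mult_left_mono e) (simp add: C_def)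
    finally have 1: "exp (4 * pi * \<nu> * \<omega> - 2 * pi * \<nu>\<^sup>2) * exp (n * \<bar>\<nu>\<bar>) * \<bar>B\<bar> \<le> C * inverse (1 + \<nu>\<^sup>2)" .
    have "\<bar>exp (4 * pi * \<nu> * \<omega> - 2 * pi * \<nu>\<^sup>2) * S \<nu>\<bar> \<le> exp (4 * pi * \<nu> * \<omega> - 2 * pi * \<nu>\<^sup>2) * (exp (n * \<bar>\<nu>\<bar>) * \<bar>B\<bar>)"
      unfolding abs_mult using S by (intro mult_mono) auto
    also have "\<dots> \<le> C * inverse (1 + \<nu>\<^sup>2)" using 1 by (simp only: mult.assoc)
    finally show ?thesis .
  qed
  have em: "(\<lambda>\<nu>. exp (4 * pi * \<nu> * \<omega> - 2 * pi * \<nu>\<^sup>2)) \<in> borel_measurable lebesgue"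
    by (rule measurable_completion) measurable
  show ?thesis
  proof (rule Bochner_Integration.integrable_bound)
    show "integrable lebesgue (\<lambda>\<nu>. C * inverse (1 + \<nu>\<^sup>2))"
      using integrable_inverse_one_plus_square by (intro integrable_mult_right) (simp add: integrable_completion)
    show "(\<lambda>\<nu>. exp (4 * pi * \<nu> * \<omega> - 2 * pi * \<nu>\<^sup>2) * S \<nu>) \<in> borel_measurable lebesgue"
      using em by measurable
    show "AE \<nu> in lebesgue. norm (exp (4 * pi * \<nu> * \<omega> - 2 * pi * \<nu>\<^sup>2) * S \<nu>) \<le> norm (C * inverse (1 + \<nu>\<^sup>2))"
      using bound by (auto intro!: AE_I2 order.trans[OF _ abs_ge_self])
  qed
qed

text \<open>The Gaussian weight is strictly positive, so a vanishing integral would force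
  \<open>S\<close> to vanish almost everywhere. This is what makes the noise nondegenerate at every
  point.\<close>

lemma psd_moment_pos:
  assumes S: "S \<in> borel_measurable lebesgue" "polynomial_growth S" "\<And>\<omega>. 0 \<le> S \<omega>" "\<not> (AE \<omega> in lebesgue. S \<omega> = 0)"
  shows "psd_moment S 0 \<omega> > 0"
proof -
  let ?f = "\<lambda>\<nu>. exp (4 * pi * \<nu> * \<omega> - 2 * pi * \<nu>\<^sup>2) * S \<nu>"
  have i: "integrable lebesgue ?f" by (rule polynomial_growth_gaussian_integrable[OF S(1,2)])
  have "(\<integral>\<nu>. ?f \<nu> \<partial>lebesgue) \<ge> 0" using S(3) by (intro integral_nonneg_AE) auto
  moreover have "(\<integral>\<nu>. ?f \<nu> \<partial>lebesgue) \<noteq> 0"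
  proof
    assume "(\<integral>\<nu>. ?f \<nu> \<partial>lebesgue) = 0"
    then have "AE \<nu> in lebesgue. ?f \<nu> = 0" using integral_nonneg_eq_0_iff_AE[OF i] S(3) by auto
    then have "AE \<nu> in lebesgue. S \<nu> = 0" by eventually_elim simp
    with S(4) show False by simp
  qed
  ultimately show ?thesis by (simp add: psd_moment_def)
qed

lemma product_cnj_integrable:
  fixes X Y :: "'a \<Rightarrow> complex"
  assumes "X \<in> borel_measurable M" "Y \<in> borel_measurable M"
    and "integrable M (\<lambda>\<xi>. (cmod (X \<xi>))\<^sup>2)" "integrable M (\<lambda>\<xi>. (cmod (Y \<xi>))\<^sup>2)"
  shows "integrable M (\<lambda>\<xi>. X \<xi> * cnj (Y \<xi>))"
proof (rule Bochner_Integration.integrable_bound)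
  show "integrable M (\<lambda>\<xi>. (cmod (X \<xi>))\<^sup>2 + (cmod (Y \<xi>))\<^sup>2)" using assms by simp
  show "(\<lambda>\<xi>. X \<xi> * cnj (Y \<xi>)) \<in> borel_measurable M" using assms(1,2) by measurable
  have "a * b \<le> a\<^sup>2 + b\<^sup>2" if "a \<ge> 0" "b \<ge> 0" for a b :: real
  proof -
    have "2 * a * b \<le> a\<^sup>2 + b\<^sup>2" by (rule sum_squares_bound)
    moreover have "0 \<le> a * b" using that by simp
    ultimately show ?thesis by linarith
  qed
  then show "AE \<xi> in M. norm (X \<xi> * cnj (Y \<xi>)) \<le> norm ((cmod (X \<xi>))\<^sup>2 + (cmod (Y \<xi>))\<^sup>2)"
    by (auto simp: norm_mult)
qed

text \<open>Unlike in the theorem, every realization is tempered here; the general case reduces to this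
  one by setting the process to zero on a null set.\<close>

locale gaussian_noise = prob_space M for M :: "'x measure" +
  fixes S :: "real \<Rightarrow> real" and W :: "(real \<Rightarrow> complex) \<Rightarrow> 'x \<Rightarrow> complex"
  assumes S_measurable: "S \<in> borel_measurable lebesgue"
    and S_nonneg: "\<And>\<omega>. 0 \<le> S \<omega>"
    and S_nonzero: "\<not> (AE \<omega> in lebesgue. S \<omega> = 0)"
    and S_growth: "polynomial_growth S"
    and process: "stationary_gaussian_process M S W"
    and tempered_W: "\<And>\<xi>. \<xi> \<in> space M \<Longrightarrow> tempered_distribution (\<lambda>\<phi>. W \<phi> \<xi>)"
begin

text \<open>Test functions are represented by entire functions, for which \<open>strip_decay\<close>
  provides shifts, linear combinations and complex derivatives.\<close>

definition WF :: "(complex \<Rightarrow> complex) \<Rightarrow> 'x \<Rightarrow> complex" where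
  "WF F \<xi> = W (\<lambda>t. F (of_real t)) \<xi>"

definition cov :: "(complex \<Rightarrow> complex) \<Rightarrow> (complex \<Rightarrow> complex) \<Rightarrow> complex" where
  "cov F G = (\<integral>\<xi>. WF F \<xi> * cnj (WF G \<xi>) \<partial>M)"

text \<open>In this order: measurability with square integrability, joint Gaussianity with circular
  symmetry, continuity, and the covariance formula.\<close>

lemmas process_parts =
  process[unfolded stationary_gaussian_process_def, THEN conjunct1]
  process[unfolded stationary_gaussian_process_def, THEN conjunct2, THEN conjunct2, THEN conjunct1]
  process[unfolded stationary_gaussian_process_def, THEN conjunct2, THEN conjunct2, THEN conjunct2, THEN conjunct1]
  process[unfolded stationary_gaussian_process_def, THEN conjunct2, THEN conjunct2, THEN conjunct2, THEN conjunct2]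

lemma W_measurable: "\<phi> \<in> schwartz \<Longrightarrow> W \<phi> \<in> borel_measurable M"
  and W_square_integrable: "\<phi> \<in> schwartz \<Longrightarrow> integrable M (\<lambda>\<xi>. (cmod (W \<phi> \<xi>))\<^sup>2)"
  using process_parts(1) by blast+

lemma WF_measurable: "strip_decay F \<Longrightarrow> WF F \<in> borel_measurable M"
  unfolding WF_def[abs_def] by (rule W_measurable[OF strip_decay_schwartz])

lemma WF_square_integrable: "strip_decay F \<Longrightarrow> integrable M (\<lambda>\<xi>. (cmod (WF F \<xi>))\<^sup>2)"
  unfolding WF_def by (rule W_square_integrable[OF strip_decay_schwartz])

lemma WF_lincomb:
  "\<lbrakk>strip_decay F; strip_decay G; \<xi> \<in> space M\<rbrakk> \<Longrightarrow> WF (\<lambda>s. a * F s + b * G s) \<xi> = a * WF F \<xi> + b * WF G \<xi>"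
  unfolding WF_def by (rule tempered_lincomb[OF tempered_W])

lemma WF_product_integrable:
  "strip_decay F \<Longrightarrow> strip_decay G \<Longrightarrow> integrable M (\<lambda>\<xi>. WF F \<xi> * cnj (WF G \<xi>))"
  by (intro product_cnj_integrable WF_measurable WF_square_integrable)

lemma cov_lincomb_left:
  assumes "strip_decay F" "strip_decay G" "strip_decay H"
  shows "cov (\<lambda>s. a * F s + b * G s) H = a * cov F H + b * cov G H"
proof -
  have "cov (\<lambda>s. a * F s + b * G s) H = (\<integral>\<xi>. a * (WF F \<xi> * cnj (WF H \<xi>)) + b * (WF G \<xi> * cnj (WF H \<xi>)) \<partial>M)"
    unfolding cov_def by (intro Bochner_Integration.integral_cong) (auto simp: WF_lincomb[OF assms(1,2)] algebra_simps)
  also have "\<dots> = a * cov F H + b * cov G H"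
    unfolding cov_def using WF_product_integrable assms by (subst Bochner_Integration.integral_add) auto
  finally show ?thesis .
qed

lemma cov_cnj: "cov G F = cnj (cov F G)"
  unfolding cov_def by (subst Bochner_Integration.integral_cnj[symmetric]) (simp add: mult.commute)

lemma cov_lincomb_right:
  assumes "strip_decay F" "strip_decay G" "strip_decay H"
  shows "cov H (\<lambda>s. a * F s + b * G s) = cnj a * cov H F + cnj b * cov H G"
proof -
  have "cov H (\<lambda>s. a * F s + b * G s) = cnj (cov (\<lambda>s. a * F s + b * G s) H)" by (rule cov_cnj)
  also have "\<dots> = cnj a * cnj (cov F H) + cnj b * cnj (cov G H)"
    unfolding cov_lincomb_left[OF assms] by simp
  finally show ?thesis by (simp only: cov_cnj[symmetric])
qed

lemma cov_self: "cov F F = of_real (\<integral>\<xi>. (cmod (WF F \<xi>))\<^sup>2 \<partial>M)"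
  unfolding cov_def complex_norm_square[symmetric] by (rule integral_complex_of_real)

text \<open>The covariance axiom is stated for \<open>pairing\<close>, so it is instantiated with
  the conjugates of \<open>F\<close> and \<open>G\<close>. Their Fourier transforms are conjugates
  of \<open>inv_fourier_at\<close>, which also accounts for the exchanged roles of the two
  factors.\<close>

lemma cov_formula:
  assumes F: "strip_decay F" and G: "strip_decay G"
  shows "cov F G = (\<integral>\<nu>. inv_fourier_at \<nu> (\<lambda>t. F (of_real t)) * cnj (inv_fourier_at \<nu> (\<lambda>t. G (of_real t))) * of_real (S \<nu>) \<partial>lebesgue)"
proof -
  have sc: "(\<lambda>t. cnj (H (of_real t))) \<in> schwartz" if "strip_decay H" for H
    using strip_decay_schwartz[OF strip_decay_cnj[OF that]] by simp
  have fo: "fourier (\<lambda>t. cnj (H (of_real t))) \<nu> = cnj (inv_fourier_at \<nu> (\<lambda>t. H (of_real t)))" if H: "strip_decay H" for H \<nu>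
  proof -
    have [measurable]: "(\<lambda>t. cnj (H (of_real t))) \<in> borel_measurable borel" by (rule schwartz_measurable[OF sc[OF H]])
    have "fourier (\<lambda>t. cnj (H (of_real t))) \<nu> = (\<integral>t. cnj (H (of_real t)) * exp (- 2 * of_real pi * \<i> * of_real t * of_real \<nu>) \<partial>lborel)"
      unfolding fourier_def by (rule integral_completion) measurable
    also have "\<dots> = (\<integral>t. cnj (H (of_real t) * exp (2 * of_real pi * \<i> * of_real t * of_real \<nu>)) \<partial>lborel)"
      by (simp add: exp_cnj)
    also have "\<dots> = cnj (inv_fourier_at \<nu> (\<lambda>t. H (of_real t)))"
      unfolding inv_fourier_at_def by (rule Bochner_Integration.integral_cnj)
    finally show ?thesis .
  qed
  from process_parts(4)[rule_format, OF sc[OF F] sc[OF G]]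
  show ?thesis unfolding pairing_def fo[OF F] fo[OF G] cov_def WF_def by (simp add: mult.commute)
qed

lemma WF_single:
  assumes F: "strip_decay F"
  shows WF_mean: "(\<integral>\<xi>. WF F \<xi> \<partial>M) = 0"
    and WF_gaussian: "complex_gaussian M (WF F) (Re (cov F F))"
proof -
  from process_parts(2)[rule_format, of 1 "\<lambda>_ t. F (of_real t)"] strip_decay_schwartz[OF F]
  have g: "jointly_complex_gaussian M 1 (\<lambda>_. WF F)" "circularly_symmetric M 1 (\<lambda>_. WF F)"
    unfolding WF_def[abs_def] by auto
  note c = circular_gaussian_single[OF g WF_measurable[OF F] WF_square_integrable[OF F]]
  show "(\<integral>\<xi>. WF F \<xi> \<partial>M) = 0" by (rule c(1))
  show "complex_gaussian M (WF F) (Re (cov F F))"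
    unfolding complex_gaussian_def cov_self using WF_measurable[OF F] c(2) by simp
qed

text \<open>The sum of the two values is the value at \<open>F + G\<close>, a single circular
  Gaussian variable. Its characteristic function depends only on its variance, which is additive
  when \<open>cov F G = 0\<close>.\<close>

lemma uncorrelated_factor:
  assumes F: "strip_decay F" and G: "strip_decay G" and c: "cov F G = 0"
  shows "(\<integral>\<xi>. iexp (Re (WF F \<xi>)) * iexp (Re (WF G \<xi>)) \<partial>M) = (\<integral>\<xi>. iexp (Re (WF F \<xi>)) \<partial>M) * (\<integral>\<xi>. iexp (Re (WF G \<xi>)) \<partial>M)"
proof -
  let ?H = "\<lambda>s. 1 * F s + 1 * G s"
  have H: "strip_decay ?H" by (rule strip_decay_lincomb[OF F G])
  have ch: "(\<integral>\<xi>. iexp (Re (WF K \<xi>)) \<partial>M) = of_real (exp (- Re (cov K K) / 4))" if "strip_decay K" for K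
    using WF_gaussian[OF that] unfolding complex_gaussian_def by (auto dest!: spec[of _ 1])
  have "cov ?H ?H = cov F F + cov G G"
    using c cov_cnj[of G F] by (simp only: cov_lincomb_left[OF F G H] cov_lincomb_right[OF F G F] cov_lincomb_right[OF F G G]) simp
  then have "(\<integral>\<xi>. iexp (Re (WF ?H \<xi>)) \<partial>M) = of_real (exp (- Re (cov F F) / 4)) * of_real (exp (- Re (cov G G) / 4))"
    unfolding ch[OF H] of_real_mult[symmetric] exp_add[symmetric] by (simp add: add_divide_distrib)
  also have "(\<integral>\<xi>. iexp (Re (WF ?H \<xi>)) \<partial>M) = (\<integral>\<xi>. iexp (Re (WF F \<xi>)) * iexp (Re (WF G \<xi>)) \<partial>M)"
    by (intro Bochner_Integration.integral_cong refl, subst WF_lincomb[OF F G]) (simp_all add: exp_add[symmetric] algebra_simps)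
  finally show ?thesis unfolding ch[OF F] ch[OF G] .
qed

text \<open>Applied to this distribution, the Bargmann transform makes the covariance kernel entire in its
  first argument, so the smoothed PSD is smooth and no integral is ever differentiated.\<close>

lemma tempered_cov:
  assumes G: "strip_decay G"
  shows "tempered_distribution (\<lambda>\<phi>. \<integral>\<xi>. W \<phi> \<xi> * cnj (WF G \<xi>) \<partial>M)"
  unfolding tempered_distribution_def
proof (intro conjI ballI allI impI)
  note m = WF_measurable[OF G] and sq = WF_square_integrable[OF G]
  fix \<phi> \<psi> a b assume s: "\<phi> \<in> schwartz" "\<psi> \<in> schwartz"
  have i: "integrable M (\<lambda>\<xi>. W \<phi> \<xi> * cnj (WF G \<xi>))" "integrable M (\<lambda>\<xi>. W \<psi> \<xi> * cnj (WF G \<xi>))"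
    by (intro product_cnj_integrable W_measurable W_square_integrable m sq s)+
  have "W (\<lambda>t. a * \<phi> t + b * \<psi> t) \<xi> = a * W \<phi> \<xi> + b * W \<psi> \<xi>" if "\<xi> \<in> space M" for \<xi>
    by (rule tempered_W[OF that, unfolded tempered_distribution_def, THEN conjunct1, rule_format, OF s])
  then have "(\<integral>\<xi>. W (\<lambda>t. a * \<phi> t + b * \<psi> t) \<xi> * cnj (WF G \<xi>) \<partial>M) = (\<integral>\<xi>. a * (W \<phi> \<xi> * cnj (WF G \<xi>)) + b * (W \<psi> \<xi> * cnj (WF G \<xi>)) \<partial>M)"
    by (intro Bochner_Integration.integral_cong) (auto simp: algebra_simps)
  also have "\<dots> = a * (\<integral>\<xi>. W \<phi> \<xi> * cnj (WF G \<xi>) \<partial>M) + b * (\<integral>\<xi>. W \<psi> \<xi> * cnj (WF G \<xi>) \<partial>M)"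
    using i by (subst Bochner_Integration.integral_add) auto
  finally show "(\<integral>\<xi>. W (\<lambda>t. a * \<phi> t + b * \<psi> t) \<xi> * cnj (WF G \<xi>) \<partial>M) = a * (\<integral>\<xi>. W \<phi> \<xi> * cnj (WF G \<xi>) \<partial>M) + b * (\<integral>\<xi>. W \<psi> \<xi> * cnj (WF G \<xi>) \<partial>M)" .
next
  note m = WF_measurable[OF G] and sq = WF_square_integrable[OF G]
  fix \<Phi> assume \<Phi>: "schwartz_null_seq \<Phi>"
  then have s: "\<Phi> k \<in> schwartz" for k by (simp add: schwartz_null_seq_def)
  define A where "A k = (\<integral>\<xi>. (cmod (W (\<Phi> k) \<xi>))\<^sup>2 \<partial>M)" for k
  define B where "B = (\<integral>\<xi>. (cmod (WF G \<xi>))\<^sup>2 \<partial>M)"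
  have A0: "A \<longlonglongrightarrow> 0" unfolding A_def by (rule process_parts(3)[rule_format, OF \<Phi>])
  have A: "A k \<ge> 0" and B: "B \<ge> 0" for k by (auto simp: A_def B_def)
  have le: "cmod (\<integral>\<xi>. W (\<Phi> k) \<xi> * cnj (WF G \<xi>) \<partial>M) \<le> sqrt (A k) * sqrt B" for k
  proof -
    have [measurable]: "W (\<Phi> k) \<in> borel_measurable M" "WF G \<in> borel_measurable M" by (rule W_measurable[OF s], rule m)
    have i: "integrable M (\<lambda>\<xi>. cmod (W (\<Phi> k) \<xi>) * cmod (WF G \<xi>))"
      using integrable_norm[OF product_cnj_integrable[OF W_measurable[OF s] m W_square_integrable[OF s] sq]] by (simp add: norm_mult)
    let ?I = "\<integral>\<xi>. cmod (W (\<Phi> k) \<xi>) * cmod (WF G \<xi>) \<partial>M"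
    have I0: "?I \<ge> 0" by simp
    have "(\<integral>\<^sup>+\<xi>. ennreal (cmod (W (\<Phi> k) \<xi>)) * ennreal (cmod (WF G \<xi>)) \<partial>M)\<^sup>2 \<le> (\<integral>\<^sup>+\<xi>. (ennreal (cmod (W (\<Phi> k) \<xi>)))\<^sup>2 \<partial>M) * (\<integral>\<^sup>+\<xi>. (ennreal (cmod (WF G \<xi>)))\<^sup>2 \<partial>M)"
      by (rule Cauchy_Schwarz_nn_integral) measurable
    then have "ennreal (?I\<^sup>2) \<le> ennreal (A k * B)"
      using i W_square_integrable[OF s[of k]] sq unfolding A_def B_def
      by (simp add: ennreal_mult[symmetric] ennreal_power nn_integral_eq_integral)
    then have "?I\<^sup>2 \<le> A k * B" using A B by simp
    then have "?I \<le> sqrt (A k * B)" by (rule real_le_rsqrt)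
    moreover have "cmod (\<integral>\<xi>. W (\<Phi> k) \<xi> * cnj (WF G \<xi>) \<partial>M) \<le> ?I"
      using integral_norm_bound[of M "\<lambda>\<xi>. W (\<Phi> k) \<xi> * cnj (WF G \<xi>)"] by (simp add: norm_mult)
    ultimately show ?thesis by (simp add: real_sqrt_mult)
  qed
  have "(\<lambda>k. sqrt (A k) * sqrt B) \<longlonglongrightarrow> sqrt 0 * sqrt B"
    by (intro tendsto_mult tendsto_real_sqrt A0 tendsto_const)
  then have lim: "(\<lambda>k. sqrt (A k) * sqrt B) \<longlonglongrightarrow> 0" by simp
  show "(\<lambda>k. \<integral>\<xi>. W (\<Phi> k) \<xi> * cnj (WF G \<xi>) \<partial>M) \<longlonglongrightarrow> 0"
    by (rule Lim_null_comparison[OF always_eventually[OF allI[OF le]] lim])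
qed

lemma cov_gam_derivatives:
  assumes G: "strip_decay G"
  shows "((\<lambda>z. cov (gam_at z) G) has_field_derivative cov (dgam_at z) G) (at z)"
    and "((\<lambda>z. cov (dgam_at z) G) has_field_derivative cov (ddgam_at z) G) (at z)"
  unfolding cov_def WF_def[of "gam_at _"] WF_def[of "dgam_at _"] WF_def[of "ddgam_at _"]
  by (rule gam_at_derivatives[OF tempered_cov[OF G]])+

lemma of_real_psd_moment:
  "(\<integral>\<nu>. (2 * of_real pi * of_real \<nu>) ^ k * exp (2 * of_real pi * \<i> * of_real \<nu> * (- 2 * \<i> * of_real \<omega>)) * of_real (exp (- 2 * pi * \<nu>\<^sup>2)) * of_real (S \<nu>) \<partial>lebesgue)
     = complex_of_real (psd_moment S k \<omega>)"
proof -
  have "(2 * of_real pi * of_real \<nu>) ^ k * exp (2 * of_real pi * \<i> * of_real \<nu> * (- 2 * \<i> * of_real \<omega>)) * of_real (exp (- 2 * pi * \<nu>\<^sup>2)) * of_real (S \<nu>) =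
     complex_of_real ((2 * pi * \<nu>) ^ k * exp (4 * pi * \<nu> * \<omega> - 2 * pi * \<nu>\<^sup>2) * S \<nu>)" for \<nu>
  proof -
    have "2 * of_real pi * \<i> * of_real \<nu> * (- 2 * \<i> * of_real \<omega>) = complex_of_real (4 * pi * \<nu> * \<omega>)" by simp
    then have "exp (2 * of_real pi * \<i> * of_real \<nu> * (- 2 * \<i> * of_real \<omega>)) = complex_of_real (exp (4 * pi * \<nu> * \<omega>))" by (simp only: exp_of_real)
    moreover have "exp (4 * pi * \<nu> * \<omega> - 2 * pi * \<nu>\<^sup>2) = exp (4 * pi * \<nu> * \<omega>) * exp (- 2 * pi * \<nu>\<^sup>2)" by (simp add: exp_add[symmetric])
    ultimately show ?thesis by simp
  qed
  then show ?thesis unfolding psd_moment_def by (simp only: integral_complex_of_real)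
qed

text \<open>The hypothesis covers both uses: the diagonal \<open>w = z\<close> with \<omega> equal
  to \<open>- Im z\<close>, and \<open>w = 0\<close> with \<open>z\<close> on the imaginary axis,
  where the kernel is differentiated to obtain derivatives in \<omega>.\<close>

lemma cov_moments:
  assumes zw: "z - cnj w = - 2 * \<i> * of_real \<omega>"
  shows "cov (gam_at z) (gam_at w) = of_real (psd_moment S 0 \<omega>)"
    and "cov (dgam_at z) (gam_at w) = \<i> * of_real (psd_moment S 1 \<omega>)"
    and "cov (ddgam_at z) (gam_at w) = - of_real (psd_moment S 2 \<omega>)"
    and "cov (dgam_at z) (dgam_at w) = of_real (psd_moment S 2 \<omega>)"
proof -
  let ?e = "\<lambda>\<nu>. exp (2 * of_real pi * \<i> * of_real \<nu> * (- 2 * \<i> * of_real \<omega>)) * of_real (exp (- 2 * pi * \<nu>\<^sup>2))"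
  let ?I = "\<lambda>k. \<integral>\<nu>. (2 * of_real pi * of_real \<nu>) ^ k * exp (2 * of_real pi * \<i> * of_real \<nu> * (- 2 * \<i> * of_real \<omega>)) * of_real (exp (- 2 * pi * \<nu>\<^sup>2)) * of_real (S \<nu>) \<partial>lebesgue"
  have e: "wave z \<nu> * cnj (wave w \<nu>) = ?e \<nu>" for \<nu> unfolding wave_cnj_product zw ..
  have I: "(\<integral>\<nu>. (c \<nu> * wave z \<nu>) * cnj (d \<nu> * wave w \<nu>) * of_real (S \<nu>) \<partial>lebesgue) = k * ?I n"
    if "\<And>\<nu>. c \<nu> * cnj (d \<nu>) = k * (2 * of_real pi * of_real \<nu>) ^ n" for c d :: "real \<Rightarrow> complex" and k n
  proof -
    have "(c \<nu> * wave z \<nu>) * cnj (d \<nu> * wave w \<nu>) * of_real (S \<nu>) = k * ((2 * of_real pi * of_real \<nu>) ^ n * exp (2 * of_real pi * \<i> * of_real \<nu> * (- 2 * \<i> * of_real \<omega>)) * of_real (exp (- 2 * pi * \<nu>\<^sup>2)) * of_real (S \<nu>))" for \<nu>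
    proof -
      have "(c \<nu> * wave z \<nu>) * cnj (d \<nu> * wave w \<nu>) * of_real (S \<nu>) = (c \<nu> * cnj (d \<nu>)) * (wave z \<nu> * cnj (wave w \<nu>)) * of_real (S \<nu>)"
        by (simp only: complex_cnj_mult mult_ac)
      then show ?thesis unfolding that e by (simp only: mult.assoc)
    qed
    then show ?thesis by (simp only: integral_mult_right_zero)
  qed
  have "cov (gam_at z) (gam_at w) = 1 * ?I 0"
    using I[of "\<lambda>_. 1" "\<lambda>_. 1" 1 0] unfolding cov_formula[OF strip_decay_gam_at(1,1)] inv_fourier_gam_at by simp
  then show "cov (gam_at z) (gam_at w) = of_real (psd_moment S 0 \<omega>)" unfolding of_real_psd_moment by simp
  have "cov (dgam_at z) (gam_at w) = \<i> * ?I 1"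
    using I[of "\<lambda>\<nu>. 2 * of_real pi * \<i> * of_real \<nu>" "\<lambda>_. 1" \<i> 1]
    unfolding cov_formula[OF strip_decay_gam_at(2,1)] inv_fourier_gam_at by simp
  then show "cov (dgam_at z) (gam_at w) = \<i> * of_real (psd_moment S 1 \<omega>)" unfolding of_real_psd_moment .
  have "cov (ddgam_at z) (gam_at w) = (-1) * ?I 2"
    using I[of "\<lambda>\<nu>. (2 * of_real pi * \<i> * of_real \<nu>)\<^sup>2" "\<lambda>_. 1" "-1" 2]
    unfolding cov_formula[OF strip_decay_gam_at(3,1)] inv_fourier_gam_at by (simp add: power_mult_distrib)
  then show "cov (ddgam_at z) (gam_at w) = - of_real (psd_moment S 2 \<omega>)" unfolding of_real_psd_moment by simp
  have "cov (dgam_at z) (dgam_at w) = 1 * ?I 2"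
    unfolding cov_formula[OF strip_decay_gam_at(2,2)] inv_fourier_gam_at
    by (rule I) (simp add: power2_eq_square)
  then show "cov (dgam_at z) (dgam_at w) = of_real (psd_moment S 2 \<omega>)" unfolding of_real_psd_moment by simp
qed

text \<open>Moments are values of an entire kernel along \<open>z = - 2 * \<i> * \<omega>\<close>
  with \<open>w = 0\<close>. The inner derivative \<open>- 2 * \<i>\<close> and the factor \<i> that
  each z-derivative brings multiply to 2.\<close>

lemma psd_moment_derivatives:
  "(psd_moment S 0 has_field_derivative 2 * psd_moment S 1 \<omega>) (at \<omega>)"
  "(psd_moment S 1 has_field_derivative 2 * psd_moment S 2 \<omega>) (at \<omega>)"
proof -
  have m: "cov (gam_at (- 2 * \<i> * of_real \<omega>)) (gam_at 0) = of_real (psd_moment S 0 \<omega>)"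
    "cov (dgam_at (- 2 * \<i> * of_real \<omega>)) (gam_at 0) = \<i> * of_real (psd_moment S 1 \<omega>)"
    "cov (ddgam_at (- 2 * \<i> * of_real \<omega>)) (gam_at 0) = - of_real (psd_moment S 2 \<omega>)" for \<omega>
    by (rule cov_moments; simp)+
  let ?l = "\<lambda>\<omega>::real. - 2 * \<i> * complex_of_real \<omega>"
  have l: "((\<lambda>x. - 2 * \<i> * x) has_field_derivative - 2 * \<i>) (at (of_real \<omega>))"
    by (auto intro!: derivative_eq_intros)
  have "((\<lambda>x. cov (gam_at (- 2 * \<i> * x)) (gam_at 0)) has_field_derivative cov (dgam_at (?l \<omega>)) (gam_at 0) * (- 2 * \<i>)) (at (of_real \<omega>))"
    by (rule DERIV_chain2[OF cov_gam_derivatives(1)[OF strip_decay_gam_at(1)] l])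
  from has_vector_derivative_real_field[OF this]
  have "((\<lambda>x. complex_of_real (psd_moment S 0 x)) has_vector_derivative of_real (2 * psd_moment S 1 \<omega>)) (at \<omega>)"
    unfolding m by (simp add: algebra_simps)
  from bounded_linear.has_vector_derivative[OF bounded_linear_Re this]
  show "(psd_moment S 0 has_field_derivative 2 * psd_moment S 1 \<omega>) (at \<omega>)"
    by (simp add: has_real_derivative_iff_has_vector_derivative)
  have "((\<lambda>x. cov (dgam_at (- 2 * \<i> * x)) (gam_at 0)) has_field_derivative cov (ddgam_at (?l \<omega>)) (gam_at 0) * (- 2 * \<i>)) (at (of_real \<omega>))"
    by (rule DERIV_chain2[OF cov_gam_derivatives(2)[OF strip_decay_gam_at(1)] l])
  from has_vector_derivative_real_field[OF this]
  have "((\<lambda>x. \<i> * complex_of_real (psd_moment S 1 x)) has_vector_derivative \<i> * of_real (2 * psd_moment S 2 \<omega>)) (at \<omega>)"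
    unfolding m by (simp add: algebra_simps)
  from bounded_linear.has_vector_derivative[OF bounded_linear_Im this]
  show "(psd_moment S 1 has_field_derivative 2 * psd_moment S 2 \<omega>) (at \<omega>)"
    by (simp add: has_real_derivative_iff_has_vector_derivative)
qed

end

section \<open>The intensity in terms of moments\<close>

text \<open>Moving \<tau> differentiates \<open>G\<close> with factor 1 and moving \<omega> with
  factor \<open>- \<i>\<close>, so \<open>Re\<close> becomes \<open>Im\<close> in the first
  derivative. In the sum of the second derivatives the terms with \<open>deriv (deriv G)\<close>
  cancel.\<close>

lemma cmod_square_line_derivatives:
  assumes G: "G holomorphic_on UNIV"
  shows "((\<lambda>x. (cmod (G (tf_point x \<omega>)))\<^sup>2) has_field_derivative 2 * Re (deriv G (tf_point \<tau> \<omega>) * cnj (G (tf_point \<tau> \<omega>)))) (at \<tau>)"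
    and "((\<lambda>x. 2 * Re (deriv G (tf_point x \<omega>) * cnj (G (tf_point x \<omega>)))) has_field_derivative
       2 * Re (deriv (deriv G) (tf_point \<tau> \<omega>) * cnj (G (tf_point \<tau> \<omega>))) + 2 * (cmod (deriv G (tf_point \<tau> \<omega>)))\<^sup>2) (at \<tau>)"
    and "((\<lambda>x. (cmod (G (tf_point \<tau> x)))\<^sup>2) has_field_derivative 2 * Im (deriv G (tf_point \<tau> \<omega>) * cnj (G (tf_point \<tau> \<omega>)))) (at \<omega>)"
    and "((\<lambda>x. 2 * Im (deriv G (tf_point \<tau> x) * cnj (G (tf_point \<tau> x)))) has_field_derivative
       - 2 * Re (deriv (deriv G) (tf_point \<tau> \<omega>) * cnj (G (tf_point \<tau> \<omega>))) + 2 * (cmod (deriv G (tf_point \<tau> \<omega>)))\<^sup>2) (at \<omega>)"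
proof -
  have d: "(F has_field_derivative deriv F z) (at z)" if "F holomorphic_on UNIV" for F z
    using holomorphic_derivI[OF that, of z] by simp
  have G': "deriv G holomorphic_on UNIV" by (rule holomorphic_deriv[OF G]) simp
  have tau: "((\<lambda>x. F (tf_point x \<omega>)) has_vector_derivative deriv F (tf_point \<tau> \<omega>)) (at \<tau>)" if F: "F holomorphic_on UNIV" for F
  proof -
    have "((\<lambda>x. tf_point x \<omega>) has_vector_derivative 1) (at \<tau>)"
      unfolding tf_point_def Complex_eq by (auto intro!: derivative_eq_intros)
    from field_vector_diff_chain_at[OF this d[OF F]] show ?thesis by (simp add: o_def)
  qed
  have om: "((\<lambda>x. F (tf_point \<tau> x)) has_vector_derivative - \<i> * deriv F (tf_point \<tau> \<omega>)) (at \<omega>)" if F: "F holomorphic_on UNIV" for F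
  proof -
    have "((\<lambda>x. tf_point \<tau> x) has_vector_derivative - \<i>) (at \<omega>)"
      unfolding tf_point_def Complex_eq by (auto intro!: derivative_eq_intros)
    from field_vector_diff_chain_at[OF this d[OF F]] show ?thesis by (simp add: o_def)
  qed
  have re: "((\<lambda>x. Re (f x)) has_field_derivative Re f') (at x0)" and im: "((\<lambda>x. Im (f x)) has_field_derivative Im f') (at x0)"
    if "(f has_vector_derivative f') (at x0)" for f :: "real \<Rightarrow> complex" and f' x0
    using bounded_linear.has_vector_derivative[OF bounded_linear_Re that] bounded_linear.has_vector_derivative[OF bounded_linear_Im that]
    by (simp_all add: has_real_derivative_iff_has_vector_derivative)
  have rc: "Re (a * cnj b) = Re a * Re b + Im a * Im b" "Im (a * cnj b) = Im a * Re b - Re a * Im b" for a b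
    by auto
  note t0 = re[OF tau[OF G]] im[OF tau[OF G]] re[OF tau[OF G']] im[OF tau[OF G']]
  note o0 = re[OF om[OF G]] im[OF om[OF G]] re[OF om[OF G']] im[OF om[OF G']]
  show "((\<lambda>x. (cmod (G (tf_point x \<omega>)))\<^sup>2) has_field_derivative 2 * Re (deriv G (tf_point \<tau> \<omega>) * cnj (G (tf_point \<tau> \<omega>)))) (at \<tau>)"
    unfolding cmod_power2 by (rule derivative_eq_intros t0 refl)+ (simp add: algebra_simps)
  show "((\<lambda>x. (cmod (G (tf_point \<tau> x)))\<^sup>2) has_field_derivative 2 * Im (deriv G (tf_point \<tau> \<omega>) * cnj (G (tf_point \<tau> \<omega>)))) (at \<omega>)"
    unfolding cmod_power2 by (rule derivative_eq_intros o0 refl)+ (simp add: algebra_simps)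
  show "((\<lambda>x. 2 * Re (deriv G (tf_point x \<omega>) * cnj (G (tf_point x \<omega>)))) has_field_derivative
       2 * Re (deriv (deriv G) (tf_point \<tau> \<omega>) * cnj (G (tf_point \<tau> \<omega>))) + 2 * (cmod (deriv G (tf_point \<tau> \<omega>)))\<^sup>2) (at \<tau>)"
    unfolding cmod_power2 rc
    by (rule derivative_eq_intros t0 refl)+ (simp add: power2_eq_square algebra_simps)
  show "((\<lambda>x. 2 * Im (deriv G (tf_point \<tau> x) * cnj (G (tf_point \<tau> x)))) has_field_derivative
       - 2 * Re (deriv (deriv G) (tf_point \<tau> \<omega>) * cnj (G (tf_point \<tau> \<omega>))) + 2 * (cmod (deriv G (tf_point \<tau> \<omega>)))\<^sup>2) (at \<omega>)"
    unfolding cmod_power2 rc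
    by (rule derivative_eq_intros o0 refl)+ (simp add: power2_eq_square algebra_simps)
qed

text \<open>Here \<open>p\<close> is the squared modulus of the Bargmann transform, \<open>D\<close>
  its \<omega>-derivative, \<open>g2\<close> the squared modulus of the derivative of the transform,
  \<open>E\<close> the factor \<open>exp (- 2 * pi * \<omega>\<^sup>2)\<close>, \<open>M0\<close>,
  \<open>M1\<close>, \<open>M2\<close> are the moments and \<open>l\<close> is the logarithmic
  derivative of the smoothed PSD. The long bracket after \<open>sqrt 2 * E\<close> is the Laplacian
  of \<open>E * p\<close> divided by \<open>E\<close>.\<close>

lemma rho1_algebra:
  fixes M0 M1 M2 p D g2 \<omega> E c :: real
  assumes M0: "M0 > 0" and E: "E > 0"
  defines "l \<equiv> - 4 * pi * \<omega> + 2 * M1 / M0"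
  shows "1 + 1 / (4 * pi) * (- 4 * pi + (4 * M2 * M0 - 4 * M1\<^sup>2) / M0\<^sup>2) + 1 / sqrt 2 *
      (1 / (4 * pi) * (sqrt 2 * E * (4 * g2 - 8 * pi * \<omega> * D + (16 * pi\<^sup>2 * \<omega>\<^sup>2 - 4 * pi) * p) / (E * M0))
      - 1 / (2 * pi) * l * (sqrt 2 * E * (D - 4 * pi * \<omega> * p) / (E * M0))
      + (1 + 1 / (4 * pi) * l\<^sup>2) * (sqrt 2 * E * p / (E * M0))) =
    1 / (pi * M0) * ((g2 + (M1 / M0)\<^sup>2 * p - (M1 / M0) * D) + M2 - M1\<^sup>2 / M0)"
proof -
  define m where "m = M1 / M0"
  have M1: "M1 = m * M0" using M0 by (simp add: m_def)
  have s: "1 / sqrt 2 * (1 / (4 * pi) * (sqrt 2 * E * a / (E * M0)) - 1 / (2 * pi) * l * (sqrt 2 * E * b / (E * M0)) + k * (sqrt 2 * E * p / (E * M0)))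
    = 1 / (4 * pi) * (a / M0) - 1 / (2 * pi) * l * (b / M0) + k * (p / M0)" for a b k
  proof -
    have c: "sqrt 2 * E * x / (E * M0) = sqrt 2 * (x / M0)" for x using E by simp
    show ?thesis unfolding c by (simp add: algebra_simps)
  qed
  have l: "l = - 4 * pi * \<omega> + 2 * m" by (simp add: l_def m_def)
  show ?thesis unfolding s m_def[symmetric] unfolding l unfolding M1
    using M0 by (simp add: field_simps power2_eq_square)
qed

context gaussian_noise begin

lemma psd0_pos: "psd_moment S 0 \<omega> > 0"
  by (rule psd_moment_pos[OF S_measurable S_growth S_nonneg S_nonzero])

lemma log_smoothed_psd_derivatives:
  "deriv (log_smoothed_psd S) = (\<lambda>\<omega>. - 4 * pi * \<omega> + 2 * psd_moment S 1 \<omega> / psd_moment S 0 \<omega>)"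
  "deriv (deriv (log_smoothed_psd S)) \<omega> = - 4 * pi + (4 * psd_moment S 2 \<omega> * psd_moment S 0 \<omega> - 4 * (psd_moment S 1 \<omega>)\<^sup>2) / (psd_moment S 0 \<omega>)\<^sup>2"
proof -
  have e: "log_smoothed_psd S = (\<lambda>\<omega>. - 2 * pi * \<omega>\<^sup>2 + ln (psd_moment S 0 \<omega>))"
  proof
    fix \<omega>
    have "ln (exp (- 2 * pi * \<omega>\<^sup>2) * psd_moment S 0 \<omega>) = ln (exp (- 2 * pi * \<omega>\<^sup>2)) + ln (psd_moment S 0 \<omega>)"
      using psd0_pos[of \<omega>] by (simp add: ln_mult_pos del: ln_exp)
    then show "log_smoothed_psd S \<omega> = - 2 * pi * \<omega>\<^sup>2 + ln (psd_moment S 0 \<omega>)"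
      by (simp add: log_smoothed_psd_def smoothed_psd_moment)
  qed
  show 1: "deriv (log_smoothed_psd S) = (\<lambda>\<omega>. - 4 * pi * \<omega> + 2 * psd_moment S 1 \<omega> / psd_moment S 0 \<omega>)"
  proof
    fix \<omega>
    have "((\<lambda>\<omega>. - 2 * pi * \<omega>\<^sup>2 + ln (psd_moment S 0 \<omega>)) has_field_derivative - 4 * pi * \<omega> + 2 * psd_moment S 1 \<omega> / psd_moment S 0 \<omega>) (at \<omega>)"
      using psd0_pos[of \<omega>] by (auto intro!: derivative_eq_intros psd_moment_derivatives simp: field_simps)
    then show "deriv (log_smoothed_psd S) \<omega> = - 4 * pi * \<omega> + 2 * psd_moment S 1 \<omega> / psd_moment S 0 \<omega>"
      unfolding e by (rule DERIV_imp_deriv)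
  qed
  show "deriv (deriv (log_smoothed_psd S)) \<omega> = - 4 * pi + (4 * psd_moment S 2 \<omega> * psd_moment S 0 \<omega> - 4 * (psd_moment S 1 \<omega>)\<^sup>2) / (psd_moment S 0 \<omega>)\<^sup>2"
    unfolding 1
  proof (rule DERIV_imp_deriv)
    have "((\<lambda>\<omega>. - 4 * pi * \<omega>) has_field_derivative - 4 * pi) (at \<omega>)" by (auto intro!: derivative_eq_intros)
    moreover have "((\<lambda>\<omega>. 2 * psd_moment S 1 \<omega> / psd_moment S 0 \<omega>) has_field_derivative
       (2 * (2 * psd_moment S 2 \<omega>) * psd_moment S 0 \<omega> - 2 * psd_moment S 1 \<omega> * (2 * psd_moment S 1 \<omega>)) / (psd_moment S 0 \<omega> * psd_moment S 0 \<omega>)) (at \<omega>)"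
      using psd0_pos[of \<omega>] by (intro DERIV_divide DERIV_cmult psd_moment_derivatives) auto
    ultimately have "((\<lambda>\<omega>. - 4 * pi * \<omega> + 2 * psd_moment S 1 \<omega> / psd_moment S 0 \<omega>) has_field_derivative
       - 4 * pi + (2 * (2 * psd_moment S 2 \<omega>) * psd_moment S 0 \<omega> - 2 * psd_moment S 1 \<omega> * (2 * psd_moment S 1 \<omega>)) / (psd_moment S 0 \<omega> * psd_moment S 0 \<omega>)) (at \<omega>)"
      by (rule DERIV_add)
    then show "((\<lambda>\<omega>. - 4 * pi * \<omega> + 2 * psd_moment S 1 \<omega> / psd_moment S 0 \<omega>) has_field_derivative
       - 4 * pi + (4 * psd_moment S 2 \<omega> * psd_moment S 0 \<omega> - 4 * (psd_moment S 1 \<omega>)\<^sup>2) / (psd_moment S 0 \<omega>)\<^sup>2) (at \<omega>)"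
      by (simp add: power2_eq_square)
  qed
qed

text \<open>This is the Kac-Rice form: the density at 0 of signal plus noise, times the mean squared
  modulus of its derivative given that the sum is 0. The conditional mean of the derivative is its
  own signal part corrected by regression on the noise value, and the moment expression is its
  conditional variance.\<close>

lemma rho1_formula:
  assumes f1: "tempered_distribution f1"
  shows "rho1_spec S f1 \<tau> \<omega> =
    exp (- (cmod (bargmann f1 (tf_point \<tau> \<omega>)))\<^sup>2 / psd_moment S 0 \<omega>) / (pi * psd_moment S 0 \<omega>) *
    ((cmod (deriv (bargmann f1) (tf_point \<tau> \<omega>) - \<i> * of_real (psd_moment S 1 \<omega> / psd_moment S 0 \<omega>) * bargmann f1 (tf_point \<tau> \<omega>)))\<^sup>2
      + psd_moment S 2 \<omega> - (psd_moment S 1 \<omega>)\<^sup>2 / psd_moment S 0 \<omega>)"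
proof -
  let ?G = "bargmann f1"
  note G = bargmann_holomorphic[OF f1, of UNIV]
  note dv = cmod_square_line_derivatives[OF G]
  define E where "E \<omega> = exp (- 2 * pi * \<omega>\<^sup>2)" for \<omega> :: real
  have E: "E \<omega> > 0" for \<omega> by (simp add: E_def)
  have dE: "(E has_field_derivative - 4 * pi * \<omega> * E \<omega>) (at \<omega>)" for \<omega>
    unfolding E_def[abs_def] by (auto intro!: derivative_eq_intros)
  define p where "p \<tau> \<omega> = (cmod (?G (tf_point \<tau> \<omega>)))\<^sup>2" for \<tau> \<omega>
  define D where "D \<tau> \<omega> = 2 * Im (deriv ?G (tf_point \<tau> \<omega>) * cnj (?G (tf_point \<tau> \<omega>)))" for \<tau> \<omega>
  define R where "R \<tau> \<omega> = 2 * Re (deriv ?G (tf_point \<tau> \<omega>) * cnj (?G (tf_point \<tau> \<omega>)))" for \<tau> \<omega>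
  define R2 where "R2 = 2 * Re (deriv (deriv ?G) (tf_point \<tau> \<omega>) * cnj (?G (tf_point \<tau> \<omega>)))"
  define g2 where "g2 = (cmod (deriv ?G (tf_point \<tau> \<omega>)))\<^sup>2"
  have sp: "spectrogram f1 = (\<lambda>\<tau> \<omega>. sqrt 2 * (E \<omega> * p \<tau> \<omega>))"
    by (intro ext) (simp add: spectrogram_bargmann[OF f1] E_def p_def)
  have pt: "((\<lambda>x. p x \<omega>) has_field_derivative R \<tau> \<omega>) (at \<tau>)" for \<tau> \<omega>
    unfolding p_def R_def by (rule dv(1))
  have Rt: "((\<lambda>x. R x \<omega>) has_field_derivative R2 + 2 * g2) (at \<tau>)"
    unfolding R_def R2_def g2_def by (rule dv(2))
  have pw: "(p \<tau> has_field_derivative D \<tau> \<omega>) (at \<omega>)" for \<tau> \<omega>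
    unfolding p_def[abs_def] D_def by (rule dv(3))
  have Dw: "(D \<tau> has_field_derivative - R2 + 2 * g2) (at \<omega>)"
    using dv(4)[where \<tau>=\<tau> and \<omega>=\<omega>] unfolding D_def[abs_def] R2_def g2_def by simp
  have "deriv (\<lambda>t. sqrt 2 * (E \<omega> * p t \<omega>)) = (\<lambda>t. sqrt 2 * (E \<omega> * R t \<omega>))"
    by (intro ext DERIV_imp_deriv DERIV_cmult pt)
  then have dt: "deriv (deriv (\<lambda>t. sqrt 2 * (E \<omega> * p t \<omega>))) \<tau> = sqrt 2 * (E \<omega> * (R2 + 2 * g2))"
    by (simp only:) (intro DERIV_imp_deriv DERIV_cmult Rt)
  have dw1: "deriv (\<lambda>w. sqrt 2 * (E w * p \<tau> w)) = (\<lambda>w. sqrt 2 * (- 4 * pi * w * E w * p \<tau> w + D \<tau> w * E w))"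
    by (intro ext DERIV_imp_deriv DERIV_cmult DERIV_mult dE pw)
  have nE: "((\<lambda>w. - 4 * pi * w * E w) has_field_derivative (- 4 * pi) * E \<omega> + (- 4 * pi * \<omega> * E \<omega>) * (- 4 * pi * \<omega>)) (at \<omega>)"
    by (rule DERIV_mult[OF DERIV_cmult_Id dE])
  have "((\<lambda>w. sqrt 2 * (- 4 * pi * w * E w * p \<tau> w + D \<tau> w * E w)) has_field_derivative
     sqrt 2 * ((((- 4 * pi) * E \<omega> + (- 4 * pi * \<omega> * E \<omega>) * (- 4 * pi * \<omega>)) * p \<tau> \<omega> + D \<tau> \<omega> * (- 4 * pi * \<omega> * E \<omega>)) +
       ((- R2 + 2 * g2) * E \<omega> + (- 4 * pi * \<omega> * E \<omega>) * D \<tau> \<omega>))) (at \<omega>)"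
    by (intro DERIV_cmult DERIV_add DERIV_mult[OF nE pw] DERIV_mult[OF Dw dE])
  then have dw2: "deriv (deriv (\<lambda>w. sqrt 2 * (E w * p \<tau> w))) \<omega> = sqrt 2 * ((((- 4 * pi) * E \<omega> + (- 4 * pi * \<omega> * E \<omega>) * (- 4 * pi * \<omega>)) * p \<tau> \<omega> + D \<tau> \<omega> * (- 4 * pi * \<omega> * E \<omega>)) +
       ((- R2 + 2 * g2) * E \<omega> + (- 4 * pi * \<omega> * E \<omega>) * D \<tau> \<omega>))"
    unfolding dw1 by (rule DERIV_imp_deriv)
  have lap: "laplacian (spectrogram f1) \<tau> \<omega> = sqrt 2 * E \<omega> * (4 * g2 - 8 * pi * \<omega> * D \<tau> \<omega> + (16 * pi\<^sup>2 * \<omega>\<^sup>2 - 4 * pi) * p \<tau> \<omega>)"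
    unfolding laplacian_def sp dt dw2 by (simp add: power2_eq_square algebra_simps)
  have dwq: "deriv (\<lambda>w. spectrogram f1 \<tau> w) \<omega> = sqrt 2 * E \<omega> * (D \<tau> \<omega> - 4 * pi * \<omega> * p \<tau> \<omega>)"
    unfolding sp dw1 by (simp add: algebra_simps)
  have sq: "spectrogram f1 \<tau> \<omega> = sqrt 2 * E \<omega> * p \<tau> \<omega>" unfolding sp by simp
  have sm: "smoothed_psd S \<omega> = E \<omega> * psd_moment S 0 \<omega>" unfolding smoothed_psd_moment E_def ..
  have ex: "- (1 / sqrt 2) * (sqrt 2 * E \<omega> * p \<tau> \<omega> / (E \<omega> * psd_moment S 0 \<omega>)) = - p \<tau> \<omega> / psd_moment S 0 \<omega>"
    using E[of \<omega>] by simp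
  have q: "(cmod (deriv ?G (tf_point \<tau> \<omega>) - \<i> * of_real m * ?G (tf_point \<tau> \<omega>)))\<^sup>2 = g2 + m\<^sup>2 * p \<tau> \<omega> - m * D \<tau> \<omega>" for m
    unfolding g2_def p_def D_def cmod_power2 by (simp add: power2_eq_square algebra_simps)
  have "rho1_spec S f1 \<tau> \<omega> = 1 / (pi * psd_moment S 0 \<omega>) * ((g2 + (psd_moment S 1 \<omega> / psd_moment S 0 \<omega>)\<^sup>2 * p \<tau> \<omega> - (psd_moment S 1 \<omega> / psd_moment S 0 \<omega>) * D \<tau> \<omega>) + psd_moment S 2 \<omega> - (psd_moment S 1 \<omega>)\<^sup>2 / psd_moment S 0 \<omega>)
     * exp (- p \<tau> \<omega> / psd_moment S 0 \<omega>)"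
    unfolding rho1_spec_def snr_tilde_def snr_def log_smoothed_psd_derivatives(2)
    unfolding log_smoothed_psd_derivatives(1) lap dwq sq sm ex
    by (simp only: rho1_algebra[OF psd0_pos E])
  then show ?thesis unfolding q p_def by (simp add: mult_ac)
qed

end

section \<open>Conditioning on the noise at one point\<close>

text \<open>In the application \<open>m\<close> and \<open>m'\<close> are the signal and its
  derivative at \<open>z\<close>, \<open>a\<close> and \<open>a'\<close> the regression coefficients
  on the noise at \<open>z0\<close>, \<open>v\<close> and \<open>K\<close> the noise variances at
  \<open>z0\<close> and \<open>z\<close>, \<open>s\<close> the residual variance, \<kappa> the
  covariance of derivative and value at \<open>z\<close>, and \<open>c\<close> the regression of the
  residual derivative on the residual. The assumptions on \<open>K\<close> and \<kappa> are the laws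
  of total variance and covariance; they eliminate everything that refers to
  \<open>z0\<close>.\<close>

lemma conditional_intensity_algebra:
  fixes m m' a a' c \<kappa> :: complex and v s K M2 :: real
  assumes a: "a \<noteq> 0" and v: "v > 0" and s: "s \<ge> 0" and K: "K = (cmod a)\<^sup>2 * v + s"
    and \<kappa>: "c * of_real s = \<kappa> - cnj a * a' * of_real v"
  shows "1 / (pi * ((cmod a)\<^sup>2 * v)) * ((cmod a)\<^sup>2 * v / ((cmod a)\<^sup>2 * v + s) * exp (- (cmod m)\<^sup>2 / ((cmod a)\<^sup>2 * v + s)) *
      ((cmod ((m' - a' / a * m) - (c - a' / a) * m * of_real (s / ((cmod a)\<^sup>2 * v + s))))\<^sup>2
        + (cmod (c - a' / a))\<^sup>2 * ((cmod a)\<^sup>2 * v * s / ((cmod a)\<^sup>2 * v + s)) + (M2 - (cmod a')\<^sup>2 * v - (cmod c)\<^sup>2 * s))) =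
    exp (- (cmod m)\<^sup>2 / K) / (pi * K) * ((cmod (m' - \<kappa> / of_real K * m))\<^sup>2 + M2 - (cmod \<kappa>)\<^sup>2 / K)"
proof -
  define b where "b = a' / a"
  define q where "q = (cmod a)\<^sup>2 * v"
  have q: "q > 0" using a v by (simp add: q_def)
  have K0: "K > 0" "K = q + s" using q s K by (auto simp: q_def)
  have a': "a' = b * a" using a by (simp add: b_def)
  have "cnj a * a' * of_real v = b * (a * cnj a) * of_real v" by (simp add: a')
  also have "\<dots> = b * of_real q" by (simp add: q_def complex_norm_square[symmetric])
  finally have \<kappa>': "\<kappa> = c * of_real s + b * of_real q" using \<kappa> by simp
  have e1: "(cmod a')\<^sup>2 * v = (cmod b)\<^sup>2 * q" by (simp add: a' q_def norm_mult power_mult_distrib)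
  have e2: "(m' - b * m) - (c - b) * m * of_real (s / K) = m' - \<kappa> / of_real K * m"
  proof -
    have "of_real (s / K) = of_real s / (of_real K :: complex)" by simp
    moreover have "(of_real K :: complex) = of_real q + of_real s" using K0 by simp
    moreover have "(of_real K :: complex) \<noteq> 0" using K0(1) by simp
    ultimately show ?thesis unfolding \<kappa>' by (simp add: field_simps)
  qed
  have e3: "(cmod (c - b))\<^sup>2 * (q * s / K) + (M2 - (cmod b)\<^sup>2 * q - (cmod c)\<^sup>2 * s) = M2 - (cmod \<kappa>)\<^sup>2 / K"
    unfolding \<kappa>' cmod_power2 using K0(1) unfolding K0(2) by (simp add: field_simps power2_eq_square)
  show ?thesis
    unfolding q_def[symmetric] b_def[symmetric] K0(2)[symmetric] e1 e2 add.assoc e3 using q K0(1) by (simp add: add_diff_eq)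
qed

context gaussian_noise begin

definition noise :: "'x \<Rightarrow> complex \<Rightarrow> complex" where
  "noise \<xi> z = WF (gam_at z) \<xi>"

lemma noise_holomorphic: "\<xi> \<in> space M \<Longrightarrow> noise \<xi> holomorphic_on A"
  and noise_derivative: "\<xi> \<in> space M \<Longrightarrow> (noise \<xi> has_field_derivative WF (dgam_at z) \<xi>) (at z)"
proof -
  assume \<xi>: "\<xi> \<in> space M"
  have d: "(noise \<xi> has_field_derivative WF (dgam_at z) \<xi>) (at z)" for z
    unfolding noise_def[abs_def] WF_def by (rule gam_at_derivatives(1)[OF tempered_W[OF \<xi>]])
  then show "(noise \<xi> has_field_derivative WF (dgam_at z) \<xi>) (at z)" .
  show "noise \<xi> holomorphic_on A"
    using d has_field_derivative_at_within unfolding holomorphic_on_def field_differentiable_def by blast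
qed

lemma dnoise_continuous: "\<xi> \<in> space M \<Longrightarrow> continuous_on A (\<lambda>z. WF (dgam_at z) \<xi>)"
proof -
  assume \<xi>: "\<xi> \<in> space M"
  have "((\<lambda>z. WF (dgam_at z) \<xi>) has_field_derivative WF (ddgam_at z) \<xi>) (at z)" for z
    unfolding WF_def by (rule gam_at_derivatives(2)[OF tempered_W[OF \<xi>]])
  then show ?thesis by (meson DERIV_isCont continuous_at_imp_continuous_on)
qed

definition var0 :: "complex \<Rightarrow> real" where
  "var0 z = psd_moment S 0 (- Im z)"

lemma var0_pos: "var0 z > 0"
  unfolding var0_def by (rule psd0_pos)

lemma cov_same:
  "cov (gam_at z) (gam_at z) = of_real (var0 z)"
  "cov (dgam_at z) (gam_at z) = \<i> * of_real (psd_moment S 1 (- Im z))"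
  "cov (dgam_at z) (dgam_at z) = of_real (psd_moment S 2 (- Im z))"
proof -
  have e: "z - cnj z = - 2 * \<i> * of_real (- Im z)" by (simp add: complex_eq_iff)
  show "cov (gam_at z) (gam_at z) = of_real (var0 z)"
  "cov (dgam_at z) (gam_at z) = \<i> * of_real (psd_moment S 1 (- Im z))"
  "cov (dgam_at z) (dgam_at z) = of_real (psd_moment S 2 (- Im z))"
    unfolding var0_def by (rule cov_moments[OF e])+
qed

text \<open>The gap between the two sides is the variance of the derivative of the noise after
  subtracting its regression on the value at the same point. It makes the intensity
  nonnegative.\<close>

lemma psd_moment_cauchy_schwarz: "(psd_moment S 1 \<omega>)\<^sup>2 / psd_moment S 0 \<omega> \<le> psd_moment S 2 \<omega>"
proof -
  define z where "z = tf_point 0 \<omega>"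
  have w: "- Im z = \<omega>" by (simp add: z_def tf_point_def)
  note c = cov_same[of z, unfolded w]
  define K where "K = psd_moment S 0 \<omega>"
  have K: "K > 0" unfolding K_def by (rule psd0_pos)
  have v: "var0 z = K" by (simp add: var0_def w K_def)
  define k where "k = \<i> * of_real (psd_moment S 1 \<omega> / K)"
  define F where "F = (\<lambda>s. 1 * dgam_at z s + (- k) * gam_at z s)"
  have F: "strip_decay F" unfolding F_def by (intro strip_decay_lincomb strip_decay_gam_at)
  have 1: "cov F (gam_at z) = 0"
    unfolding F_def cov_lincomb_left[OF strip_decay_gam_at(2,1,1)] c v k_def using K by simp
  have "cov F (dgam_at z) = of_real (psd_moment S 2 \<omega>) - k * cnj (\<i> * of_real (psd_moment S 1 \<omega>))"
    unfolding F_def cov_lincomb_left[OF strip_decay_gam_at(2,1,2)] cov_cnj[of "gam_at z" "dgam_at z"] c by simp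
  moreover have "k * cnj (\<i> * of_real (psd_moment S 1 \<omega>)) = of_real ((psd_moment S 1 \<omega>)\<^sup>2 / K)"
    unfolding k_def by (simp add: complex_eq_iff power2_eq_square)
  ultimately have 2: "cov F (dgam_at z) = of_real (psd_moment S 2 \<omega> - (psd_moment S 1 \<omega>)\<^sup>2 / K)"
    by (simp only: of_real_diff)
  have "cov F F = of_real (psd_moment S 2 \<omega> - (psd_moment S 1 \<omega>)\<^sup>2 / K)"
    unfolding F_def[symmetric] using cov_lincomb_right[OF strip_decay_gam_at(2)[of z] strip_decay_gam_at(1)[of z] F, where a=1 and b="- k"] 1 2
    unfolding F_def[symmetric] by simp
  then have "complex_of_real (psd_moment S 2 \<omega> - (psd_moment S 1 \<omega>)\<^sup>2 / K) = of_real (\<integral>\<xi>. (cmod (WF F \<xi>))\<^sup>2 \<partial>M)"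
    unfolding cov_self by simp
  then have "psd_moment S 2 \<omega> - (psd_moment S 1 \<omega>)\<^sup>2 / K = (\<integral>\<xi>. (cmod (WF F \<xi>))\<^sup>2 \<partial>M)" by (simp only: of_real_eq_iff)
  moreover have "(\<integral>\<xi>. (cmod (WF F \<xi>))\<^sup>2 \<partial>M) \<ge> 0" by simp
  ultimately show ?thesis unfolding K_def by linarith
qed

lemma WF_zero_AE:
  assumes F: "strip_decay F" and c: "Re (cov F F) = 0" shows "AE \<xi> in M. WF F \<xi> = 0"
proof -
  have "(\<integral>\<xi>. (cmod (WF F \<xi>))\<^sup>2 \<partial>M) = 0" using c unfolding cov_self by simp
  then have "AE \<xi> in M. (cmod (WF F \<xi>))\<^sup>2 = 0"
    using integral_nonneg_eq_0_iff_AE[OF WF_square_integrable[OF F]] by auto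
  then show ?thesis by eventually_elim simp
qed

text \<open>The regression coefficients of the noise at \<open>z\<close>, and of its derivative there, on the noise at
  \<open>z0\<close>; \<open>res_test\<close> and \<open>dres_test\<close> below give the residuals, which are independent of the noise
  at \<open>z0\<close>.\<close>

definition coef :: "complex \<Rightarrow> complex \<Rightarrow> complex" where
  "coef z0 z = cov (gam_at z) (gam_at z0) / of_real (var0 z0)"

definition dcoef :: "complex \<Rightarrow> complex \<Rightarrow> complex" where
  "dcoef z0 z = cov (dgam_at z) (gam_at z0) / of_real (var0 z0)"

lemma coef_self: "coef z0 z0 = 1"
  unfolding coef_def cov_same using var0_pos[of z0] by simp

lemma coef_derivative: "(coef z0 has_field_derivative dcoef z0 z) (at z)"
  and dcoef_continuous: "continuous_on A (dcoef z0)"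
proof -
  show "(coef z0 has_field_derivative dcoef z0 z) (at z)"
    unfolding coef_def[abs_def] dcoef_def
    by (rule DERIV_cdivide[OF cov_gam_derivatives(1)[OF strip_decay_gam_at(1)]])
  have "(dcoef z0 has_field_derivative cov (ddgam_at z) (gam_at z0) / of_real (var0 z0)) (at z)" for z
    unfolding dcoef_def[abs_def]
    by (rule DERIV_cdivide[OF cov_gam_derivatives(2)[OF strip_decay_gam_at(1)]])
  then show "continuous_on A (dcoef z0)" by (meson DERIV_isCont continuous_at_imp_continuous_on)
qed

lemma coef_holomorphic: "coef z0 holomorphic_on A"
  using coef_derivative[of z0] has_field_derivative_at_within unfolding holomorphic_on_def field_differentiable_def by blast

definition res_test :: "complex \<Rightarrow> complex \<Rightarrow> complex \<Rightarrow> complex" where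
  "res_test z0 z = (\<lambda>s. 1 * gam_at z s + (- coef z0 z) * gam_at z0 s)"

definition dres_test :: "complex \<Rightarrow> complex \<Rightarrow> complex \<Rightarrow> complex" where
  "dres_test z0 z = (\<lambda>s. 1 * dgam_at z s + (- dcoef z0 z) * gam_at z0 s)"

lemma strip_decay_res_test [intro, simp]: "strip_decay (res_test z0 z)" "strip_decay (dres_test z0 z)"
  unfolding res_test_def dres_test_def by (intro strip_decay_lincomb strip_decay_gam_at)+

lemma WF_res_test:
  assumes "\<xi> \<in> space M"
  shows "WF (res_test z0 z) \<xi> = noise \<xi> z - coef z0 z * noise \<xi> z0"
    and "WF (dres_test z0 z) \<xi> = WF (dgam_at z) \<xi> - dcoef z0 z * noise \<xi> z0"
  unfolding res_test_def dres_test_def noise_def WF_lincomb[OF strip_decay_gam_at(1,1) assms] WF_lincomb[OF strip_decay_gam_at(2,1) assms]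
  by simp_all

lemma cov_res_test_center: "cov (res_test z0 z) (gam_at z0) = 0" "cov (dres_test z0 z) (gam_at z0) = 0"
  unfolding res_test_def dres_test_def cov_lincomb_left[OF strip_decay_gam_at(1,1,1)] cov_lincomb_left[OF strip_decay_gam_at(2,1,1)]
    cov_same coef_def dcoef_def using var0_pos[of z0] by simp_all

text \<open>Residuals are orthogonal to \<open>gam_at z0\<close>. So one residual in each pair may
  be replaced by the unprojected test function, and only the other has to be expanded.\<close>

lemma cov_res_tests:
  "cov (res_test z0 z) (res_test z0 z) = of_real (var0 z - (cmod (coef z0 z))\<^sup>2 * var0 z0)"
  "cov (dres_test z0 z) (res_test z0 z) = cov (dgam_at z) (gam_at z) - cnj (coef z0 z) * dcoef z0 z * of_real (var0 z0)"
  "cov (dres_test z0 z) (dres_test z0 z) = of_real (psd_moment S 2 (- Im z) - (cmod (dcoef z0 z))\<^sup>2 * var0 z0)"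
proof -
  let ?v = "complex_of_real (var0 z0)"
  have v: "?v \<noteq> 0" using var0_pos[of z0] by simp
  have g: "cov (gam_at z) (gam_at z0) = coef z0 z * ?v" "cov (dgam_at z) (gam_at z0) = dcoef z0 z * ?v"
    using v by (simp_all add: coef_def dcoef_def)
  have c0: "cov (gam_at z0) (res_test z0 z) = 0" "cov (gam_at z0) (dres_test z0 z) = 0"
    using cov_cnj[of "gam_at z0"] cov_res_test_center by simp_all
  have l: "cov (res_test z0 z) F = cov (gam_at z) F - coef z0 z * cov (gam_at z0) F"
    "cov (dres_test z0 z) F = cov (dgam_at z) F - dcoef z0 z * cov (gam_at z0) F" if "strip_decay F" for F
    using cov_lincomb_left[OF strip_decay_gam_at(1,1) that, of 1 z "- coef z0 z" z0]
      cov_lincomb_left[OF strip_decay_gam_at(2,1) that, of 1 z "- dcoef z0 z" z0]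
    unfolding res_test_def[symmetric] dres_test_def[symmetric] by simp_all
  have r: "cov F (res_test z0 z) = cov F (gam_at z) - cnj (coef z0 z) * cov F (gam_at z0)"
    "cov F (dres_test z0 z) = cov F (dgam_at z) - cnj (dcoef z0 z) * cov F (gam_at z0)" if "strip_decay F" for F
    using cov_lincomb_right[OF strip_decay_gam_at(1)[of z] strip_decay_gam_at(1)[of z0] that, where a=1 and b="- coef z0 z"]
      cov_lincomb_right[OF strip_decay_gam_at(2)[of z] strip_decay_gam_at(1)[of z0] that, where a=1 and b="- dcoef z0 z"]
    unfolding res_test_def[symmetric] dres_test_def[symmetric] by simp_all
  have n: "cnj x * (x * ?v) = of_real ((cmod x)\<^sup>2 * var0 z0)" for x
  proof -
    have "cnj x * (x * ?v) = (x * cnj x) * ?v" by simp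
    then show ?thesis by (simp add: complex_norm_square[symmetric])
  qed
  show "cov (res_test z0 z) (res_test z0 z) = of_real (var0 z - (cmod (coef z0 z))\<^sup>2 * var0 z0)"
    unfolding l(1)[OF strip_decay_res_test(1)] c0 unfolding r(1)[OF strip_decay_gam_at(1)] g n cov_same by simp
  show "cov (dres_test z0 z) (res_test z0 z) = cov (dgam_at z) (gam_at z) - cnj (coef z0 z) * dcoef z0 z * ?v"
    unfolding l(2)[OF strip_decay_res_test(1)] c0 unfolding r(1)[OF strip_decay_gam_at(2)] g by simp
  show "cov (dres_test z0 z) (dres_test z0 z) = of_real (psd_moment S 2 (- Im z) - (cmod (dcoef z0 z))\<^sup>2 * var0 z0)"
    unfolding l(2)[OF strip_decay_res_test(2)] c0 unfolding r(2)[OF strip_decay_gam_at(2)] g n cov_same by simp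
qed

text \<open>The intensity of the zeros of \<open>G\<close> plus noise in the coordinate \<open>z = \<tau> - \<i> \<omega>\<close>.\<close>

definition intensity :: "(complex \<Rightarrow> complex) \<Rightarrow> complex \<Rightarrow> real" where
  "intensity G z = exp (- (cmod (G z))\<^sup>2 / var0 z) / (pi * var0 z) *
    ((cmod (deriv G z - cov (dgam_at z) (gam_at z) / of_real (var0 z) * G z))\<^sup>2
      + psd_moment S 2 (- Im z) - (cmod (cov (dgam_at z) (gam_at z)))\<^sup>2 / var0 z)"

text \<open>This is \<open>p (h z) * (cmod (deriv h z))\<^sup>2\<close>, where \<open>h\<close> is minus the quotient of \<open>G\<close> plus the
  residual noise by \<open>coef z0\<close> and \<open>p\<close> is the density of the noise at \<open>z0\<close>.\<close>

definition cond_integrand :: "(complex \<Rightarrow> complex) \<Rightarrow> complex \<Rightarrow> complex \<Rightarrow> 'x \<Rightarrow> ennreal" where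
  "cond_integrand G z0 z \<xi> =
    ennreal (complex_normal_density 0 (var0 z0) (- ((G z + WF (res_test z0 z) \<xi>) / coef z0 z))) *
    ennreal ((cmod ((deriv G z + WF (dres_test z0 z) \<xi> - dcoef z0 z / coef z0 z * (G z + WF (res_test z0 z) \<xi>)) / coef z0 z))\<^sup>2)"

text \<open>The residual derivative \<open>D\<close> equals \<open>c\<close> times the residual
  \<open>F\<close> plus a part \<open>Q\<close> uncorrelated with \<open>F\<close>. The integrand is
  then a Gaussian weight in \<open>F\<close> times the square of an affine function of
  \<open>F\<close> plus an independent summand. Division by \<open>coef z0 z\<close> inside the
  density of variance \<open>v\<close> changes the width of that weight to \<open>q\<close>.\<close>

lemma nn_integral_cond_integrand:
  assumes a: "coef z0 z \<noteq> 0"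
  shows "(\<integral>\<^sup>+\<xi>. cond_integrand G z0 z \<xi> \<partial>M) = ennreal (intensity G z)"
proof -
  define a' where "a' = dcoef z0 z"
  define b where "b = coef z0 z"
  define v where "v = var0 z0"
  define q where "q = (cmod b)\<^sup>2 * v"
  define m where "m = G z"
  define m' where "m' = deriv G z"
  define U where "U = WF (res_test z0 z)"
  define s where "s = var0 z - q"
  define F where "F = res_test z0 z"
  define D where "D = dres_test z0 z"
  \<comment> \<open>When \<open>s = 0\<close> the residual vanishes almost surely, hence
    \<open>cov D F = 0\<close> and the coefficient 0 satisfies the regression equation
    \<open>cs\<close>.\<close>
  define c where "c = (if s = 0 then 0 else cov D F / of_real s)"
  define Q where "Q = (\<lambda>t. 1 * D t + (- c) * F t)"
  have F: "strip_decay F" and D: "strip_decay D" by (simp_all add: F_def D_def)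
  have Q: "strip_decay Q" unfolding Q_def by (rule strip_decay_lincomb[OF D F])
  have b: "b \<noteq> 0" and v: "v > 0" and q: "q > 0" using a var0_pos[of z0] by (auto simp: b_def v_def q_def)
  have cFF: "cov F F = of_real s" unfolding F_def s_def q_def b_def v_def by (rule cov_res_tests)
  have cDF: "cov D F = cov (dgam_at z) (gam_at z) - cnj b * a' * of_real v" unfolding D_def F_def b_def a'_def v_def by (rule cov_res_tests)
  have cDD: "cov D D = of_real (psd_moment S 2 (- Im z) - (cmod a')\<^sup>2 * v)" unfolding D_def a'_def v_def by (rule cov_res_tests)
  have "complex_of_real s = of_real (\<integral>\<xi>. (cmod (WF F \<xi>))\<^sup>2 \<partial>M)" using cFF unfolding cov_self by simp
  then have "s = (\<integral>\<xi>. (cmod (WF F \<xi>))\<^sup>2 \<partial>M)" by (simp only: of_real_eq_iff)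
  then have s: "s \<ge> 0" by simp
  have s0: "AE \<xi> in M. WF F \<xi> = 0" if "s = 0"
    by (rule WF_zero_AE[OF F]) (simp add: cFF that)
  have cs: "cov D F = c * of_real s"
  proof (cases "s = 0")
    case True
    have [measurable]: "WF F \<in> borel_measurable M" "WF D \<in> borel_measurable M" by (intro WF_measurable F D)+
    have "cov D F = (\<integral>\<xi>. 0 \<partial>M)" unfolding cov_def
      by (rule integral_cong_AE) (use s0[OF True] in \<open>auto\<close>)
    then show ?thesis using True by simp
  qed (simp add: c_def)
  have QF: "cov Q F = 0" unfolding Q_def cov_lincomb_left[OF D F F] cFF cs by simp
  have "cov Q Q = cov Q D" using cov_lincomb_right[OF D F Q, of 1 "- c"] QF unfolding Q_def[symmetric] by simp
  also have "\<dots> = cov D D - c * cnj (cov D F)"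
    unfolding Q_def cov_lincomb_left[OF D F D] cov_cnj[of F D] by simp
  also have "\<dots> = of_real (psd_moment S 2 (- Im z) - (cmod a')\<^sup>2 * v - (cmod c)\<^sup>2 * s)"
  proof -
    have "c * cnj (c * of_real s) = of_real ((cmod c)\<^sup>2 * s)" unfolding of_real_mult complex_norm_square by simp
    then show ?thesis unfolding cDD cs by (simp only: of_real_diff)
  qed
  finally have "complex_of_real (\<integral>\<xi>. (cmod (WF Q \<xi>))\<^sup>2 \<partial>M) = of_real (psd_moment S 2 (- Im z) - (cmod a')\<^sup>2 * v - (cmod c)\<^sup>2 * s)"
    unfolding cov_self .
  then have QQ: "(\<integral>\<xi>. (cmod (WF Q \<xi>))\<^sup>2 \<partial>M) = psd_moment S 2 (- Im z) - (cmod a')\<^sup>2 * v - (cmod c)\<^sup>2 * s"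
    by (simp only: of_real_eq_iff)
  have sm: "WF (\<lambda>t. k * K t + 0 * K t) \<xi> = k * WF K \<xi>" if "strip_decay K" "\<xi> \<in> space M" for k K \<xi>
    using WF_lincomb[OF that(1,1,2), of k 0] by simp
  have tilt: "(\<integral>\<^sup>+\<xi>. ennreal (exp (- (cmod (m + WF F \<xi>))\<^sup>2 / q)) * ennreal ((cmod ((m' - a' / b * m) + (c - a' / b) * WF F \<xi> + WF Q \<xi>))\<^sup>2) \<partial>M) =
    ennreal (q / (q + s) * exp (- (cmod m)\<^sup>2 / (q + s)) *
      ((cmod ((m' - a' / b * m) - (c - a' / b) * m * of_real (s / (q + s))))\<^sup>2 + (cmod (c - a' / b))\<^sup>2 * (q * s / (q + s)) + (\<integral>\<xi>. (cmod (WF Q \<xi>))\<^sup>2 \<partial>M)))"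
  proof (rule gaussian_tilt_independent[OF _ s s0 q WF_measurable[OF Q] WF_mean[OF Q] WF_square_integrable[OF Q]])
    show "complex_gaussian M (WF F) s" using WF_gaussian[OF F] unfolding cFF by simp
    fix k d
    have k: "strip_decay (\<lambda>t. k * Q t + 0 * Q t)" "strip_decay (\<lambda>t. d * F t + 0 * F t)"
      by (intro strip_decay_lincomb Q F)+
    have "cov (\<lambda>t. k * Q t + 0 * Q t) (\<lambda>t. d * F t + 0 * F t) = 0"
      unfolding cov_lincomb_left[OF Q Q k(2)] cov_lincomb_right[OF F F Q] QF by simp
    from uncorrelated_factor[OF k this]
    show "(\<integral>\<xi>. iexp (Re (k * WF Q \<xi>)) * iexp (Re (d * WF F \<xi>)) \<partial>M) = (\<integral>\<xi>. iexp (Re (k * WF Q \<xi>)) \<partial>M) * (\<integral>\<xi>. iexp (Re (d * WF F \<xi>)) \<partial>M)"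
      using sm[OF Q] sm[OF F] by (simp cong: Bochner_Integration.integral_cong)
  qed
  have pw: "cond_integrand G z0 z \<xi> = ennreal (1 / (pi * q)) * (ennreal (exp (- (cmod (m + WF F \<xi>))\<^sup>2 / q)) * ennreal ((cmod ((m' - a' / b * m) + (c - a' / b) * WF F \<xi> + WF Q \<xi>))\<^sup>2))" if \<xi>: "\<xi> \<in> space M" for \<xi>
  proof -
    have "WF Q \<xi> = WF D \<xi> - c * WF F \<xi>" unfolding Q_def using WF_lincomb[OF D F \<xi>, of 1 "- c"] by simp
    then have 1: "(m' - a' / b * m) + (c - a' / b) * WF F \<xi> + WF Q \<xi> = m' + WF D \<xi> - a' / b * (m + WF F \<xi>)"
      by (simp add: algebra_simps)
    have 2: "(cmod (x / b))\<^sup>2 = (cmod x)\<^sup>2 / (cmod b)\<^sup>2" for x by (simp add: norm_divide power_divide)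
    have 3: "complex_normal_density 0 v (- (x / b)) = exp (- (cmod x)\<^sup>2 / q) / (pi * v)" for x
      unfolding complex_normal_density_def by (simp add: 2 q_def)
    have 4: "ennreal (x / (pi * v)) * ennreal (y / (cmod b)\<^sup>2) = ennreal (1 / (pi * q)) * (ennreal x * ennreal y)" if "x \<ge> 0" "y \<ge> 0" for x y
      using that v q b by (simp add: ennreal_mult'[symmetric] q_def field_simps)
    show ?thesis unfolding 1 cond_integrand_def
      unfolding F_def[symmetric] D_def[symmetric] b_def[symmetric] a'_def[symmetric] m_def[symmetric] m'_def[symmetric] v_def[symmetric] 2 3
      by (rule 4) simp_all
  qed
  have [measurable]: "WF F \<in> borel_measurable M" "WF Q \<in> borel_measurable M" by (intro WF_measurable F Q)+
  have "(\<integral>\<^sup>+\<xi>. cond_integrand G z0 z \<xi> \<partial>M) = (\<integral>\<^sup>+\<xi>. ennreal (1 / (pi * q)) * (ennreal (exp (- (cmod (m + WF F \<xi>))\<^sup>2 / q)) * ennreal ((cmod ((m' - a' / b * m) + (c - a' / b) * WF F \<xi> + WF Q \<xi>))\<^sup>2)) \<partial>M)"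
    by (rule nn_integral_cong) (rule pw)
  also have "\<dots> = ennreal (1 / (pi * q)) * (\<integral>\<^sup>+\<xi>. (ennreal (exp (- (cmod (m + WF F \<xi>))\<^sup>2 / q)) * ennreal ((cmod ((m' - a' / b * m) + (c - a' / b) * WF F \<xi> + WF Q \<xi>))\<^sup>2)) \<partial>M)"
    by (rule nn_integral_cmult) measurable
  also have "\<dots> = ennreal (1 / (pi * q) * (q / (q + s) * exp (- (cmod m)\<^sup>2 / (q + s)) *
      ((cmod ((m' - a' / b * m) - (c - a' / b) * m * of_real (s / (q + s))))\<^sup>2 + (cmod (c - a' / b))\<^sup>2 * (q * s / (q + s)) + (\<integral>\<xi>. (cmod (WF Q \<xi>))\<^sup>2 \<partial>M))))"
    unfolding tilt using q by (intro ennreal_mult'[symmetric]) simp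
  also have "\<dots> = ennreal (intensity G z)"
    unfolding QQ q_def intensity_def m_def[symmetric] m'_def[symmetric]
    by (subst conditional_intensity_algebra[OF b v s _ cs[unfolded cDF, symmetric], where K="var0 z"])
       (simp_all add: s_def q_def)
  finally show ?thesis .
qed

end

section \<open>The expected number of zeros\<close>

context gaussian_noise begin

lemma WF_res_test_continuous: "\<xi> \<in> space M \<Longrightarrow> continuous_on A (\<lambda>z. WF (res_test z0 z) \<xi>)"
  and WF_dres_test_continuous: "\<xi> \<in> space M \<Longrightarrow> continuous_on A (\<lambda>z. WF (dres_test z0 z) \<xi>)"
proof -
  assume \<xi>: "\<xi> \<in> space M"
  show "continuous_on A (\<lambda>z. WF (res_test z0 z) \<xi>)"
    unfolding WF_res_test[OF \<xi>]
    by (intro continuous_intros holomorphic_on_imp_continuous_on[OF noise_holomorphic[OF \<xi>]] holomorphic_on_imp_continuous_on[OF coef_holomorphic])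
  show "continuous_on A (\<lambda>z. WF (dres_test z0 z) \<xi>)"
    unfolding WF_res_test[OF \<xi>]
    by (intro continuous_intros dnoise_continuous[OF \<xi>] dcoef_continuous)
qed

lemma WF_res_test_derivative:
  "\<xi> \<in> space M \<Longrightarrow> ((\<lambda>z. WF (res_test z0 z) \<xi>) has_field_derivative WF (dres_test z0 z) \<xi>) (at z)"
  unfolding WF_res_test by (intro DERIV_diff noise_derivative DERIV_cmult_right coef_derivative)

text \<open>Finite combinations of residuals are again single values of the process, at a test
  function orthogonal to \<open>gam_at z0\<close>. This puts the finite-dimensional independence
  condition within reach of \<open>uncorrelated_factor\<close>.\<close>

lemma res_test_sum:
  assumes "finite J"
  shows "\<exists>F. strip_decay F \<and> (\<forall>\<xi>\<in>space M. WF F \<xi> = (\<Sum>j\<in>J. c j * WF (res_test z0 j) \<xi>)) \<and> cov F (gam_at z0) = 0"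
  using assms
proof (induction J rule: finite_induct)
  case empty
  let ?F = "\<lambda>s. 0 * gam_at z0 s + 0 * gam_at z0 s"
  have "strip_decay ?F" by (intro strip_decay_lincomb strip_decay_gam_at)
  moreover have "cov ?F (gam_at z0) = 0" unfolding cov_lincomb_left[OF strip_decay_gam_at(1,1,1)] by simp
  moreover have "WF ?F \<xi> = 0" if "\<xi> \<in> space M" for \<xi> unfolding WF_lincomb[OF strip_decay_gam_at(1,1) that] by simp
  ultimately show ?case by (intro exI[of _ ?F]) simp
next
  case (insert j J)
  then obtain F where F: "strip_decay F" "\<forall>\<xi>\<in>space M. WF F \<xi> = (\<Sum>j\<in>J. c j * WF (res_test z0 j) \<xi>)" "cov F (gam_at z0) = 0" by blast
  let ?F = "\<lambda>s. c j * res_test z0 j s + 1 * F s"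
  have "strip_decay ?F" by (intro strip_decay_lincomb strip_decay_res_test F)
  moreover have "cov ?F (gam_at z0) = 0"
    unfolding cov_lincomb_left[OF strip_decay_res_test(1) F(1) strip_decay_gam_at(1)] cov_res_test_center F(3) by simp
  moreover have "WF ?F \<xi> = (\<Sum>j\<in>insert j J. c j * WF (res_test z0 j) \<xi>)" if "\<xi> \<in> space M" for \<xi>
    unfolding WF_lincomb[OF strip_decay_res_test(1) F(1) that] using F(2) that insert.hyps by simp
  ultimately show ?case by (intro exI[of _ ?F]) simp
qed

lemma noise_decomposition_independent:
  "distr M (borel \<Otimes>\<^sub>M rv_sigma M (\<lambda>z. WF (res_test z0 z))) (\<lambda>\<xi>. (WF (gam_at z0) \<xi>, \<xi>)) =
   distr M borel (WF (gam_at z0)) \<Otimes>\<^sub>M distr M (rv_sigma M (\<lambda>z. WF (res_test z0 z))) (\<lambda>\<xi>. \<xi>)"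
proof (rule independent_of_rv_sigma)
  fix J :: "complex set" and c d assume "finite J"
  from res_test_sum[OF this, of c z0] obtain F where F: "strip_decay F"
    "\<And>\<xi>. \<xi> \<in> space M \<Longrightarrow> WF F \<xi> = (\<Sum>j\<in>J. c j * WF (res_test z0 j) \<xi>)" "cov F (gam_at z0) = 0" by blast
  let ?D = "\<lambda>s. d * gam_at z0 s + 0 * gam_at z0 s"
  have D: "strip_decay ?D" by (intro strip_decay_lincomb strip_decay_gam_at)
  have DW: "WF ?D \<xi> = d * WF (gam_at z0) \<xi>" if "\<xi> \<in> space M" for \<xi>
    unfolding WF_lincomb[OF strip_decay_gam_at(1,1) that] by simp
  have "cov F ?D = 0" unfolding cov_lincomb_right[OF strip_decay_gam_at(1,1) F(1)] F(3) by simp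
  from uncorrelated_factor[OF F(1) D this]
  show "(\<integral>x. iexp (Re (\<Sum>j\<in>J. c j * WF (res_test z0 j) x)) * iexp (Re (d * WF (gam_at z0) x)) \<partial>M) =
       (\<integral>x. iexp (Re (\<Sum>j\<in>J. c j * WF (res_test z0 j) x)) \<partial>M) * (\<integral>x. iexp (Re (d * WF (gam_at z0) x)) \<partial>M)"
    by (simp only: F(2)[symmetric] DW[symmetric] cong: Bochner_Integration.integral_cong)
qed (simp_all add: WF_measurable)

lemma gam_law:
  "distr M borel (WF (gam_at z)) = density lborel (\<lambda>w. ennreal (complex_normal_density 0 (var0 z) w))"
  using complex_gaussian_distr[OF WF_gaussian[OF strip_decay_gam_at(1)[of z]]] var0_pos[of z] unfolding cov_same by simp

text \<open>With the residual path frozen, the noise value at \<open>z0\<close> is a free variable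
  \<open>w\<close>, and zeros are the solutions of \<open>h z = w\<close>. The area formula with the
  density of \<open>w\<close> then gives an integral over \<Omega>, whose integrand is the one
  computed by the quotient rule.\<close>

lemma conditional_count:
  assumes G: "G holomorphic_on UNIV" and \<Omega>: "\<Omega> \<in> sets borel" "\<And>z. z \<in> \<Omega> \<Longrightarrow> coef z0 z \<noteq> 0"
    and \<xi>: "\<xi> \<in> space M"
    and m[measurable]: "(\<lambda>w. zero_count_nz (\<lambda>z. G z + WF (res_test z0 z) \<xi> + coef z0 z * w) \<Omega>) \<in> borel_measurable borel"
  shows "(\<integral>\<^sup>+w. zero_count_nz (\<lambda>z. G z + WF (res_test z0 z) \<xi> + coef z0 z * w) \<Omega> \<partial>distr M borel (WF (gam_at z0))) =
    (\<integral>\<^sup>+z\<in>\<Omega>. cond_integrand G z0 z \<xi> \<partial>lborel)"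
proof -
  let ?a = "coef z0"
  define H where "H z = G z + WF (res_test z0 z) \<xi>" for z
  define U where "U = {z. ?a z \<noteq> 0}"
  define h where "h z = - (H z / ?a z)" for z
  let ?p = "\<lambda>w. ennreal (complex_normal_density 0 (var0 z0) w)"
  have Gd: "(G has_field_derivative deriv G z) (at z)" for z using holomorphic_derivI[OF G, of z] by simp
  have Hd: "(H has_field_derivative (deriv G z + WF (dres_test z0 z) \<xi>)) (at z)" for z
    unfolding H_def[abs_def] by (intro DERIV_add Gd WF_res_test_derivative \<xi>)
  have hd: "(h has_field_derivative - (((deriv G z + WF (dres_test z0 z) \<xi>) * ?a z - H z * dcoef z0 z) / (?a z * ?a z))) (at z)" if "z \<in> U" for z
    unfolding h_def[abs_def] using that by (intro DERIV_minus DERIV_divide Hd coef_derivative) (simp add: U_def)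
  have U: "open U" unfolding U_def
    by (intro open_Collect_neq holomorphic_on_imp_continuous_on[OF coef_holomorphic] continuous_on_const)
  have hol: "h holomorphic_on U"
    unfolding holomorphic_on_def field_differentiable_def using hd has_field_derivative_at_within by blast
  have \<Omega>U: "\<Omega> \<subseteq> U" using \<Omega>(2) by (auto simp: U_def)
  have "(\<integral>\<^sup>+w. zero_count_nz (\<lambda>z. G z + WF (res_test z0 z) \<xi> + ?a z * w) \<Omega> \<partial>distr M borel (WF (gam_at z0))) =
    (\<integral>\<^sup>+w. ?p w * zero_count_nz (\<lambda>z. G z + WF (res_test z0 z) \<xi> + ?a z * w) \<Omega> \<partial>lborel)"
    unfolding gam_law by (subst nn_integral_density) auto
  also have "\<dots> = (\<integral>\<^sup>+w. ?p w * emeasure (count_space UNIV) {z\<in>\<Omega>. h z = w} \<partial>lborel)"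
  \<comment> \<open>Where the function is identically zero, \<open>zero_count_nz\<close> is not the
    number of solutions. As \<open>coef z0 z0 = 1\<close>, evaluation at \<open>z0\<close> shows
    that this can happen only for the single value \<open>w = - H z0\<close>.\<close>
  proof (rule nn_integral_cong_AE, rule AE_mp[OF AE_lborel_singleton[of "- H z0"]], rule AE_I2, rule impI)
    fix w assume w: "w \<noteq> - H z0"
    have "\<not> (\<forall>z. G z + WF (res_test z0 z) \<xi> + ?a z * w = 0)"
    proof
      assume "\<forall>z. G z + WF (res_test z0 z) \<xi> + ?a z * w = 0"
      then have "H z0 + ?a z0 * w = 0" by (simp add: H_def)
      then show False using w unfolding coef_self by (simp add: add_eq_0_iff)
    qed
    moreover have "{z\<in>\<Omega>. G z + WF (res_test z0 z) \<xi> + ?a z * w = 0} = {z\<in>\<Omega>. h z = w}"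
    proof (rule Collect_cong, rule conj_cong[OF refl])
      fix z assume "z \<in> \<Omega>"
      then have a: "?a z \<noteq> 0" by (rule \<Omega>(2))
      have "h z = w \<longleftrightarrow> - H z = w * ?a z" unfolding h_def using a by (auto simp: field_simps)
      then show "G z + WF (res_test z0 z) \<xi> + ?a z * w = 0 \<longleftrightarrow> h z = w"
        unfolding H_def neg_eq_iff_add_eq_0 by (simp only: mult.commute)
    qed
    ultimately show "?p w * zero_count_nz (\<lambda>z. G z + WF (res_test z0 z) \<xi> + ?a z * w) \<Omega> = ?p w * emeasure (count_space UNIV) {z\<in>\<Omega>. h z = w}"
      by (simp only: zero_count_nz_def zero_count_def if_False)
  qed
  also have "\<dots> = (\<integral>\<^sup>+z\<in>\<Omega>. ?p (h z) * ennreal ((cmod (deriv h z))\<^sup>2) \<partial>lborel)"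
    by (rule area_formula_holomorphic[OF U hol \<Omega>(1) \<Omega>U, symmetric]) measurable
  also have "\<dots> = (\<integral>\<^sup>+z\<in>\<Omega>. cond_integrand G z0 z \<xi> \<partial>lborel)"
  proof (rule nn_integral_cong)
    fix z
    show "?p (h z) * ennreal ((cmod (deriv h z))\<^sup>2) * indicator \<Omega> z = cond_integrand G z0 z \<xi> * indicator \<Omega> z"
    proof (cases "z \<in> \<Omega>")
      case True
      have a: "?a z \<noteq> 0" by (rule \<Omega>(2)[OF True])
      have "- ((A * x - B * y) / (x * x)) = - ((A - y / x * B) / x)" if "x \<noteq> 0" for A B x y :: complex
        using that by (simp add: field_simps)
      then have "deriv h z = - ((deriv G z + WF (dres_test z0 z) \<xi> - dcoef z0 z / ?a z * H z) / ?a z)"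
        using DERIV_imp_deriv[OF hd] True \<Omega>U a by auto
      then show ?thesis unfolding cond_integrand_def h_def H_def by (simp only: norm_minus_cancel)
    qed simp
  qed
  finally show ?thesis .
qed

lemma cond_integrand_measurable:
  assumes G: "G holomorphic_on UNIV"
  shows "(\<lambda>(z, \<xi>). cond_integrand G z0 z \<xi>) \<in> borel_measurable (borel \<Otimes>\<^sub>M M)"
proof -
  have [measurable]: "G \<in> borel_measurable borel" "deriv G \<in> borel_measurable borel"
    "coef z0 \<in> borel_measurable borel" "dcoef z0 \<in> borel_measurable borel"
    using holomorphic_on_imp_continuous_on[OF G] holomorphic_on_imp_continuous_on[OF holomorphic_deriv[OF G open_UNIV]]
      holomorphic_on_imp_continuous_on[OF coef_holomorphic] dcoef_continuous
    by (auto intro!: borel_measurable_continuous_onI)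
  have [measurable]: "(\<lambda>p. WF (res_test z0 (fst p)) (snd p)) \<in> borel_measurable (borel \<Otimes>\<^sub>M M)"
    "(\<lambda>p. WF (dres_test z0 (fst p)) (snd p)) \<in> borel_measurable (borel \<Otimes>\<^sub>M M)"
    using measurable_continuous_parameter[of "\<lambda>\<xi> z. WF (res_test z0 z) \<xi>" M]
      measurable_continuous_parameter[of "\<lambda>\<xi> z. WF (dres_test z0 z) \<xi>" M]
    by (simp_all add: WF_measurable WF_res_test_continuous WF_dres_test_continuous case_prod_beta)
  show ?thesis unfolding cond_integrand_def case_prod_beta by measurable
qed

text \<open>Independence turns the expectation into an iterated integral over the value at
  \<open>z0\<close> and the residual path. The inner integral is the area formula; Fubini then moves
  the path integral inside, where at fixed \<open>z\<close> it is Gaussian. Measurability of the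
  intensity is that of this inner integral.\<close>

lemma local_count:
  assumes G: "G holomorphic_on UNIV" and \<Omega>[measurable]: "\<Omega> \<in> sets borel" and a: "\<And>z. z \<in> \<Omega> \<Longrightarrow> coef z0 z \<noteq> 0"
  shows "(\<integral>\<^sup>+\<xi>. zero_count_nz (\<lambda>z. G z + noise \<xi> z) \<Omega> \<partial>M) = (\<integral>\<^sup>+z\<in>\<Omega>. ennreal (intensity G z) \<partial>lborel)"
    and "(\<lambda>z. ennreal (intensity G z) * indicator \<Omega> z) \<in> borel_measurable borel"
proof -
  let ?H = "\<lambda>z. WF (res_test z0 z)"
  let ?\<zeta> = "WF (gam_at z0)"
  define N where "N = rv_sigma M ?H"
  define \<Psi> where "\<Psi> p = zero_count_nz (\<lambda>z. G z + ?H z (snd p) + coef z0 z * fst p) \<Omega>" for p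
  have Hm: "?H z \<in> borel_measurable M" for z by (simp add: WF_measurable)
  have \<zeta>m[measurable]: "?\<zeta> \<in> borel_measurable M" by (simp add: WF_measurable)
  have HN[measurable]: "?H z \<in> borel_measurable N" for z unfolding N_def by (rule measurable_rv_sigma)
  have idm[measurable]: "(\<lambda>\<xi>. \<xi>) \<in> measurable M N"
    using sets_rv_sigma_subset[of ?H, OF Hm] by (auto intro!: measurableI simp: N_def)
  interpret E: measurable_entire "borel \<Otimes>\<^sub>M N" "\<lambda>p z. G z + ?H z (snd p) + coef z0 z * fst p"
  proof
    show "(\<lambda>p. G z + ?H z (snd p) + coef z0 z * fst p) \<in> borel_measurable (borel \<Otimes>\<^sub>M N)" for z by measurable
    fix p :: "complex \<times> 'x" assume "p \<in> space (borel \<Otimes>\<^sub>M N)"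
    then have \<xi>: "snd p \<in> space M" by (auto simp: space_pair_measure N_def)
    show "(\<lambda>z. G z + ?H z (snd p) + coef z0 z * fst p) holomorphic_on UNIV"
      unfolding WF_res_test[OF \<xi>]
      by (intro holomorphic_intros G noise_holomorphic[OF \<xi>] coef_holomorphic)
  qed
  have \<Psi>m[measurable]: "\<Psi> \<in> borel_measurable (borel \<Otimes>\<^sub>M N)"
    unfolding \<Psi>_def[abs_def] by (rule E.zero_count_nz_measurable[OF \<Omega>])
  interpret Nd: prob_space "distr M N (\<lambda>x. x)" by (rule prob_space_distr) measurable
  interpret Zd: prob_space "distr M borel ?\<zeta>" by (rule prob_space_distr) measurable
  interpret P: pair_sigma_finite "distr M borel ?\<zeta>" "distr M N (\<lambda>x. x)" ..
  interpret Q: pair_sigma_finite lborel M ..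
  have "(\<integral>\<^sup>+\<xi>. zero_count_nz (\<lambda>z. G z + noise \<xi> z) \<Omega> \<partial>M) = (\<integral>\<^sup>+\<xi>. \<Psi> (?\<zeta> \<xi>, \<xi>) \<partial>M)"
    by (rule nn_integral_cong) (simp add: \<Psi>_def WF_res_test, simp add: noise_def)
  also have "\<dots> = (\<integral>\<^sup>+p. \<Psi> p \<partial>distr M (borel \<Otimes>\<^sub>M N) (\<lambda>\<xi>. (?\<zeta> \<xi>, \<xi>)))"
    by (rule nn_integral_distr[symmetric]) measurable
  also have "\<dots> = (\<integral>\<^sup>+p. \<Psi> p \<partial>(distr M borel ?\<zeta> \<Otimes>\<^sub>M distr M N (\<lambda>x. x)))"
    unfolding N_def noise_decomposition_independent ..
  also have "\<dots> = (\<integral>\<^sup>+\<xi>. \<integral>\<^sup>+w. \<Psi> (w, \<xi>) \<partial>distr M borel ?\<zeta> \<partial>distr M N (\<lambda>x. x))"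
    by (rule P.nn_integral_snd[symmetric]) (simp add: measurable_cong_sets[OF sets_pair_measure_cong[OF sets_distr sets_distr] refl])
  also have "\<dots> = (\<integral>\<^sup>+\<xi>. \<integral>\<^sup>+w. \<Psi> (w, \<xi>) \<partial>distr M borel ?\<zeta> \<partial>M)"
    by (rule nn_integral_distr) measurable
  also have "\<dots> = (\<integral>\<^sup>+\<xi>. \<integral>\<^sup>+z. cond_integrand G z0 z \<xi> * indicator \<Omega> z \<partial>lborel \<partial>M)"
  proof (rule nn_integral_cong)
    fix \<xi> assume \<xi>: "\<xi> \<in> space M"
    have "(\<lambda>w. \<Psi> (w, \<xi>)) \<in> borel_measurable borel"
      using \<xi> by (intro measurable_compose[OF _ \<Psi>m]) (auto simp: N_def)
    then show "(\<integral>\<^sup>+w. \<Psi> (w, \<xi>) \<partial>distr M borel ?\<zeta>) = (\<integral>\<^sup>+z. cond_integrand G z0 z \<xi> * indicator \<Omega> z \<partial>lborel)"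
      unfolding \<Psi>_def fst_conv snd_conv by (intro conditional_count[OF G \<Omega> a \<xi>])
  qed
  also have "\<dots> = (\<integral>\<^sup>+z. \<integral>\<^sup>+\<xi>. cond_integrand G z0 z \<xi> * indicator \<Omega> z \<partial>M \<partial>lborel)"
    using cond_integrand_measurable[OF G, of z0] by (intro Q.Fubini') (simp add: case_prod_beta measurable_cong_sets[OF sets_pair_measure_cong[OF sets_lborel refl] refl])
  also have eq: "(\<lambda>z. \<integral>\<^sup>+\<xi>. cond_integrand G z0 z \<xi> * indicator \<Omega> z \<partial>M) = (\<lambda>z. ennreal (intensity G z) * indicator \<Omega> z)"
  proof
    fix z
    show "(\<integral>\<^sup>+\<xi>. cond_integrand G z0 z \<xi> * indicator \<Omega> z \<partial>M) = ennreal (intensity G z) * indicator \<Omega> z"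
      using nn_integral_cond_integrand[OF a, of z G] by (cases "z \<in> \<Omega>") simp_all
  qed
  finally show "(\<integral>\<^sup>+\<xi>. zero_count_nz (\<lambda>z. G z + noise \<xi> z) \<Omega> \<partial>M) = (\<integral>\<^sup>+z\<in>\<Omega>. ennreal (intensity G z) \<partial>lborel)" .
  have "(\<lambda>(z, \<xi>). cond_integrand G z0 z \<xi> * indicator \<Omega> z) \<in> borel_measurable (borel \<Otimes>\<^sub>M M)"
    using cond_integrand_measurable[OF G, of z0] by (simp add: case_prod_beta)
  then have "(\<lambda>z. \<integral>\<^sup>+\<xi>. cond_integrand G z0 z \<xi> * indicator \<Omega> z \<partial>M) \<in> borel_measurable borel"
    by (rule borel_measurable_nn_integral)
  then show "(\<lambda>z. ennreal (intensity G z) * indicator \<Omega> z) \<in> borel_measurable borel" unfolding eq .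
qed

lemma zero_count_field_measurable:
  assumes G: "G holomorphic_on UNIV" and \<Omega>: "\<Omega> \<in> sets borel"
  shows "(\<lambda>\<xi>. zero_count_nz (\<lambda>z. G z + noise \<xi> z) \<Omega>) \<in> borel_measurable M"
proof -
  interpret E: measurable_entire M "\<lambda>\<xi> z. G z + noise \<xi> z"
  proof
    have [measurable]: "(\<lambda>\<xi>. noise \<xi> z) \<in> borel_measurable M" for z
      unfolding noise_def by (simp add: WF_measurable)
    show "(\<lambda>\<xi>. G z + noise \<xi> z) \<in> borel_measurable M" for z by measurable
    show "(\<lambda>z. G z + noise \<xi> z) holomorphic_on UNIV" if "\<xi> \<in> space M" for \<xi>
      by (intro holomorphic_intros G noise_holomorphic that)
  qed
  show ?thesis by (rule E.zero_count_nz_measurable[OF \<Omega>])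
qed

text \<open>The set where \<open>coef z0\<close> is nonzero is open and contains \<open>z0\<close>,
  so these sets cover the plane and Lindelof extracts a countable cover. Its disjoint pieces may use
  different \<open>z0\<close>, since the intensity does not involve \<open>z0\<close>.\<close>

theorem expected_zero_count:
  assumes G: "G holomorphic_on UNIV" and \<Omega>: "\<Omega> \<in> sets borel"
  shows "(\<integral>\<^sup>+\<xi>. zero_count_nz (\<lambda>z. G z + noise \<xi> z) \<Omega> \<partial>M) = (\<integral>\<^sup>+z\<in>\<Omega>. ennreal (intensity G z) \<partial>lborel)"
    and "(\<lambda>z. ennreal (intensity G z) * indicator \<Omega> z) \<in> borel_measurable borel"
proof -
  define U where "U z0 = {z. coef z0 z \<noteq> 0}" for z0
  have Uo: "open (U z0)" for z0 unfolding U_def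
    by (intro open_Collect_neq holomorphic_on_imp_continuous_on[OF coef_holomorphic] continuous_on_const)
  obtain \<F> where \<F>: "\<F> \<subseteq> range U" "countable \<F>" "\<Union>\<F> = \<Union>(range U)"
    using Lindelof[of "range U"] Uo by blast
  have cov: "\<Union>(range U) = UNIV" using coef_self by (auto simp: U_def intro!: exI)
  then have ne: "\<F> \<noteq> {}" using \<F>(3) by auto
  define E where "E = from_nat_into \<F>"
  have Er: "range E = \<F>" unfolding E_def by (rule range_from_nat_into[OF ne \<F>(2)])
  define D where "D n = \<Omega> \<inter> disjointed E n" for n
  have "\<exists>z0. E n = U z0" for n using Er \<F>(1) by blast
  then obtain z0 where z0: "\<And>n. E n = U (z0 n)" by metis
  have Eb: "range E \<subseteq> sets borel" using z0 Uo by auto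
  have Db: "D n \<in> sets borel" for n
    using sets.range_disjointed_sets[OF Eb] unfolding D_def by (intro sets.Int \<Omega>) auto
  have Dd: "disjoint_family D" using disjoint_family_disjointed[of E] unfolding D_def disjoint_family_on_def by auto
  have DU: "(\<Union>n. D n) = \<Omega>" using UN_disjointed_eq[of E] Er \<F>(3) cov by (auto simp: D_def)
  have Da: "z \<in> D n \<Longrightarrow> coef (z0 n) z \<noteq> 0" for z n
    using disjointed_subset[of E n] z0[of n] by (auto simp: D_def U_def)
  have "(\<integral>\<^sup>+\<xi>. zero_count_nz (\<lambda>z. G z + noise \<xi> z) \<Omega> \<partial>M) = (\<integral>\<^sup>+\<xi>. (\<Sum>n. zero_count_nz (\<lambda>z. G z + noise \<xi> z) (D n)) \<partial>M)"
    unfolding zero_count_nz_disjoint_UN[OF Dd, symmetric] DU ..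
  also have "\<dots> = (\<Sum>n. \<integral>\<^sup>+\<xi>. zero_count_nz (\<lambda>z. G z + noise \<xi> z) (D n) \<partial>M)"
    by (rule nn_integral_suminf) (rule zero_count_field_measurable[OF G Db])
  also have "\<dots> = (\<Sum>n. \<integral>\<^sup>+z\<in>D n. ennreal (intensity G z) \<partial>lborel)"
    by (rule suminf_cong) (rule local_count(1)[OF G Db Da])
  also have "\<dots> = (\<integral>\<^sup>+z. (\<Sum>n. ennreal (intensity G z) * indicator (D n) z) \<partial>lborel)"
    using local_count(2)[OF G Db Da] by (intro nn_integral_suminf[symmetric]) simp
  also have "\<dots> = (\<integral>\<^sup>+z\<in>\<Omega>. ennreal (intensity G z) \<partial>lborel)"
    unfolding ennreal_suminf_cmult suminf_indicator[OF Dd] DU ..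
  finally show "(\<integral>\<^sup>+\<xi>. zero_count_nz (\<lambda>z. G z + noise \<xi> z) \<Omega> \<partial>M) = (\<integral>\<^sup>+z\<in>\<Omega>. ennreal (intensity G z) \<partial>lborel)" .
  have "(\<lambda>z. ennreal (intensity G z) * indicator \<Omega> z) = (\<lambda>z. \<Sum>n. ennreal (intensity G z) * indicator (D n) z)"
    unfolding ennreal_suminf_cmult suminf_indicator[OF Dd] DU ..
  also have "\<dots> \<in> borel_measurable borel"
    by (rule borel_measurable_suminf_order[OF local_count(2)[OF G Db Da]])
  finally show "(\<lambda>z. ennreal (intensity G z) * indicator \<Omega> z) \<in> borel_measurable borel" .
qed

text \<open>One point decides: the noise at 0 has a density and so almost surely avoids
  \<open>- G 0\<close>. Hence \<open>zero_count_nz\<close> is almost surely the true count.\<close>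

lemma field_not_identically_zero: "AE \<xi> in M. \<not> (\<forall>z. G z + noise \<xi> z = 0)"
proof -
  have [measurable]: "WF (gam_at 0) \<in> borel_measurable M" by (simp add: WF_measurable)
  have "AE w in distr M borel (WF (gam_at 0)). w \<noteq> - G 0"
    unfolding gam_law by (subst AE_density) (auto intro: AE_mp[OF AE_lborel_singleton[of "- G 0"]])
  then have "AE \<xi> in M. WF (gam_at 0) \<xi> \<noteq> - G 0"
    by (subst (asm) AE_distr_iff) auto
  then show ?thesis
  proof eventually_elim
    case (elim \<xi>)
    then have "G 0 + noise \<xi> 0 \<noteq> 0" by (simp add: noise_def add_eq_0_iff)
    then show ?case by blast
  qed
qed

lemma intensity_eq_rho1:
  assumes f1: "tempered_distribution f1"
  shows "intensity (bargmann f1) (tf_point \<tau> \<omega>) = rho1_spec S f1 \<tau> \<omega>"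
proof -
  have w: "- Im (tf_point \<tau> \<omega>) = \<omega>" by (simp add: tf_point_def)
  have k: "cov (dgam_at (tf_point \<tau> \<omega>)) (gam_at (tf_point \<tau> \<omega>)) = \<i> * of_real (psd_moment S 1 \<omega>)"
    unfolding cov_same w ..
  have "(cmod (\<i> * of_real (psd_moment S 1 \<omega>)))\<^sup>2 = (psd_moment S 1 \<omega>)\<^sup>2" by (simp add: norm_mult)
  then show ?thesis unfolding intensity_def rho1_formula[OF f1] var0_def w k by simp
qed

lemma rho1_nonneg:
  assumes f1: "tempered_distribution f1"
  shows "0 \<le> rho1_spec S f1 \<tau> \<omega>"
  unfolding rho1_formula[OF f1] using psd_moment_cauchy_schwarz[of \<omega>] psd0_pos[of \<omega>]
  by (intro mult_nonneg_nonneg divide_nonneg_pos) (auto simp: add_diff_eq[symmetric] intro!: add_nonneg_nonneg)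

end

section \<open>Time-frequency coordinates and almost surely tempered realizations\<close>

lemma lborel_complex_eq_distr_tf: "lborel = distr lborel borel (\<lambda>(\<tau>, \<omega>). tf_point \<tau> \<omega>)"
proof (rule lborel_eqI)
  fix l u :: complex assume lu: "\<And>b. b \<in> Basis \<Longrightarrow> l \<bullet> b \<le> u \<bullet> b"
  have le: "Re l \<le> Re u" "Im l \<le> Im u" using lu[of 1] lu[of \<i>] by (auto simp: Basis_complex_def)
  have m: "(\<lambda>(\<tau>, \<omega>). tf_point \<tau> \<omega>) \<in> borel_measurable (lborel :: (real \<times> real) measure)"
    unfolding tf_point_def lborel_prod[symmetric] by measurable
  have "(\<lambda>(\<tau>, \<omega>). tf_point \<tau> \<omega>) -` box l u \<inter> space (lborel :: (real \<times> real) measure) = {Re l<..<Re u} \<times> {- Im u<..<- Im l}"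
    by (auto simp: in_box_complex_iff tf_point_def)
  then have "emeasure (distr lborel borel (\<lambda>(\<tau>, \<omega>). tf_point \<tau> \<omega>)) (box l u) = emeasure (lborel \<Otimes>\<^sub>M lborel) ({Re l<..<Re u} \<times> {- Im u<..<- Im l})"
    by (subst emeasure_distr[OF m]) (auto simp: lborel_prod)
  also have "\<dots> = ennreal (Re u - Re l) * ennreal (Im u - Im l)"
    using le by (subst lborel.emeasure_pair_measure_Times) auto
  also have "\<dots> = ennreal (prod ((\<bullet>) (u - l)) Basis)"
    using le by (simp add: Basis_complex_def ennreal_mult)
  finally show "emeasure (distr lborel borel (\<lambda>(\<tau>, \<omega>). tf_point \<tau> \<omega>)) (box l u) = ennreal (prod ((\<bullet>) (u - l)) Basis)" .
qed simp

text \<open>The count of the given process is controlled only off a null set, where realizations may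
  fail to be tempered, so its measurability is obtained in the completion.\<close>

lemma measurable_completion_cong_AE:
  assumes g: "g \<in> measurable M N" and ae: "AE x in M. f x = g x" and f: "\<And>x. x \<in> space M \<Longrightarrow> f x \<in> space N"
  shows "f \<in> measurable (completion M) N"
proof (rule measurableI)
  fix A assume A: "A \<in> sets N"
  show "f -` A \<inter> space (completion M) \<in> sets (completion M)"
  proof (rule completion.in_sets_AE)
    show "g -` A \<inter> space M \<in> sets (completion M)" using measurable_sets[OF g A] by simp
    show "AE x in completion M. x \<in> g -` A \<inter> space M \<longleftrightarrow> x \<in> f -` A \<inter> space (completion M)"
      by (rule AE_completion, rule AE_mp[OF ae]) auto
  qed auto
qed (use f in auto)

lemma schwartz_cnj:
  assumes "\<phi> \<in> schwartz" shows "(\<lambda>t. cnj (\<phi> t)) \<in> schwartz"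
proof -
  have d: "nth_vderiv k \<phi> differentiable (at t)" and b: "bounded (range (\<lambda>t. of_real (t ^ j) * nth_vderiv k \<phi> t))" for j k t
    using assms unfolding schwartz_def by blast+
  have vd: "((\<lambda>t. cnj (nth_vderiv k \<phi> t)) has_vector_derivative cnj (nth_vderiv (Suc k) \<phi> t)) (at t)" for k t
  proof -
    have "(nth_vderiv k \<phi> has_vector_derivative nth_vderiv (Suc k) \<phi> t) (at t)"
      using d[of k t] unfolding vector_derivative_works by (simp add: nth_vderiv_def)
    then show ?thesis by (rule has_vector_derivative_cnj)
  qed
  have e: "nth_vderiv k (\<lambda>t. cnj (\<phi> t)) = (\<lambda>t. cnj (nth_vderiv k \<phi> t))" for k
  proof (induction k)
    case (Suc k)
    have "nth_vderiv (Suc k) (\<lambda>t. cnj (\<phi> t)) = (\<lambda>t. vector_derivative (nth_vderiv k (\<lambda>t. cnj (\<phi> t))) (at t))"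
      by (simp add: nth_vderiv_def)
    also have "\<dots> = (\<lambda>t. cnj (nth_vderiv (Suc k) \<phi> t))"
      unfolding Suc by (rule ext) (rule vector_derivative_at[OF vd])
    finally show ?case .
  qed (simp add: nth_vderiv_def)
  show ?thesis
    unfolding schwartz_def mem_Collect_eq e
  proof (intro conjI allI)
    fix k t show "(\<lambda>t. cnj (nth_vderiv k \<phi> t)) differentiable (at t)"
      using vd[of k t] by (auto simp: has_vector_derivative_def differentiable_def)
  next
    fix j k
    obtain B where "\<forall>x\<in>range (\<lambda>t. of_real (t ^ j) * nth_vderiv k \<phi> t). cmod x \<le> B"
      using b[of j k] unfolding bounded_iff by blast
    then show "bounded (range (\<lambda>t. of_real (t ^ j) * cnj (nth_vderiv k \<phi> t)))"
      by (intro boundedI[of _ B]) (auto simp: norm_mult)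
  qed
qed

text \<open>Each clause concerns measurability, a law, an expectation or an almost sure identity.
  With one exceptional set common to all test functions, the last three survive the change, also for
  finite vectors; measurability is supplied by \<open>W'\<close>.\<close>

lemma (in prob_space) stationary_gaussian_process_cong_AE:
  assumes W: "stationary_gaussian_process M S W"
    and ae: "AE \<xi> in M. \<forall>\<phi>. W' \<phi> \<xi> = W \<phi> \<xi>"
    and W': "\<And>\<phi>. \<phi> \<in> schwartz \<Longrightarrow> W' \<phi> \<in> borel_measurable M"
  shows "stationary_gaussian_process M S W'"
proof -
  note p = W[unfolded stationary_gaussian_process_def, THEN conjunct1]
    W[unfolded stationary_gaussian_process_def, THEN conjunct2, THEN conjunct1]
    W[unfolded stationary_gaussian_process_def, THEN conjunct2, THEN conjunct2, THEN conjunct1]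
    W[unfolded stationary_gaussian_process_def, THEN conjunct2, THEN conjunct2, THEN conjunct2, THEN conjunct1]
    W[unfolded stationary_gaussian_process_def, THEN conjunct2, THEN conjunct2, THEN conjunct2, THEN conjunct2]
  have Wm: "\<phi> \<in> schwartz \<Longrightarrow> W \<phi> \<in> borel_measurable M" for \<phi> using p(1) by blast
  have rg: "real_gaussian M X'" if X: "real_gaussian M X" and e: "AE \<xi> in M. X' \<xi> = X \<xi>" and X'[measurable]: "X' \<in> borel_measurable M" for X X'
    using X unfolding real_gaussian_def
  proof (elim disjE exE conjE)
    fix \<mu> \<sigma> :: real assume \<sigma>: "\<sigma> > 0" and d: "distributed M lborel X (\<lambda>x. ennreal (normal_density \<mu> \<sigma> x))"
    have [measurable]: "X \<in> borel_measurable M" using distributed_measurable[OF d] by simp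
    have "distr M lborel X' = distr M lborel X" by (rule distr_cong_AE) (use e in auto)
    then have "distributed M lborel X' (\<lambda>x. ennreal (normal_density \<mu> \<sigma> x))" using d unfolding distributed_def by simp
    then show "(\<exists>\<mu> \<sigma>. 0 < \<sigma> \<and> distributed M lborel X' (\<lambda>x. ennreal (normal_density \<mu> \<sigma> x))) \<or> X' \<in> borel_measurable M \<and> (\<exists>\<mu>. AE \<xi> in M. X' \<xi> = \<mu>)"
      using \<sigma> by blast
  next
    fix \<mu> assume "AE \<xi> in M. X \<xi> = \<mu>"
    with e have "AE \<xi> in M. X' \<xi> = \<mu>" by eventually_elim simp
    then show "(\<exists>\<mu> \<sigma>. 0 < \<sigma> \<and> distributed M lborel X' (\<lambda>x. ennreal (normal_density \<mu> \<sigma> x))) \<or> X' \<in> borel_measurable M \<and> (\<exists>\<mu>. AE \<xi> in M. X' \<xi> = \<mu>)"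
      by auto
  qed
  have sq: "AE \<xi> in M. (cmod (W' \<phi> \<xi>))\<^sup>2 = (cmod (W \<phi> \<xi>))\<^sup>2" for \<phi>
    using ae by eventually_elim simp
  show ?thesis
    unfolding stationary_gaussian_process_def
  proof (intro conjI ballI allI impI)
    fix \<phi> assume s: "\<phi> \<in> schwartz"
    show "W' \<phi> \<in> borel_measurable M" by (rule W'[OF s])
    have [measurable]: "W \<phi> \<in> borel_measurable M" "W' \<phi> \<in> borel_measurable M" by (rule Wm[OF s], rule W'[OF s])
    have "integrable M (\<lambda>\<xi>. (cmod (W \<phi> \<xi>))\<^sup>2)" using p(1) s by blast
    then show "integrable M (\<lambda>\<xi>. (cmod (W' \<phi> \<xi>))\<^sup>2)"
      by (subst integrable_cong_AE[OF _ _ sq]) auto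
  next
    fix \<phi> \<psi> a b assume s: "\<phi> \<in> schwartz" "\<psi> \<in> schwartz"
    have "AE \<xi> in M. W (\<lambda>t. a * \<phi> t + b * \<psi> t) \<xi> = a * W \<phi> \<xi> + b * W \<psi> \<xi>" by (rule p(2)[rule_format, OF s])
    with ae show "AE \<xi> in M. W' (\<lambda>t. a * \<phi> t + b * \<psi> t) \<xi> = a * W' \<phi> \<xi> + b * W' \<psi> \<xi>" by eventually_elim simp
  next
    fix n :: nat and \<phi> assume s: "\<forall>i<n. \<phi> i \<in> schwartz"
    note g = p(3)[rule_format, of n \<phi>, OF s[rule_format], simplified]
    have Wi[measurable]: "i < n \<Longrightarrow> W (\<phi> i) \<in> borel_measurable M" "i < n \<Longrightarrow> W' (\<phi> i) \<in> borel_measurable M" for i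
      using s Wm W' by auto
    show "jointly_complex_gaussian M n (\<lambda>i. W' (\<phi> i))"
      unfolding jointly_complex_gaussian_def
    proof (intro conjI allI impI)
      fix a b :: "nat \<Rightarrow> real"
      show "real_gaussian M (\<lambda>\<xi>. \<Sum>i<n. a i * Re (W' (\<phi> i) \<xi>) + b i * Im (W' (\<phi> i) \<xi>))"
      proof (rule rg)
        show "real_gaussian M (\<lambda>\<xi>. \<Sum>i<n. a i * Re (W (\<phi> i) \<xi>) + b i * Im (W (\<phi> i) \<xi>))"
          using g[THEN conjunct1, unfolded jointly_complex_gaussian_def, THEN conjunct2] by blast
        show "AE \<xi> in M. (\<Sum>i<n. a i * Re (W' (\<phi> i) \<xi>) + b i * Im (W' (\<phi> i) \<xi>)) = (\<Sum>i<n. a i * Re (W (\<phi> i) \<xi>) + b i * Im (W (\<phi> i) \<xi>))"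
          using ae by eventually_elim simp
        show "(\<lambda>\<xi>. \<Sum>i<n. a i * Re (W' (\<phi> i) \<xi>) + b i * Im (W' (\<phi> i) \<xi>)) \<in> borel_measurable M"
          by (intro borel_measurable_sum borel_measurable_add borel_measurable_times borel_measurable_const
              measurable_compose[OF _ borel_measurable_Re] measurable_compose[OF _ borel_measurable_Im] Wi) auto
      qed
    qed (use Wi in auto)
    have dc: "distr M (Pi\<^sub>M {..<n} (\<lambda>_. borel)) (\<lambda>\<xi>. \<lambda>i\<in>{..<n}. k * W' (\<phi> i) \<xi>) = distr M (Pi\<^sub>M {..<n} (\<lambda>_. borel)) (\<lambda>\<xi>. \<lambda>i\<in>{..<n}. k * W (\<phi> i) \<xi>)" for k :: complex
    proof (rule distr_cong_AE)
      show "AE \<xi> in M. (\<lambda>i\<in>{..<n}. k * W' (\<phi> i) \<xi>) = (\<lambda>i\<in>{..<n}. k * W (\<phi> i) \<xi>)"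
        using ae by eventually_elim simp
    qed (auto intro!: measurable_restrict borel_measurable_times Wi)
    show "circularly_symmetric M n (\<lambda>i. W' (\<phi> i))"
      using g[THEN conjunct2] dc dc[of 1] unfolding circularly_symmetric_def by simp
  next
    fix \<Phi> assume \<Phi>: "schwartz_null_seq \<Phi>"
    then have s: "\<Phi> m \<in> schwartz" for m by (simp add: schwartz_null_seq_def)
    have "(\<integral>\<xi>. (cmod (W' (\<Phi> m) \<xi>))\<^sup>2 \<partial>M) = (\<integral>\<xi>. (cmod (W (\<Phi> m) \<xi>))\<^sup>2 \<partial>M)" for m
    proof (rule integral_cong_AE[OF _ _ sq])
      have [measurable]: "W (\<Phi> m) \<in> borel_measurable M" "W' (\<Phi> m) \<in> borel_measurable M" by (rule Wm[OF s], rule W'[OF s])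
      show "(\<lambda>\<xi>. (cmod (W' (\<Phi> m) \<xi>))\<^sup>2) \<in> borel_measurable M" "(\<lambda>\<xi>. (cmod (W (\<Phi> m) \<xi>))\<^sup>2) \<in> borel_measurable M" by measurable
    qed
    then show "(\<lambda>m. \<integral>\<xi>. (cmod (W' (\<Phi> m) \<xi>))\<^sup>2 \<partial>M) \<longlonglongrightarrow> 0"
      using p(4)[rule_format, OF \<Phi>] by simp
  next
    fix \<psi>1 \<psi>2 assume s: "\<psi>1 \<in> schwartz" "\<psi>2 \<in> schwartz"
    note c = schwartz_cnj[OF s(1)] schwartz_cnj[OF s(2)]
    have "(\<integral>\<xi>. pairing (\<lambda>\<phi>. W' \<phi> \<xi>) \<psi>1 * cnj (pairing (\<lambda>\<phi>. W' \<phi> \<xi>) \<psi>2) \<partial>M) = (\<integral>\<xi>. pairing (\<lambda>\<phi>. W \<phi> \<xi>) \<psi>1 * cnj (pairing (\<lambda>\<phi>. W \<phi> \<xi>) \<psi>2) \<partial>M)"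
      unfolding pairing_def
    proof (rule integral_cong_AE)
      have [measurable]: "W (\<lambda>t. cnj (\<psi>1 t)) \<in> borel_measurable M" "W' (\<lambda>t. cnj (\<psi>1 t)) \<in> borel_measurable M"
        "W (\<lambda>t. cnj (\<psi>2 t)) \<in> borel_measurable M" "W' (\<lambda>t. cnj (\<psi>2 t)) \<in> borel_measurable M"
        by (rule Wm[OF c(1)], rule W'[OF c(1)], rule Wm[OF c(2)], rule W'[OF c(2)])
      show "(\<lambda>\<xi>. W' (\<lambda>t. cnj (\<psi>1 t)) \<xi> * cnj (W' (\<lambda>t. cnj (\<psi>2 t)) \<xi>)) \<in> borel_measurable M"
        "(\<lambda>\<xi>. W (\<lambda>t. cnj (\<psi>1 t)) \<xi> * cnj (W (\<lambda>t. cnj (\<psi>2 t)) \<xi>)) \<in> borel_measurable M" by measurable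
      show "AE \<xi> in M. W' (\<lambda>t. cnj (\<psi>1 t)) \<xi> * cnj (W' (\<lambda>t. cnj (\<psi>2 t)) \<xi>) = W (\<lambda>t. cnj (\<psi>1 t)) \<xi> * cnj (W (\<lambda>t. cnj (\<psi>2 t)) \<xi>)"
        using ae by eventually_elim simp
    qed
    also have "\<dots> = (\<integral>\<omega>. fourier \<psi>2 \<omega> * cnj (fourier \<psi>1 \<omega>) * of_real (S \<omega>) \<partial>lebesgue)"
      by (rule p(5)[rule_format, OF s])
    finally show "(\<integral>\<xi>. pairing (\<lambda>\<phi>. W' \<phi> \<xi>) \<psi>1 * cnj (pairing (\<lambda>\<phi>. W' \<phi> \<xi>) \<psi>2) \<partial>M) = (\<integral>\<omega>. fourier \<psi>2 \<omega> * cnj (fourier \<psi>1 \<omega>) * of_real (S \<omega>) \<partial>lebesgue)" .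
  qed
qed

lemma tempered_add:
  assumes u: "tempered_distribution u" and v: "tempered_distribution v"
  shows "tempered_distribution (\<lambda>\<phi>. u \<phi> + v \<phi>)"
proof -
  note u' = u[unfolded tempered_distribution_def, THEN conjunct1] u[unfolded tempered_distribution_def, THEN conjunct2]
  note v' = v[unfolded tempered_distribution_def, THEN conjunct1] v[unfolded tempered_distribution_def, THEN conjunct2]
  show ?thesis unfolding tempered_distribution_def
  proof (intro conjI ballI allI impI)
    fix \<phi> \<psi> a b assume s: "\<phi> \<in> schwartz" "\<psi> \<in> schwartz"
    show "u (\<lambda>t. a * \<phi> t + b * \<psi> t) + v (\<lambda>t. a * \<phi> t + b * \<psi> t) = a * (u \<phi> + v \<phi>) + b * (u \<psi> + v \<psi>)"
      unfolding u'(1)[rule_format, OF s] v'(1)[rule_format, OF s] by (simp add: algebra_simps)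
  next
    fix \<Phi> assume "schwartz_null_seq \<Phi>"
    from tendsto_add[OF u'(2)[rule_format, OF this] v'(2)[rule_format, OF this]]
    show "(\<lambda>m. u (\<Phi> m) + v (\<Phi> m)) \<longlonglongrightarrow> 0" by simp
  qed
qed

lemma emeasure_count_space_inj_image:
  assumes "inj_on f A"
  shows "emeasure (count_space UNIV) (f ` A) = emeasure (count_space UNIV) A"
proof (cases "finite A")
  case True
  then show ?thesis using card_image[OF assms] by (simp add: emeasure_count_space_finite)
next
  case False
  then have "infinite (f ` A)" using finite_imageD[OF _ assms] by blast
  then show ?thesis using False by (simp add: emeasure_count_space_infinite)
qed

lemma inj_tf_point: "inj_on (\<lambda>(\<tau>, \<omega>). tf_point \<tau> \<omega>) A"
  by (auto simp: inj_on_def tf_point_def)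

lemma spec_zero_count_bargmann:
  assumes u: "tempered_distribution u"
  shows "spec_zero_count u \<Omega> = zero_count (bargmann u) ((\<lambda>(\<tau>, \<omega>). tf_point \<tau> \<omega>) ` \<Omega>)"
proof -
  let ?t = "\<lambda>(\<tau>, \<omega>). tf_point \<tau> \<omega>"
  have z: "spectrogram u \<tau> \<omega> = 0 \<longleftrightarrow> bargmann u (tf_point \<tau> \<omega>) = 0" for \<tau> \<omega>
    unfolding spectrogram_bargmann[OF u] by simp
  have "{z \<in> ?t ` \<Omega>. bargmann u z = 0} = ?t ` {(\<tau>, \<omega>). (\<tau>, \<omega>) \<in> \<Omega> \<and> spectrogram u \<tau> \<omega> = 0}"
    unfolding z by auto
  then show ?thesis unfolding zero_count_def spec_zero_count_def
    by (simp only: emeasure_count_space_inj_image[OF inj_tf_point])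
qed

lemma tf_point_image_borel:
  assumes "\<Omega> \<in> sets borel" shows "(\<lambda>(\<tau>, \<omega>). tf_point \<tau> \<omega>) ` \<Omega> \<in> sets borel"
proof -
  have [measurable]: "(\<lambda>z. (Re z, - Im z)) \<in> borel_measurable borel"
    by (intro borel_measurable_continuous_onI continuous_intros)
  have "(\<lambda>z. (Re z, - Im z)) -` \<Omega> \<inter> space borel \<in> sets borel"
    by (rule measurable_sets[OF _ assms]) measurable
  also have "(\<lambda>z. (Re z, - Im z)) -` \<Omega> \<inter> space borel = (\<lambda>(\<tau>, \<omega>). tf_point \<tau> \<omega>) ` \<Omega>"
    by (force simp: tf_point_def image_iff complex_eq_iff)
  finally show ?thesis .
qed

theorem theorem1p1:
  fixes M :: "'x measure"
    and S :: "real \<Rightarrow> real"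
    and f1 :: "(real \<Rightarrow> complex) \<Rightarrow> complex"
    and W :: "(real \<Rightarrow> complex) \<Rightarrow> 'x \<Rightarrow> complex"
    and f :: "'x \<Rightarrow> (real \<Rightarrow> complex) \<Rightarrow> complex"
    and \<Omega> :: "(real \<times> real) set"
  assumes "prob_space M"
    and "f1 \<in> modulation_space_infty"
    and "S \<in> borel_measurable lebesgue"
    and "\<And>\<omega>. 0 \<le> S \<omega>"
    and "\<not> (AE \<omega> in lebesgue. S \<omega> = 0)"
    and "polynomial_growth S"
    and "stationary_gaussian_process M S W"
    and "AE \<xi> in M. tempered_distribution (\<lambda>\<phi>. W \<phi> \<xi>)"
    and "\<And>\<xi> \<phi>. f \<xi> \<phi> = f1 \<phi> + W \<phi> \<xi>"
    and "\<Omega> \<in> sets borel"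
  shows "(\<forall>\<tau> \<omega>. 0 \<le> rho1_spec S f1 \<tau> \<omega>) \<and>
         (\<lambda>\<xi>. spec_zero_count (f \<xi>) \<Omega>) \<in> borel_measurable (completion M) \<and>
         (\<integral>\<^sup>+\<xi>. spec_zero_count (f \<xi>) \<Omega> \<partial>M) =
           (\<integral>\<^sup>+(\<tau>, \<omega>)\<in>\<Omega>. ennreal (rho1_spec S f1 \<tau> \<omega>) \<partial>lborel)"
proof -
  interpret prob_space M by fact
  have f1: "tempered_distribution f1" using assms(2) by (simp add: modulation_space_infty_def)
  obtain N where N: "N \<in> null_sets M" "{\<xi>\<in>space M. \<not> tempered_distribution (\<lambda>\<phi>. W \<phi> \<xi>)} \<subseteq> N"
    using assms(8) unfolding eventually_ae_filter by blast
  \<comment> \<open>\<open>N\<close> is a measurable null set containing all points with a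
    realization that is not tempered. Setting the process to 0 there gives the zero distribution,
    which is tempered, and keeps measurability.\<close>
  define W' where "W' \<phi> \<xi> = (if \<xi> \<in> N then 0 else W \<phi> \<xi>)" for \<phi> \<xi>
  have ae: "AE \<xi> in M. \<forall>\<phi>. W' \<phi> \<xi> = W \<phi> \<xi>"
    by (rule AE_mp[OF AE_not_in[OF N(1)]]) (auto simp: W'_def)
  have Nm[measurable]: "N \<in> sets M" using N(1) by (rule null_setsD2)
  have proc: "stationary_gaussian_process M S W'"
  proof (rule stationary_gaussian_process_cong_AE[OF assms(7) ae])
    fix \<phi> assume "\<phi> \<in> schwartz"
    then have [measurable]: "W \<phi> \<in> borel_measurable M"
      using assms(7)[unfolded stationary_gaussian_process_def, THEN conjunct1] by blast
    show "W' \<phi> \<in> borel_measurable M" unfolding W'_def by measurable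
  qed
  have "tempered_distribution (\<lambda>\<phi>. W' \<phi> \<xi>)" if "\<xi> \<in> space M" for \<xi>
  proof (cases "\<xi> \<in> N")
    case True
    then show ?thesis by (simp add: W'_def tempered_distribution_def)
  next
    case False
    then show ?thesis using N(2) that by (auto simp: W'_def)
  qed
  then interpret gaussian_noise M S W'
    using assms(3-6) proc by unfold_locales auto
  let ?t = "\<lambda>(\<tau>, \<omega>). tf_point \<tau> \<omega>"
  let ?G = "bargmann f1"
  let ?Z = "\<lambda>\<xi>. zero_count_nz (\<lambda>z. ?G z + noise \<xi> z) (?t ` \<Omega>)"
  note G = bargmann_holomorphic[OF f1, of UNIV]
  note \<Omega>' = tf_point_image_borel[OF assms(10)]
  have cnt: "AE \<xi> in M. spec_zero_count (f \<xi>) \<Omega> = ?Z \<xi>"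
    using field_not_identically_zero[of ?G] assms(8) ae
  proof eventually_elim
    case (elim \<xi>)
    have fe: "f \<xi> = (\<lambda>\<phi>. f1 \<phi> + W \<phi> \<xi>)" using assms(9) by blast
    have "tempered_distribution (f \<xi>)" unfolding fe by (rule tempered_add[OF f1 elim(2)])
    moreover have "bargmann (f \<xi>) = (\<lambda>z. ?G z + noise \<xi> z)"
      using elim(3) unfolding fe bargmann_def noise_def WF_def gam_at_def by auto
    ultimately show ?case using elim(1)
      by (simp only: spec_zero_count_bargmann zero_count_nz_def if_False)
  qed
  have Zm: "?Z \<in> borel_measurable M" by (rule zero_count_field_measurable[OF G \<Omega>'])
  have tm: "?t \<in> borel_measurable (lborel :: (real \<times> real) measure)"
    unfolding tf_point_def lborel_prod[symmetric] by measurable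
  have "(\<lambda>\<xi>. spec_zero_count (f \<xi>) \<Omega>) \<in> borel_measurable (completion M)"
    by (rule measurable_completion_cong_AE[OF Zm cnt]) simp
  moreover have "(\<integral>\<^sup>+\<xi>. spec_zero_count (f \<xi>) \<Omega> \<partial>M) = (\<integral>\<^sup>+(\<tau>, \<omega>)\<in>\<Omega>. ennreal (rho1_spec S f1 \<tau> \<omega>) \<partial>lborel)"
  proof -
    have "(\<integral>\<^sup>+\<xi>. spec_zero_count (f \<xi>) \<Omega> \<partial>M) = (\<integral>\<^sup>+\<xi>. ?Z \<xi> \<partial>M)"
      by (rule nn_integral_cong_AE[OF cnt])
    also have "\<dots> = (\<integral>\<^sup>+z. ennreal (intensity ?G z) * indicator (?t ` \<Omega>) z \<partial>lborel)"
      by (rule expected_zero_count(1)[OF G \<Omega>'])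
    also have "\<dots> = (\<integral>\<^sup>+p. ennreal (intensity ?G (?t p)) * indicator (?t ` \<Omega>) (?t p) \<partial>lborel)"
      by (subst lborel_complex_eq_distr_tf, rule nn_integral_distr[OF tm]) (simp add: expected_zero_count(2)[OF G \<Omega>'])
    also have "\<dots> = (\<integral>\<^sup>+(\<tau>, \<omega>)\<in>\<Omega>. ennreal (rho1_spec S f1 \<tau> \<omega>) \<partial>lborel)"
    proof (rule nn_integral_cong)
      fix p :: "real \<times> real"
      have "tf_point \<tau> \<omega> \<in> ?t ` \<Omega> \<longleftrightarrow> (\<tau>, \<omega>) \<in> \<Omega>" for \<tau> \<omega>
        by (force simp: tf_point_def image_iff)
      then show "ennreal (intensity ?G (?t p)) * indicator (?t ` \<Omega>) (?t p) = (case p of (\<tau>, \<omega>) \<Rightarrow> ennreal (rho1_spec S f1 \<tau> \<omega>)) * indicator \<Omega> p"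
        by (cases p) (simp add: intensity_eq_rho1[OF f1] indicator_def)
    qed
    finally show ?thesis .
  qed
  ultimately show ?thesis using rho1_nonneg[OF f1] by blast
qed

end
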